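(* Let $P$ be the terminal symmetric operad in $\mathbf{Set}$ (whose algebras are commutative monoids), let $\Phi\in\mathbf{Set}^{\mathbb{N}}$ be its standard signature, with $\Phi_0=\{e\}$, $\Phi_2=\{\,.\,\}$ and $\Phi_n=\emptyset$ for all other $n$, and let $Q$ be the categorification of $P$ with respect to $\Phi$. Then for every category $\mathcal{C}$, the $Q$-algebra structures on $\mathcal{C}$ are in one-to-one correspondence with the symmetric monoidal category structures $(\otimes,I,\alpha,\lambda,\rho,\tau)$ on $\mathcal{C}$. The correspondence sends a $Q$-algebra structure $\widehat{(\ )}:Q\to\mathrm{End}(\mathcal{C})$ to the structure with $\otimes=\hat{.}$, $I=\hat e$, $\alpha=\hat\delta_1$, $\lambda=\hat\delta_2$, $\rho=\hat\delta_3$, $\tau=\hat\delta_4$, where $\delta_1,\dots,\delta_4$ are the unique arrows of $Q$ of the following types: $$\delta_1:\ .\circ(1,.)\to .\circ(.,1),\qquad \delta_2:\ .\circ(e,1)\to 1,\qquad \delta_3:\ .\circ(1,e)\to 1,\qquad \delta_4:\ (12)\cdot .\ \to\ .\,,$$ $(12)$ being the non-identity permutation of $\{1,2\}$.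
   Context: Natural numbers include $0$. Symmetric operads. A symmetric operad $P$ in $\mathbf{Set}$ consists of sets $P_0,P_1,P_2,\dots$, composition functions $\circ: P_n\times P_{k_1}\times\cdots\times P_{k_n}\to P_{k_1+\cdots+k_n}$ for all $n,k_1,\dots,k_n\in\mathbb{N}$, a unit $1\in P_1$, and a left action of the symmetric group $S_n$ on each $P_n$, such that composition is associative, $1\circ f=f=f\circ(1,\dots,1)$, and composition is equivariant in the usual sense: $(\sigma\cdot f)\circ(g_1,\dots,g_n)=\hat\sigma\cdot\big(f\circ(g_{\sigma(1)},\dots,g_{\sigma(n)})\big)$, where $\hat\sigma$ is the block permutation sending the $j$-th position of the $i$-th block (of size $k_{\sigma(i)}$) to the $j$-th position of the $\sigma(i)$-th block in the ordering with block sizes $k_1,\dots,k_n$; and $f\circ(\sigma_1\cdot g_1,\dots,\sigma_n\cdot g_n)=(\sigma_1\oplus\cdots\oplus\sigma_n)\cdot(f\circ(g_1,\dots,g_n))$. A morphism is a sequence of functions preserving composition, unit and the symmetric group actions. The resulting category is $\Sigma\text{-}\mathbf{Operad}$. Symmetric $\mathbf{Cat}$-operads and their morphisms are defined in the same way internally to $\mathbf{Cat}$ with its finite products (each $P_n$ is a category, the structure maps are functors, all axioms hold strictly, morphisms are sequences of functors preserving the structure strictly). Symmetric operads in $\mathbf{Set}$ are regarded as symmetric $\mathbf{Cat}$-operads by viewing sets as discrete categories. Algebras. For a category $\mathcal{C}$, $\mathrm{End}(\mathcal{C})$ is the symmetric $\mathbf{Cat}$-operad whose $n$-th category is the category of functors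 $\mathcal{C}^n\to\mathcal{C}$ and natural transformations, with composition given by substitution and with $(\sigma\cdot G)(A_1,\dots,A_n)=G(A_{\sigma(1)},\dots,A_{\sigma(n)})$. For a symmetric $\mathbf{Cat}$-operad $Q$, a $Q$-algebra structure on $\mathcal{C}$ is a morphism of symmetric $\mathbf{Cat}$-operads $\widehat{(\ )}:Q\to\mathrm{End}(\mathcal{C})$. Signatures and categorification. Let $U:\Sigma\text{-}\mathbf{Operad}\to\mathbf{Set}^{\mathbb{N}}$ be the forgetful functor and $F$ its left adjoint. A signature for $P$ is a pair $(\Phi,\phi)$ with $\Phi\in\mathbf{Set}^{\mathbb{N}}$ and $\phi:F\Phi\to P$ a regular epimorphism in $\Sigma\text{-}\mathbf{Operad}$; here $P$ is terminal, so $\phi$ is the unique morphism. Factor $\phi$, as a morphism of symmetric $\mathbf{Cat}$-operads, as $F\Phi\xrightarrow{\,b\,}Q\xrightarrow{\,f\,}P$ with each $b_n$ bijective on objects and each $f_n$ full and faithful; the symmetric $\mathbf{Cat}$-operad $Q$, unique up to isomorphism, is the categorification of $P$ with respect to $(\Phi,\phi)$. Objects of $Q_n$ are identified with elements of $(F\Phi)_n$ via $b$, so $e\in Q_0$ and $.\in Q_2$ are objects of $Q$. Since $P$ is terminal, there is exactly one arrow in $Q_n$ between any two objects of $Q_n$. Symmetric monoidal categories. A symmetric monoidal category structure on $\mathcal{C}$ consists of a functor $\otimes:\mathcal{C}\times\mathcal{C}\to\mathcal{C}$, an object $I\in\mathcal{C}$, and natural isomorphisms with components $\alpha_{A,B,C}:A\otimes(B\otimes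 C)\to(A\otimes B)\otimes C$, $\lambda_A:I\otimes A\to A$, $\rho_A:A\otimes I\to A$, and $\tau:(12)\cdot\otimes\to\otimes$, satisfying the usual (Mac Lane) axioms for a symmetric monoidal category. *)

theory Defs
  imports "HOL-Combinatorics.Permutations" "HOL-Library.FuncSet"
begin

section \<open>Categories, functors, natural transformations\<close>

record ('o, 'a) category =
  Ob :: "'o set"
  Arr :: "'a set"
  Dom :: "'a \<Rightarrow> 'o"
  Cod :: "'a \<Rightarrow> 'o"
  Idn :: "'o \<Rightarrow> 'a"
  Cmp :: "'a \<Rightarrow> 'a \<Rightarrow> 'a"  \<comment> \<open>\<open>Cmp C g f\<close> is \<open>g\<close> after \<open>f\<close>\<close>

definition Hom :: "('o, 'a) category \<Rightarrow> 'o \<Rightarrow> 'o \<Rightarrow> 'a set" where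
  "Hom C x y = {f \<in> Arr C. Dom C f = x \<and> Cod C f = y}"

definition is_category :: "('o, 'a) category \<Rightarrow> bool" where
  "is_category C \<longleftrightarrow>
     (\<forall>f\<in>Arr C. Dom C f \<in> Ob C \<and> Cod C f \<in> Ob C) \<and>
     (\<forall>x\<in>Ob C. Idn C x \<in> Hom C x x) \<and>
     (\<forall>f\<in>Arr C. \<forall>g\<in>Arr C. Dom C g = Cod C f \<longrightarrow> Cmp C g f \<in> Hom C (Dom C f) (Cod C g)) \<and>
     (\<forall>f\<in>Arr C. Cmp C f (Idn C (Dom C f)) = f \<and> Cmp C (Idn C (Cod C f)) f = f) \<and>
     (\<forall>f\<in>Arr C. \<forall>g\<in>Arr C. \<forall>h\<in>Arr C. Dom C g = Cod C f \<longrightarrow> Dom C h = Cod C g \<longrightarrow>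
        Cmp C h (Cmp C g f) = Cmp C (Cmp C h g) f)"

definition is_iso :: "('o, 'a) category \<Rightarrow> 'a \<Rightarrow> bool" where
  "is_iso C f \<longleftrightarrow> f \<in> Arr C \<and>
     (\<exists>g\<in>Hom C (Cod C f) (Dom C f).
        Cmp C g f = Idn C (Dom C f) \<and> Cmp C f g = Idn C (Cod C f))"

record ('o, 'a, 'p, 'b) ftor =
  omap :: "'o \<Rightarrow> 'p"
  amap :: "'a \<Rightarrow> 'b"

definition is_functor ::
  "('o, 'a) category \<Rightarrow> ('p, 'b) category \<Rightarrow> ('o, 'a, 'p, 'b) ftor \<Rightarrow> bool" where
  "is_functor A B F \<longleftrightarrow>
     (\<forall>x\<in>Ob A. omap F x \<in> Ob B) \<and>
     (\<forall>f\<in>Arr A. amap F f \<in> Hom B (omap F (Dom A f)) (omap F (Cod A f))) \<and>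
     (\<forall>x\<in>Ob A. amap F (Idn A x) = Idn B (omap F x)) \<and>
     (\<forall>f\<in>Arr A. \<forall>g\<in>Arr A. Dom A g = Cod A f \<longrightarrow>
        amap F (Cmp A g f) = Cmp B (amap F g) (amap F f))"

text \<open>Functors, natural transformations and morphisms are required to be extensional
  (\<open>undefined\<close> outside their domain) wherever they are counted or compared, so that equality
  in HOL is equality of the mathematical objects.\<close>

definition functors ::
  "('o, 'a) category \<Rightarrow> ('p, 'b) category \<Rightarrow> ('o, 'a, 'p, 'b) ftor set" where
  "functors A B = {F. is_functor A B F \<and> omap F \<in> extensional (Ob A) \<and> amap F \<in> extensional (Arr A)}"

definition full_and_faithful ::
  "('o, 'a) category \<Rightarrow> ('p, 'b) category \<Rightarrow> ('o, 'a, 'p, 'b) ftor \<Rightarrow> bool" where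
  "full_and_faithful A B F \<longleftrightarrow>
     (\<forall>x\<in>Ob A. \<forall>y\<in>Ob A. bij_betw (amap F) (Hom A x y) (Hom B (omap F x) (omap F y)))"

definition is_natural ::
  "('o, 'a) category \<Rightarrow> ('p, 'b) category \<Rightarrow> ('o, 'a, 'p, 'b) ftor \<Rightarrow> ('o, 'a, 'p, 'b) ftor \<Rightarrow>
     ('o \<Rightarrow> 'b) \<Rightarrow> bool" where
  "is_natural A B F G \<eta> \<longleftrightarrow>
     \<eta> \<in> extensional (Ob A) \<and>
     (\<forall>x\<in>Ob A. \<eta> x \<in> Hom B (omap F x) (omap G x)) \<and>
     (\<forall>f\<in>Arr A. Cmp B (\<eta> (Cod A f)) (amap F f) = Cmp B (amap G f) (\<eta> (Dom A f)))"

definition is_natural_iso ::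
  "('o, 'a) category \<Rightarrow> ('p, 'b) category \<Rightarrow> ('o, 'a, 'p, 'b) ftor \<Rightarrow> ('o, 'a, 'p, 'b) ftor \<Rightarrow>
     ('o \<Rightarrow> 'b) \<Rightarrow> bool" where
  "is_natural_iso A B F G \<eta> \<longleftrightarrow> is_natural A B F G \<eta> \<and> (\<forall>x\<in>Ob A. is_iso B (\<eta> x))"

record ('o, 'a, 'p, 'b) ntrans =
  nsrc :: "('o, 'a, 'p, 'b) ftor"
  ntgt :: "('o, 'a, 'p, 'b) ftor"
  ncmp :: "'o \<Rightarrow> 'b"

definition functor_cat ::
  "('o, 'a) category \<Rightarrow> ('p, 'b) category \<Rightarrow>
     (('o, 'a, 'p, 'b) ftor, ('o, 'a, 'p, 'b) ntrans) category" where
  "functor_cat A B =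
     \<lparr> Ob = functors A B,
       Arr = {t. nsrc t \<in> functors A B \<and> ntgt t \<in> functors A B \<and>
                 is_natural A B (nsrc t) (ntgt t) (ncmp t)},
       Dom = nsrc,
       Cod = ntgt,
       Idn = (\<lambda>F. \<lparr>nsrc = F, ntgt = F, ncmp = (\<lambda>x\<in>Ob A. Idn B (omap F x))\<rparr>),
       Cmp = (\<lambda>t s. \<lparr>nsrc = nsrc s, ntgt = ntgt t,
                     ncmp = (\<lambda>x\<in>Ob A. Cmp B (ncmp t x) (ncmp s x))\<rparr>) \<rparr>"

definition discrete_cat :: "'p set \<Rightarrow> ('p, 'p) category" where
  "discrete_cat S =
     \<lparr> Ob = S, Arr = S, Dom = (\<lambda>x. x), Cod = (\<lambda>x. x), Idn = (\<lambda>x. x), Cmp = (\<lambda>x y. x) \<rparr>"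

definition prod_cat ::
  "('o, 'a) category \<Rightarrow> ('p, 'b) category \<Rightarrow> ('o \<times> 'p, 'a \<times> 'b) category" where
  "prod_cat A B =
     \<lparr> Ob = Ob A \<times> Ob B,
       Arr = Arr A \<times> Arr B,
       Dom = map_prod (Dom A) (Dom B),
       Cod = map_prod (Cod A) (Cod B),
       Idn = map_prod (Idn A) (Idn B),
       Cmp = (\<lambda>(g, g') (f, f'). (Cmp A g f, Cmp B g' f')) \<rparr>"

definition list_prod :: "'p set list \<Rightarrow> 'p list set" where
  "list_prod Ss = {xs. list_all2 (\<in>) xs Ss}"

definition list_prod_cat :: "('o, 'a) category list \<Rightarrow> ('o list, 'a list) category" where
  "list_prod_cat Cs =
     \<lparr> Ob = list_prod (map Ob Cs),
       Arr = list_prod (map Arr Cs),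
       Dom = map2 Dom Cs,
       Cod = map2 Cod Cs,
       Idn = map2 Idn Cs,
       Cmp = (\<lambda>gs fs. map2 (\<lambda>C (g, f). Cmp C g f) Cs (zip gs fs)) \<rparr>"

definition power_cat :: "('o, 'a) category \<Rightarrow> nat \<Rightarrow> ('o list, 'a list) category" where
  "power_cat C n = list_prod_cat (replicate n C)"


section \<open>Block permutations\<close>

text \<open>Everything is indexed from 0: \<open>S\<^sub>n\<close> consists of the \<open>\<sigma>\<close> with \<open>\<sigma> permutes {..<n}\<close>, and
  \<open>permute_list \<sigma> [A\<^sub>0, \<dots>] = [A\<^bsub>\<sigma> 0\<^esub>, \<dots>]\<close>.\<close>

definition block_start :: "nat list \<Rightarrow> nat \<Rightarrow> nat" where
  "block_start ks i = sum_list (take i ks)"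

definition perm_of_list :: "nat list \<Rightarrow> nat \<Rightarrow> nat" where
  "perm_of_list xs p = (if p < length xs then xs ! p else p)"

text \<open>\<open>block_perm ks \<sigma>\<close> is \<open>\<sigma>\<close> with a hat: the \<open>i\<close>-th segment of the list below, of length
  \<open>ks ! \<sigma> i\<close>, enumerates the \<open>\<sigma> i\<close>-th block for the block sizes \<open>ks\<close>.\<close>

definition block_perm :: "nat list \<Rightarrow> (nat \<Rightarrow> nat) \<Rightarrow> nat \<Rightarrow> nat" where
  "block_perm ks \<sigma> =
     perm_of_list (concat (map (\<lambda>i. map (\<lambda>j. block_start ks (\<sigma> i) + j) [0..<ks ! \<sigma> i]) [0..<length ks]))"

definition perm_sum :: "nat list \<Rightarrow> (nat \<Rightarrow> nat) list \<Rightarrow> nat \<Rightarrow> nat" where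
  "perm_sum ks \<sigma>s =
     perm_of_list (concat (map (\<lambda>i. map (\<lambda>j. block_start ks i + (\<sigma>s ! i) j) [0..<ks ! i]) [0..<length ks]))"


section \<open>Symmetric operads in Set\<close>

text \<open>In \<open>opcomp P [k\<^sub>1, \<dots>, k\<^sub>n] f [g\<^sub>1, \<dots>, g\<^sub>n]\<close> and \<open>opact P n \<sigma> f\<close> the arities are explicit
  arguments because the sets \<open>ops P n\<close> need not be disjoint.\<close>

record 'p operad =
  ops :: "nat \<Rightarrow> 'p set"
  opcomp :: "nat list \<Rightarrow> 'p \<Rightarrow> 'p list \<Rightarrow> 'p"
  opunit :: 'p
  opact :: "nat \<Rightarrow> (nat \<Rightarrow> nat) \<Rightarrow> 'p \<Rightarrow> 'p"

locale symmetric_operad =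
  fixes P :: "'p operad"
  assumes comp_closed:
    "\<lbrakk>f \<in> ops P (length ks); gs \<in> list_prod (map (ops P) ks)\<rbrakk>
       \<Longrightarrow> opcomp P ks f gs \<in> ops P (sum_list ks)"
  and unit_closed: "opunit P \<in> ops P 1"
  and act_closed: "\<lbrakk>\<sigma> permutes {..<n}; f \<in> ops P n\<rbrakk> \<Longrightarrow> opact P n \<sigma> f \<in> ops P n"
  and comp_assoc:
    "\<lbrakk>f \<in> ops P (length kss); gs \<in> list_prod (map (ops P \<circ> length) kss);
      list_all2 (\<lambda>hs ks. hs \<in> list_prod (map (ops P) ks)) hss kss\<rbrakk>
       \<Longrightarrow> opcomp P (concat kss) (opcomp P (map length kss) f gs) (concat hss)
         = opcomp P (map sum_list kss) f (map2 (\<lambda>ks (g, hs). opcomp P ks g hs) kss (zip gs hss))"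
  and unit_left: "f \<in> ops P n \<Longrightarrow> opcomp P [n] (opunit P) [f] = f"
  and unit_right: "f \<in> ops P n \<Longrightarrow> opcomp P (replicate n 1) f (replicate n (opunit P)) = f"
  and act_id: "f \<in> ops P n \<Longrightarrow> opact P n id f = f"
  and act_comp:
    "\<lbrakk>\<sigma> permutes {..<n}; \<tau> permutes {..<n}; f \<in> ops P n\<rbrakk>
       \<Longrightarrow> opact P n (\<sigma> \<circ> \<tau>) f = opact P n \<sigma> (opact P n \<tau> f)"
  and equivariant_outer:
    "\<lbrakk>\<sigma> permutes {..<length ks}; f \<in> ops P (length ks); gs \<in> list_prod (map (ops P) ks)\<rbrakk>
       \<Longrightarrow> opcomp P ks (opact P (length ks) \<sigma> f) gs
         = opact P (sum_list ks) (block_perm ks \<sigma>) (opcomp P (permute_list \<sigma> ks) f (permute_list \<sigma> gs))"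
  and equivariant_inner:
    "\<lbrakk>f \<in> ops P (length ks); gs \<in> list_prod (map (ops P) ks);
      list_all2 (\<lambda>\<sigma> k. \<sigma> permutes {..<k}) \<sigma>s ks\<rbrakk>
       \<Longrightarrow> opcomp P ks f (map2 (\<lambda>k (\<sigma>, g). opact P k \<sigma> g) ks (zip \<sigma>s gs))
         = opact P (sum_list ks) (perm_sum ks \<sigma>s) (opcomp P ks f gs)"

definition operad_morphism :: "'p operad \<Rightarrow> 'r operad \<Rightarrow> (nat \<Rightarrow> 'p \<Rightarrow> 'r) \<Rightarrow> bool" where
  "operad_morphism P R h \<longleftrightarrow>
     (\<forall>n. h n \<in> ops P n \<rightarrow>\<^sub>E ops R n) \<and>
     h 1 (opunit P) = opunit R \<and>
     (\<forall>n \<sigma> f. \<sigma> permutes {..<n} \<longrightarrow> f \<in> ops P n \<longrightarrow> h n (opact P n \<sigma> f) = opact R n \<sigma> (h n f)) \<and>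
     (\<forall>ks f gs. f \<in> ops P (length ks) \<longrightarrow> gs \<in> list_prod (map (ops P) ks) \<longrightarrow>
        h (sum_list ks) (opcomp P ks f gs) = opcomp R ks (h (length ks) f) (map2 h ks gs))"

definition terminal_operad :: "unit operad" where
  "terminal_operad =
     \<lparr> ops = (\<lambda>n. {()}), opcomp = (\<lambda>ks f gs. ()), opunit = (), opact = (\<lambda>n \<sigma> f. ()) \<rparr>"


section \<open>The free symmetric operad\<close>

text \<open>\<open>(F\<Phi>)\<^sub>n\<close> consists of the trees whose nodes with \<open>k\<close> children are labelled by \<open>\<Phi>\<^sub>k\<close> and whose
  leaves are labelled bijectively by \<open>{0, \<dots>, n - 1}\<close>; equivalently, of a planar tree with
  \<open>n\<close> leaves together with a permutation in \<open>S\<^sub>n\<close>. That this is the value at \<open>\<Phi>\<close> of the left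
  adjoint of the forgetful functor is \<open>free_operad_universal\<close> below.\<close>

datatype ('g, 'v) optree = Leaf 'v | Node 'g "('g, 'v) optree list"

primrec leaves :: "('g, 'v) optree \<Rightarrow> 'v list" where
  "leaves (Leaf v) = [v]"
| "leaves (Node g ts) = concat (map leaves ts)"

primrec well_formed :: "(nat \<Rightarrow> 'g set) \<Rightarrow> ('g, 'v) optree \<Rightarrow> bool" where
  "well_formed \<Phi> (Leaf v) \<longleftrightarrow> True"
| "well_formed \<Phi> (Node g ts) \<longleftrightarrow> g \<in> \<Phi> (length ts) \<and> list_all (well_formed \<Phi>) ts"

primrec graft :: "('v \<Rightarrow> ('g, 'w) optree) \<Rightarrow> ('g, 'v) optree \<Rightarrow> ('g, 'w) optree" where
  "graft s (Leaf v) = s v"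
| "graft s (Node g ts) = Node g (map (graft s) ts)"

definition relabel :: "('v \<Rightarrow> 'w) \<Rightarrow> ('g, 'v) optree \<Rightarrow> ('g, 'w) optree" where
  "relabel h = graft (\<lambda>v. Leaf (h v))"

definition free_operad :: "(nat \<Rightarrow> 'g set) \<Rightarrow> ('g, nat) optree operad" where
  "free_operad \<Phi> =
     \<lparr> ops = (\<lambda>n. {t. well_formed \<Phi> t \<and> distinct (leaves t) \<and> set (leaves t) = {..<n}}),
       opcomp = (\<lambda>ks t ts. graft (\<lambda>i. relabel (\<lambda>j. block_start ks i + j) (ts ! i)) t),
       opunit = Leaf 0,
       opact = (\<lambda>n \<sigma>. relabel \<sigma>) \<rparr>"

definition generator :: "nat \<Rightarrow> 'g \<Rightarrow> ('g, nat) optree" where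
  "generator n g = Node g (map Leaf [0..<n])"


section \<open>Symmetric Cat-operads\<close>

record ('o, 'a) cat_operad =
  cat_at :: "nat \<Rightarrow> ('o, 'a) category"
  ccomp :: "nat list \<Rightarrow> ('o \<times> 'o list, 'a \<times> 'a list, 'o, 'a) ftor"
  cunit :: 'o
  cact :: "nat \<Rightarrow> (nat \<Rightarrow> nat) \<Rightarrow> ('o, 'a, 'o, 'a) ftor"

definition obj_operad :: "('o, 'a) cat_operad \<Rightarrow> 'o operad" where
  "obj_operad Q =
     \<lparr> ops = (\<lambda>n. Ob (cat_at Q n)),
       opcomp = (\<lambda>ks f gs. omap (ccomp Q ks) (f, gs)),
       opunit = cunit Q,
       opact = (\<lambda>n \<sigma>. omap (cact Q n \<sigma>)) \<rparr>"

text \<open>A functor \<open>1 \<rightarrow> Q\<^sub>1\<close> picks out an object together with its identity arrow.\<close>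

definition arr_operad :: "('o, 'a) cat_operad \<Rightarrow> 'a operad" where
  "arr_operad Q =
     \<lparr> ops = (\<lambda>n. Arr (cat_at Q n)),
       opcomp = (\<lambda>ks f gs. amap (ccomp Q ks) (f, gs)),
       opunit = Idn (cat_at Q 1) (cunit Q),
       opact = (\<lambda>n \<sigma>. amap (cact Q n \<sigma>)) \<rparr>"

text \<open>An equation between functors holds iff it holds on objects and on arrows, so the operad
  axioms internal to \<open>Cat\<close> are the operad axioms for objects and for arrows.\<close>

locale symmetric_cat_operad =
  fixes Q :: "('o, 'a) cat_operad"
  assumes cat: "is_category (cat_at Q n)"
  and comp_functor:
    "is_functor (prod_cat (cat_at Q (length ks)) (list_prod_cat (map (cat_at Q) ks)))
       (cat_at Q (sum_list ks)) (ccomp Q ks)"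
  and act_functor: "\<sigma> permutes {..<n} \<Longrightarrow> is_functor (cat_at Q n) (cat_at Q n) (cact Q n \<sigma>)"
  and obj_axioms: "symmetric_operad (obj_operad Q)"
  and arr_axioms: "symmetric_operad (arr_operad Q)"

definition cat_operad_morphism ::
  "('o, 'a) cat_operad \<Rightarrow> ('p, 'b) cat_operad \<Rightarrow> (nat \<Rightarrow> ('o, 'a, 'p, 'b) ftor) \<Rightarrow> bool" where
  "cat_operad_morphism Q R h \<longleftrightarrow>
     (\<forall>n. h n \<in> functors (cat_at Q n) (cat_at R n)) \<and>
     operad_morphism (obj_operad Q) (obj_operad R) (\<lambda>n. omap (h n)) \<and>
     operad_morphism (arr_operad Q) (arr_operad R) (\<lambda>n. amap (h n))"

definition discrete_operad :: "'p operad \<Rightarrow> ('p, 'p) cat_operad" where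
  "discrete_operad P =
     \<lparr> cat_at = (\<lambda>n. discrete_cat (ops P n)),
       ccomp = (\<lambda>ks. \<lparr>omap = (\<lambda>(f, gs). opcomp P ks f gs), amap = (\<lambda>(f, gs). opcomp P ks f gs)\<rparr>),
       cunit = opunit P,
       cact = (\<lambda>n \<sigma>. \<lparr>omap = opact P n \<sigma>, amap = opact P n \<sigma>\<rparr>) \<rparr>"


section \<open>Categorification\<close>

definition is_categorification ::
  "'p operad \<Rightarrow> (nat \<Rightarrow> 'g set) \<Rightarrow> (nat \<Rightarrow> ('g, nat) optree \<Rightarrow> 'p) \<Rightarrow> ('o, 'a) cat_operad \<Rightarrow>
     (nat \<Rightarrow> (('g, nat) optree, ('g, nat) optree, 'o, 'a) ftor) \<Rightarrow>
     (nat \<Rightarrow> ('o, 'a, 'p, 'p) ftor) \<Rightarrow> bool" where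
  "is_categorification P \<Phi> \<phi> Q b f \<longleftrightarrow>
     symmetric_cat_operad Q \<and>
     cat_operad_morphism (discrete_operad (free_operad \<Phi>)) Q b \<and>
     cat_operad_morphism Q (discrete_operad P) f \<and>
     (\<forall>n. bij_betw (omap (b n)) (ops (free_operad \<Phi>) n) (Ob (cat_at Q n))) \<and>
     (\<forall>n. full_and_faithful (cat_at Q n) (discrete_cat (ops P n)) (f n)) \<and>
     (\<forall>n. \<forall>t\<in>ops (free_operad \<Phi>) n. omap (f n) (omap (b n) t) = \<phi> n t)"

datatype cmon_gen = Gen_e | Gen_dot

definition cmon_signature :: "nat \<Rightarrow> cmon_gen set" where
  "cmon_signature n = (if n = 0 then {Gen_e} else if n = 2 then {Gen_dot} else {})"


section \<open>The endomorphism operad and algebras\<close>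

primrec blocks :: "nat list \<Rightarrow> 'x list \<Rightarrow> 'x list list" where
  "blocks [] xs = []"
| "blocks (k # ks) xs = take k xs # blocks ks (drop k xs)"

definition End_operad ::
  "('o, 'a) category \<Rightarrow>
     (('o list, 'a list, 'o, 'a) ftor, ('o list, 'a list, 'o, 'a) ntrans) cat_operad" where
  "End_operad C =
    (let
       comp_ob = (\<lambda>ks (G, Hs).
         \<lparr>omap = (\<lambda>xs\<in>Ob (power_cat C (sum_list ks)). omap G (map2 omap Hs (blocks ks xs))),
          amap = (\<lambda>fs\<in>Arr (power_cat C (sum_list ks)). amap G (map2 amap Hs (blocks ks fs)))\<rparr>);
       act_ob = (\<lambda>n \<sigma> G.
         \<lparr>omap = (\<lambda>xs\<in>Ob (power_cat C n). omap G (permute_list \<sigma> xs)),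
          amap = (\<lambda>fs\<in>Arr (power_cat C n). amap G (permute_list \<sigma> fs))\<rparr>)
     in
     \<lparr> cat_at = (\<lambda>n. functor_cat (power_cat C n) C),
       ccomp = (\<lambda>ks.
         \<lparr>omap = comp_ob ks,
          amap = (\<lambda>(t, ss).
            \<lparr>nsrc = comp_ob ks (nsrc t, map nsrc ss),
             ntgt = comp_ob ks (ntgt t, map ntgt ss),
             ncmp = (\<lambda>xs\<in>Ob (power_cat C (sum_list ks)).
               Cmp C (ncmp t (map2 omap (map ntgt ss) (blocks ks xs)))
                     (amap (nsrc t) (map2 ncmp ss (blocks ks xs))))\<rparr>)\<rparr>),
       cunit = \<lparr>omap = (\<lambda>xs\<in>Ob (power_cat C 1). hd xs), amap = (\<lambda>fs\<in>Arr (power_cat C 1). hd fs)\<rparr>,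
       cact = (\<lambda>n \<sigma>.
         \<lparr>omap = act_ob n \<sigma>,
          amap = (\<lambda>t.
            \<lparr>nsrc = act_ob n \<sigma> (nsrc t),
             ntgt = act_ob n \<sigma> (ntgt t),
             ncmp = (\<lambda>xs\<in>Ob (power_cat C n). ncmp t (permute_list \<sigma> xs))\<rparr>)\<rparr>) \<rparr>)"

definition algebra_structures ::
  "('q, 'r) cat_operad \<Rightarrow> ('o, 'a) category \<Rightarrow>
     (nat \<Rightarrow> ('q, 'r, ('o list, 'a list, 'o, 'a) ftor, ('o list, 'a list, 'o, 'a) ntrans) ftor) set" where
  "algebra_structures Q C = {h. cat_operad_morphism Q (End_operad C) h}"


section \<open>Symmetric monoidal categories\<close>

record ('o, 'a) sym_mon =
  tensor :: "('o \<times> 'o, 'a \<times> 'a, 'o, 'a) ftor"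
  unit_ob :: 'o
  assoc :: "'o \<times> 'o \<times> 'o \<Rightarrow> 'a"
  lunit :: "'o \<Rightarrow> 'a"
  runit :: "'o \<Rightarrow> 'a"
  symm :: "'o \<times> 'o \<Rightarrow> 'a"

text \<open>The equations are, in this order, Mac Lane's pentagon, triangle, \<open>\<lambda>\<^sub>I = \<rho>\<^sub>I\<close>, symmetry,
  compatibility of \<open>\<tau>\<close> with the units, and hexagon. Note the type \<open>\<tau>\<^bsub>A,B\<^esub> : B \<otimes> A \<rightarrow> A \<otimes> B\<close>, since
  the source of \<open>\<tau>\<close> is the functor \<open>(A, B) \<mapsto> B \<otimes> A\<close>.\<close>

definition is_sym_mon :: "('o, 'a) category \<Rightarrow> ('o, 'a) sym_mon \<Rightarrow> bool" where
  "is_sym_mon C S \<longleftrightarrow>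
    (let
       T = (\<lambda>A B. omap (tensor S) (A, B));
       U = (\<lambda>f g. amap (tensor S) (f, g));
       I = unit_ob S;
       \<alpha> = (\<lambda>A B D. assoc S (A, B, D));
       l = lunit S;
       r = runit S;
       \<tau> = (\<lambda>A B. symm S (A, B));
       one = Idn C
     in
     tensor S \<in> functors (prod_cat C C) C \<and>
     I \<in> Ob C \<and>
     is_natural_iso (prod_cat C (prod_cat C C)) C
       \<lparr>omap = (\<lambda>(A, B, D). T A (T B D)), amap = (\<lambda>(f, g, h). U f (U g h))\<rparr>
       \<lparr>omap = (\<lambda>(A, B, D). T (T A B) D), amap = (\<lambda>(f, g, h). U (U f g) h)\<rparr>
       (assoc S) \<and>
     is_natural_iso C C
       \<lparr>omap = (\<lambda>A. T I A), amap = (\<lambda>f. U (one I) f)\<rparr> \<lparr>omap = (\<lambda>A. A), amap = (\<lambda>f. f)\<rparr> l \<and>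
     is_natural_iso C C
       \<lparr>omap = (\<lambda>A. T A I), amap = (\<lambda>f. U f (one I))\<rparr> \<lparr>omap = (\<lambda>A. A), amap = (\<lambda>f. f)\<rparr> r \<and>
     is_natural_iso (prod_cat C C) C
       \<lparr>omap = (\<lambda>(A, B). T B A), amap = (\<lambda>(f, g). U g f)\<rparr> (tensor S) (symm S) \<and>
     (\<forall>A\<in>Ob C. \<forall>B\<in>Ob C. \<forall>D\<in>Ob C. \<forall>E\<in>Ob C.
        Cmp C (\<alpha> (T A B) D E) (\<alpha> A B (T D E))
        = Cmp C (U (\<alpha> A B D) (one E)) (Cmp C (\<alpha> A (T B D) E) (U (one A) (\<alpha> B D E)))) \<and>
     (\<forall>A\<in>Ob C. \<forall>B\<in>Ob C. Cmp C (U (r A) (one B)) (\<alpha> A I B) = U (one A) (l B)) \<and>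
     l I = r I \<and>
     (\<forall>A\<in>Ob C. \<forall>B\<in>Ob C. Cmp C (\<tau> A B) (\<tau> B A) = one (T A B)) \<and>
     (\<forall>A\<in>Ob C. Cmp C (l A) (\<tau> I A) = r A) \<and>
     (\<forall>A\<in>Ob C. \<forall>B\<in>Ob C. \<forall>D\<in>Ob C.
        Cmp C (U (\<tau> A D) (one B)) (Cmp C (\<alpha> D A B) (Cmp C (\<tau> D (T A B)) (\<alpha> A B D)))
        = Cmp C (\<alpha> A D B) (U (one A) (\<tau> D B))))"

definition sym_mon_structures :: "('o, 'a) category \<Rightarrow> ('o, 'a) sym_mon set" where
  "sym_mon_structures C = {S. is_sym_mon C S}"

text \<open>The structure read off from functors \<open>T : C\<^sup>2 \<rightarrow> C\<close> and \<open>E : C\<^sup>0 \<rightarrow> C\<close> and natural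
  transformations \<open>a\<close>, \<open>l\<close>, \<open>r\<close>, \<open>s\<close>, with tuples in place of lists as arguments.\<close>

definition sym_mon_of ::
  "('o, 'a) category \<Rightarrow> ('o list, 'a list, 'o, 'a) ftor \<Rightarrow> ('o list, 'a list, 'o, 'a) ftor \<Rightarrow>
     ('o list, 'a list, 'o, 'a) ntrans \<Rightarrow> ('o list, 'a list, 'o, 'a) ntrans \<Rightarrow>
     ('o list, 'a list, 'o, 'a) ntrans \<Rightarrow> ('o list, 'a list, 'o, 'a) ntrans \<Rightarrow> ('o, 'a) sym_mon" where
  "sym_mon_of C T E a l r s =
     \<lparr> tensor = \<lparr>omap = (\<lambda>(A, B)\<in>Ob C \<times> Ob C. omap T [A, B]),
                 amap = (\<lambda>(f, g)\<in>Arr C \<times> Arr C. amap T [f, g])\<rparr>,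
       unit_ob = omap E [],
       assoc = (\<lambda>(A, B, D)\<in>Ob C \<times> Ob C \<times> Ob C. ncmp a [A, B, D]),
       lunit = (\<lambda>A\<in>Ob C. ncmp l [A]),
       runit = (\<lambda>A\<in>Ob C. ncmp r [A]),
       symm = (\<lambda>(A, B)\<in>Ob C \<times> Ob C. ncmp s [A, B]) \<rparr>"


section \<open>The free operad is free\<close>

lemma length_list_prod: "xs \<in> list_prod Ss \<Longrightarrow> length xs = length Ss"
  by (auto simp: list_prod_def dest: list_all2_lengthD)

lemma in_list_prod_iff: "xs \<in> list_prod Ss \<longleftrightarrow> length xs = length Ss \<and> (\<forall>i<length Ss. xs ! i \<in> Ss ! i)"
  by (auto simp: list_prod_def list_all2_conv_all_nth)

lemma block_start_0 [simp]: "block_start ks 0 = 0"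
  and block_start_Nil [simp]: "block_start [] i = 0"
  and block_start_Cons_Suc [simp]: "block_start (k # ks) (Suc i) = k + block_start ks i"
  by (simp_all add: block_start_def)

lemma block_start_bound: "i < length ks \<Longrightarrow> j < ks ! i \<Longrightarrow> block_start ks i + j < sum_list ks"
proof (induction ks arbitrary: i)
  case (Cons k ks)
  then show ?case by (cases i) auto
qed simp

lemma block_start_exhaust:
  assumes "p < sum_list ks"
  obtains i j where "i < length ks" "j < ks ! i" "p = block_start ks i + j"
proof -
  have "\<exists>i j. i < length ks \<and> j < ks ! i \<and> p = block_start ks i + j"
    using assms
  proof (induction ks arbitrary: p)
    case (Cons k ks)
    show ?case
    proof (cases "p < k")
      case True
      then show ?thesis by (intro exI[of _ 0] exI[of _ p]) simp
    next
      case False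
      then have "p - k < sum_list ks" using Cons.prems by simp
      from Cons.IH[OF this] obtain i j where "i < length ks" "j < ks ! i" "p - k = block_start ks i + j" by auto
      then show ?thesis using False by (intro exI[of _ "Suc i"] exI[of _ j]) simp
    qed
  qed simp
  then show ?thesis using that by blast
qed

lemma block_start_inj:
  "\<lbrakk>i < length ks; j < ks ! i; i' < length ks; j' < ks ! i'; block_start ks i + j = block_start ks i' + j'\<rbrakk>
   \<Longrightarrow> i = i' \<and> j = j'"
proof (induction ks arbitrary: i i')
  case (Cons k ks)
  then show ?case by (cases i; cases i') auto
qed simp

lemma nth_concat_block:
  "\<lbrakk>map length xss = ks; i < length ks; j < ks ! i\<rbrakk> \<Longrightarrow> concat xss ! (block_start ks i + j) = xss ! i ! j"
proof (induction xss arbitrary: i ks)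
  case (Cons xs xss)
  then show ?case by (cases i) (auto simp: nth_append)
qed simp

lemma length_concat_block: "map length xss = ks \<Longrightarrow> length (concat xss) = sum_list ks"
  by (auto simp: length_concat)

lemma block_start_concat:
  "\<lbrakk>i < length kss; j < length (kss ! i)\<rbrakk> \<Longrightarrow>
   block_start (concat kss) (block_start (map length kss) i + j) = block_start (map sum_list kss) i + block_start (kss ! i) j"
proof (induction kss arbitrary: i)
  case (Cons ks kss)
  then show ?case by (cases i) (auto simp: block_start_def)
qed simp

lemma permutes_lt: "\<sigma> permutes {..<n} \<Longrightarrow> i < n \<Longrightarrow> \<sigma> i < (n::nat)"
  using permutes_in_image[of \<sigma> "{..<n}" i] by auto

lemma map_nth_permute:
  assumes "\<sigma> permutes {..<length ks}"
  shows "map (\<lambda>i. ks ! \<sigma> i) [0..<length ks] = permute_list \<sigma> ks"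
  by (simp add: permute_list_def)

lemma sum_list_permute:
  assumes "\<sigma> permutes {..<length ks}"
  shows "sum_list (permute_list \<sigma> ks) = sum_list (ks :: nat list)"
  using mset_permute_list[OF assms] by (metis sum_mset_sum_list)

lemma block_perm_eq:
  assumes "\<sigma> permutes {..<length ks}" "i < length ks" "j < ks ! \<sigma> i"
  shows "block_perm ks \<sigma> (block_start (permute_list \<sigma> ks) i + j) = block_start ks (\<sigma> i) + j"
proof -
  let ?xss = "map (\<lambda>i. map (\<lambda>j. block_start ks (\<sigma> i) + j) [0..<ks ! \<sigma> i]) [0..<length ks]"
  have 1: "map length ?xss = permute_list \<sigma> ks" by (simp add: permute_list_def o_def)
  have 2: "j < permute_list \<sigma> ks ! i" "i < length (permute_list \<sigma> ks)"
    using assms by (simp_all add: permute_list_def)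
  have "block_start (permute_list \<sigma> ks) i + j < length (concat ?xss)"
    unfolding length_concat_block[OF 1] by (rule block_start_bound[OF 2(2) 2(1)])
  then show ?thesis
    unfolding block_perm_def perm_of_list_def
    using nth_concat_block[OF 1 2(2) 2(1)] assms by simp
qed

lemma perm_sum_eq:
  assumes "i < length ks" "j < ks ! i"
  shows "perm_sum ks \<sigma>s (block_start ks i + j) = block_start ks i + (\<sigma>s ! i) j"
proof -
  let ?xss = "map (\<lambda>i. map (\<lambda>j. block_start ks i + (\<sigma>s ! i) j) [0..<ks ! i]) [0..<length ks]"
  have 1: "map length ?xss = ks" by (simp add: o_def map_nth)
  have "block_start ks i + j < length (concat ?xss)"
    unfolding length_concat_block[OF 1] by (rule block_start_bound[OF assms])
  then show ?thesis
    unfolding perm_sum_def perm_of_list_def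
    using nth_concat_block[OF 1 assms] assms by simp
qed

lemma block_perm_outside: "\<sigma> permutes {..<length ks} \<Longrightarrow> p \<ge> sum_list ks \<Longrightarrow> block_perm ks \<sigma> p = p"
proof -
  assume a: "\<sigma> permutes {..<length ks}" "p \<ge> sum_list ks"
  let ?xss = "map (\<lambda>i. map (\<lambda>j. block_start ks (\<sigma> i) + j) [0..<ks ! \<sigma> i]) [0..<length ks]"
  have 1: "map length ?xss = permute_list \<sigma> ks" by (simp add: permute_list_def o_def)
  show ?thesis
    unfolding block_perm_def perm_of_list_def length_concat_block[OF 1] sum_list_permute[OF a(1)] using a by simp
qed

lemma perm_sum_outside: "p \<ge> sum_list ks \<Longrightarrow> perm_sum ks \<sigma>s p = p"
proof -
  assume a: "p \<ge> sum_list ks"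
  let ?xss = "map (\<lambda>i. map (\<lambda>j. block_start ks i + (\<sigma>s ! i) j) [0..<ks ! i]) [0..<length ks]"
  have 1: "map length ?xss = ks" by (simp add: o_def map_nth)
  show ?thesis
    unfolding perm_sum_def perm_of_list_def length_concat_block[OF 1] using a by simp
qed

lemma permutesI_surj:
  assumes "\<And>p. p < (n::nat) \<Longrightarrow> \<exists>q<n. f q = p" "\<And>p. p \<ge> n \<Longrightarrow> f p = p"
  shows "f permutes {..<n}"
proof -
  have s: "{..<n} \<subseteq> f ` {..<n}" using assms(1) by fastforce
  have c: "card (f ` {..<n}) \<le> n" using card_image_le[of "{..<n}" f] by simp
  have e: "{..<n} = f ` {..<n}" by (rule card_seteq) (use s c in auto)
  have "inj_on f {..<n}" using e by (metis eq_card_imp_inj_on finite_lessThan)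
  with e have "bij_betw f {..<n} {..<n}" by (simp add: bij_betw_def)
  then show ?thesis by (rule bij_imp_permutes) (use assms(2) in auto)
qed

lemma block_perm_permutes: assumes "\<sigma> permutes {..<length ks}" shows "block_perm ks \<sigma> permutes {..<sum_list ks}"
proof (rule permutesI_surj)
  fix p assume "p < sum_list ks"
  then obtain i j where ij: "i < length ks" "j < ks ! i" "p = block_start ks i + j" by (rule block_start_exhaust)
  let ?i = "inv \<sigma> i"
  have i: "\<sigma> ?i = i" "?i < length ks"
    using permutes_inverses(1)[OF assms] permutes_lt[OF permutes_inv[OF assms] ij(1)] by auto
  have "block_perm ks \<sigma> (block_start (permute_list \<sigma> ks) ?i + j) = p"
    using block_perm_eq[OF assms i(2), of j] ij i by simp
  moreover have "block_start (permute_list \<sigma> ks) ?i + j < sum_list ks"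
    using block_start_bound[of ?i "permute_list \<sigma> ks" j] ij i by (simp add: sum_list_permute[OF assms] permute_list_nth[OF assms])
  ultimately show "\<exists>q<sum_list ks. block_perm ks \<sigma> q = p" by blast
qed (rule block_perm_outside[OF assms])

lemma perm_sum_permutes:
  assumes "list_all2 (\<lambda>\<sigma> k. \<sigma> permutes {..<k}) \<sigma>s ks" shows "perm_sum ks \<sigma>s permutes {..<sum_list ks}"
proof (rule permutesI_surj)
  fix p assume "p < sum_list ks"
  then obtain i j where ij: "i < length ks" "j < ks ! i" "p = block_start ks i + j" by (rule block_start_exhaust)
  have s: "\<sigma>s ! i permutes {..<ks ! i}" using assms ij by (simp add: list_all2_conv_all_nth)
  let ?j = "inv (\<sigma>s ! i) j"
  have j: "(\<sigma>s ! i) ?j = j" "?j < ks ! i"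
    using permutes_inverses(1)[OF s] permutes_lt[OF permutes_inv[OF s] ij(2)] by auto
  have "perm_sum ks \<sigma>s (block_start ks i + ?j) = p"
    using perm_sum_eq[OF ij(1) j(2)] j ij by simp
  then show "\<exists>q<sum_list ks. perm_sum ks \<sigma>s q = p" using block_start_bound[OF ij(1) j(2)] by blast
qed (rule perm_sum_outside)

lemma leaves_graft: "leaves (graft s t) = concat (map (\<lambda>v. leaves (s v)) (leaves t))"
proof (induction t)
  case (Node g ts)
  then show ?case by (induction ts) auto
qed simp

lemma wf_graft: "well_formed \<Phi> t \<Longrightarrow> (\<And>v. v \<in> set (leaves t) \<Longrightarrow> well_formed \<Phi> (s v)) \<Longrightarrow> well_formed \<Phi> (graft s t)"
  by (induction t) (auto simp: list_all_iff)

lemma graft_graft: "graft s (graft r t) = graft (\<lambda>v. graft s (r v)) t"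
  by (induction t) auto

lemma graft_cong: "(\<And>v. v \<in> set (leaves t) \<Longrightarrow> s v = r v) \<Longrightarrow> graft s t = graft r t"
  by (induction t) auto

lemma graft_Leaf: "graft Leaf t = t"
  by (induction t) (auto simp: map_idI)

lemma leaves_relabel: "leaves (relabel h t) = map h (leaves t)"
  by (simp add: relabel_def leaves_graft o_def concat_map_singleton)

lemma wf_relabel: "well_formed \<Phi> t \<Longrightarrow> well_formed \<Phi> (relabel h t)"
  by (simp add: relabel_def wf_graft)

lemma graft_relabel: "graft s (relabel h t) = graft (\<lambda>v. s (h v)) t"
  by (simp add: relabel_def graft_graft)

lemma relabel_graft: "relabel h (graft s t) = graft (\<lambda>v. relabel h (s v)) t"
  by (simp add: relabel_def graft_graft)

lemma relabel_relabel: "relabel h (relabel k t) = relabel (\<lambda>v. h (k v)) t"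
  by (simp add: relabel_def graft_graft)

lemma relabel_cong: "(\<And>v. v \<in> set (leaves t) \<Longrightarrow> h v = k v) \<Longrightarrow> relabel h t = relabel k t"
  unfolding relabel_def by (rule graft_cong) simp

lemma relabel_ident: "(\<And>v. v \<in> set (leaves t) \<Longrightarrow> h v = v) \<Longrightarrow> relabel h t = t"
  unfolding relabel_def by (rule trans[OF graft_cong graft_Leaf]) simp

lemma free_ops_iff: "t \<in> ops (free_operad \<Phi>) n \<longleftrightarrow> well_formed \<Phi> t \<and> distinct (leaves t) \<and> set (leaves t) = {..<n}"
  by (simp add: free_operad_def)

lemma free_opcomp: "opcomp (free_operad \<Phi>) ks t ts = graft (\<lambda>i. relabel (\<lambda>j. block_start ks i + j) (ts ! i)) t"
  and free_opunit: "opunit (free_operad \<Phi>) = Leaf 0"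
  and free_opact: "opact (free_operad \<Phi>) n \<sigma> = relabel \<sigma>"
  by (simp_all add: free_operad_def)

lemma free_ops_nthD:
  "\<lbrakk>ts \<in> list_prod (map (ops (free_operad \<Phi>)) ks); i < length ks\<rbrakk> \<Longrightarrow>
    well_formed \<Phi> (ts ! i) \<and> distinct (leaves (ts ! i)) \<and> set (leaves (ts ! i)) = {..<ks ! i}"
  by (auto simp: in_list_prod_iff free_ops_iff)

lemma distinct_concat_map:
  assumes "distinct xs" "\<And>x. x \<in> set xs \<Longrightarrow> distinct (f x)"
    "\<And>x y. \<lbrakk>x \<in> set xs; y \<in> set xs; x \<noteq> y\<rbrakk> \<Longrightarrow> set (f x) \<inter> set (f y) = {}"
  shows "distinct (concat (map f xs))"
  using assms
proof (induction xs)
  case (Cons a xs)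
  then have "set (f a) \<inter> set (f y) = {}" if "y \<in> set xs" for y
    using that Cons.prems(3)[of a y] by auto
  then have "set (f a) \<inter> (\<Union>y\<in>set xs. set (f y)) = {}" by blast
  moreover have "distinct (concat (map f xs))" using Cons by simp
  ultimately show ?case using Cons.prems by auto
qed simp

lemma free_comp_closed:
  assumes "t \<in> ops (free_operad \<Phi>) (length ks)" "ts \<in> list_prod (map (ops (free_operad \<Phi>)) ks)"
  shows "opcomp (free_operad \<Phi>) ks t ts \<in> ops (free_operad \<Phi>) (sum_list ks)"
proof -
  have t: "well_formed \<Phi> t" "distinct (leaves t)" "set (leaves t) = {..<length ks}"
    using assms(1) by (auto simp: free_ops_iff)
  note ts = free_ops_nthD[OF assms(2)]
  let ?f = "\<lambda>i. map (\<lambda>j. block_start ks i + j) (leaves (ts ! i))"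
  have l: "leaves (opcomp (free_operad \<Phi>) ks t ts) = concat (map ?f (leaves t))"
    by (simp add: free_opcomp leaves_graft leaves_relabel)
  have "distinct (concat (map ?f (leaves t)))"
  proof (rule distinct_concat_map)
    show "distinct (leaves t)" by fact
    fix x assume "x \<in> set (leaves t)"
    then have x: "x < length ks" using t by auto
    then show "distinct (?f x)" using ts by (simp add: distinct_map)
    fix y assume "y \<in> set (leaves t)" and ne: "x \<noteq> y"
    then have y: "y < length ks" using t by auto
    show "set (?f x) \<inter> set (?f y) = {}"
      using ts[OF x] ts[OF y] block_start_inj[OF x _ y] ne by fastforce
  qed
  moreover have "set (concat (map ?f (leaves t))) = {..<sum_list ks}"
  proof (intro equalityI subsetI)
    fix p assume "p \<in> set (concat (map ?f (leaves t)))"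
    then obtain i j where "i < length ks" "j \<in> set (leaves (ts ! i))" "p = block_start ks i + j"
      using t by auto
    then show "p \<in> {..<sum_list ks}" using block_start_bound ts by auto
  next
    fix p assume "p \<in> {..<sum_list ks}"
    then obtain i j where "i < length ks" "j < ks ! i" "p = block_start ks i + j"
      by (auto elim: block_start_exhaust)
    then show "p \<in> set (concat (map ?f (leaves t)))" using t ts by auto
  qed
  moreover have "well_formed \<Phi> (opcomp (free_operad \<Phi>) ks t ts)"
    unfolding free_opcomp by (rule wf_graft) (use t ts in \<open>auto intro: wf_relabel\<close>)
  ultimately show ?thesis by (simp add: free_ops_iff l)
qed

lemma free_symmetric_operad: "symmetric_operad (free_operad \<Phi>)"
proof
  fix f ks gs
  assume "f \<in> ops (free_operad \<Phi>) (length ks)" "gs \<in> list_prod (map (ops (free_operad \<Phi>)) ks)"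
  then show "opcomp (free_operad \<Phi>) ks f gs \<in> ops (free_operad \<Phi>) (sum_list ks)"
    by (rule free_comp_closed)
next
  show "opunit (free_operad \<Phi>) \<in> ops (free_operad \<Phi>) 1"
    by (auto simp: free_ops_iff free_opunit)
next
  fix \<sigma> n f assume "\<sigma> permutes {..<n}" "f \<in> ops (free_operad \<Phi>) n"
  then show "opact (free_operad \<Phi>) n \<sigma> f \<in> ops (free_operad \<Phi>) n"
    by (auto simp: free_ops_iff free_opact wf_relabel leaves_relabel distinct_map permutes_image
        intro: permutes_inj_on)
next
  fix f kss gs hss
  assume f: "f \<in> ops (free_operad \<Phi>) (length kss)"
    and gs: "gs \<in> list_prod (map (ops (free_operad \<Phi>) \<circ> length) kss)"
    and hss: "list_all2 (\<lambda>hs ks. hs \<in> list_prod (map (ops (free_operad \<Phi>)) ks)) hss kss"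
  have len: "length gs = length kss" "length hss = length kss"
    using gs hss by (auto simp: in_list_prod_iff list_all2_lengthD)
  have mh: "map length hss = map length kss"
    using hss by (auto simp: list_all2_conv_all_nth list_eq_iff_nth_eq in_list_prod_iff)
  show "opcomp (free_operad \<Phi>) (concat kss) (opcomp (free_operad \<Phi>) (map length kss) f gs) (concat hss)
      = opcomp (free_operad \<Phi>) (map sum_list kss) f
          (map2 (\<lambda>ks (g, hs). opcomp (free_operad \<Phi>) ks g hs) kss (zip gs hss))"
    unfolding free_opcomp graft_graft graft_relabel
  proof (rule graft_cong)
    fix i assume "i \<in> set (leaves f)"
    then have i: "i < length kss" using f by (auto simp: free_ops_iff)
    have gi: "set (leaves (gs ! i)) = {..<length (kss ! i)}"
      using gs i by (auto simp: in_list_prod_iff free_ops_iff)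
    show "graft (\<lambda>v. relabel ((+) (block_start (concat kss) (block_start (map length kss) i + v)))
                (concat hss ! (block_start (map length kss) i + v))) (gs ! i)
        = relabel ((+) (block_start (map sum_list kss) i))
            (map2 (\<lambda>ks (g, hs). graft (\<lambda>i. relabel ((+) (block_start ks i)) (hs ! i)) g) kss (zip gs hss) ! i)"
      using i len
      by (auto simp: relabel_graft relabel_relabel gi block_start_concat add.assoc
          nth_concat_block[OF mh] intro!: graft_cong relabel_cong)
  qed
next
  fix f n assume "f \<in> ops (free_operad \<Phi>) n"
  then show "opcomp (free_operad \<Phi>) [n] (opunit (free_operad \<Phi>)) [f] = f"
    by (simp add: free_opcomp free_opunit relabel_ident)
next
  fix f n assume "f \<in> ops (free_operad \<Phi>) n"
  moreover have "block_start (replicate n 1) i = i" if "i < n" for i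
    using that by (simp add: block_start_def min_def sum_list_replicate)
  ultimately show "opcomp (free_operad \<Phi>) (replicate n 1) f (replicate n (opunit (free_operad \<Phi>))) = f"
    by (auto simp: free_opcomp free_opunit free_ops_iff relabel_def intro!: trans[OF graft_cong graft_Leaf])
next
  fix f n show "opact (free_operad \<Phi>) n id f = f"
    by (simp add: free_opact relabel_ident)
next
  fix \<sigma> \<tau> n f show "opact (free_operad \<Phi>) n (\<sigma> \<circ> \<tau>) f = opact (free_operad \<Phi>) n \<sigma> (opact (free_operad \<Phi>) n \<tau> f)"
    by (simp add: free_opact relabel_relabel o_def)
next
  fix \<sigma> ks f gs
  assume s: "\<sigma> permutes {..<length ks}" and f: "f \<in> ops (free_operad \<Phi>) (length ks)"
    and gs: "gs \<in> list_prod (map (ops (free_operad \<Phi>)) ks)"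
  have len: "length gs = length ks" using gs by (simp add: in_list_prod_iff)
  then have s': "\<sigma> permutes {..<length gs}" using s by simp
  show "opcomp (free_operad \<Phi>) ks (opact (free_operad \<Phi>) (length ks) \<sigma> f) gs
      = opact (free_operad \<Phi>) (sum_list ks) (block_perm ks \<sigma>)
          (opcomp (free_operad \<Phi>) (permute_list \<sigma> ks) f (permute_list \<sigma> gs))"
    unfolding free_opcomp free_opact graft_relabel relabel_graft relabel_relabel
  proof (rule graft_cong)
    fix i assume "i \<in> set (leaves f)"
    then have i: "i < length ks" using f by (auto simp: free_ops_iff)
    then have "set (leaves (gs ! \<sigma> i)) = {..<ks ! \<sigma> i}"
      using free_ops_nthD[OF gs] permutes_lt[OF s] by blast
    then show "relabel ((+) (block_start ks (\<sigma> i))) (gs ! \<sigma> i)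
        = relabel (\<lambda>j. block_perm ks \<sigma> (block_start (permute_list \<sigma> ks) i + j)) (permute_list \<sigma> gs ! i)"
      unfolding permute_list_nth[OF s' i[folded len]]
      by (intro relabel_cong) (simp add: block_perm_eq[OF s i])
  qed
next
  fix f ks gs \<sigma>s
  assume f: "f \<in> ops (free_operad \<Phi>) (length ks)"
    and gs: "gs \<in> list_prod (map (ops (free_operad \<Phi>)) ks)"
    and s: "list_all2 (\<lambda>\<sigma> k. \<sigma> permutes {..<k}) \<sigma>s ks"
  have len: "length gs = length ks" "length \<sigma>s = length ks"
    using gs s by (auto simp: in_list_prod_iff list_all2_lengthD)
  show "opcomp (free_operad \<Phi>) ks f (map2 (\<lambda>k (\<sigma>, g). opact (free_operad \<Phi>) k \<sigma> g) ks (zip \<sigma>s gs))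
      = opact (free_operad \<Phi>) (sum_list ks) (perm_sum ks \<sigma>s) (opcomp (free_operad \<Phi>) ks f gs)"
    unfolding free_opcomp free_opact relabel_graft relabel_relabel
  proof (rule graft_cong)
    fix i assume "i \<in> set (leaves f)"
    then have i: "i < length ks" using f by (auto simp: free_ops_iff)
    then have "set (leaves (gs ! i)) = {..<ks ! i}"
      using free_ops_nthD[OF gs] by blast
    then show "relabel ((+) (block_start ks i)) (map2 (\<lambda>k (\<sigma>, g). relabel \<sigma> g) ks (zip \<sigma>s gs) ! i)
        = relabel (\<lambda>j. perm_sum ks \<sigma>s (block_start ks i + j)) (gs ! i)"
      using i len by (simp add: relabel_relabel) (intro relabel_cong, simp add: perm_sum_eq)
  qed
qed

context symmetric_operad begin

primrec planar_eval :: "(nat \<Rightarrow> 'g \<Rightarrow> 'p) \<Rightarrow> ('g, 'v) optree \<Rightarrow> 'p" where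
  "planar_eval h (Leaf v) = opunit P"
| "planar_eval h (Node g ts) =
     opcomp P (map (length \<circ> leaves) ts) (h (length ts) g) (map (planar_eval h) ts)"

definition tree_eval :: "(nat \<Rightarrow> 'g \<Rightarrow> 'p) \<Rightarrow> nat \<Rightarrow> ('g, nat) optree \<Rightarrow> 'p" where
  "tree_eval h n t = opact P n (perm_of_list (leaves t)) (planar_eval h t)"

lemma planar_eval_closed:
  assumes "\<And>n g. g \<in> \<Phi> n \<Longrightarrow> h n g \<in> ops P n"
  shows "well_formed \<Phi> t \<Longrightarrow> planar_eval h t \<in> ops P (length (leaves t))"
proof (induction t)
  case (Leaf v)
  then show ?case using unit_closed by simp
next
  case (Node g ts)
  have "planar_eval h (Node g ts) \<in> ops P (sum_list (map (length \<circ> leaves) ts))"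
    unfolding planar_eval.simps
    by (rule comp_closed) (use Node assms in \<open>auto simp: in_list_prod_iff list_all_iff\<close>)
  then show ?case by (simp add: length_concat o_def)
qed

lemma planar_eval_relabel: "planar_eval h (relabel k t) = planar_eval h t"
  unfolding relabel_def
proof (induction t)
  case (Node g ts)
  have "map (planar_eval h \<circ> graft (\<lambda>v. Leaf (k v))) ts = map (planar_eval h) ts"
    using Node by simp
  moreover have "map (length \<circ> leaves \<circ> graft (\<lambda>v. Leaf (k v))) ts = map (length \<circ> leaves) ts"
    by (simp add: leaves_graft o_def concat_map_singleton)
  ultimately show ?case by (simp only: graft.simps planar_eval.simps map_map length_map)
qed simp

lemma planar_eval_graft:
  assumes h: "\<And>n g. g \<in> \<Phi> n \<Longrightarrow> h n g \<in> ops P n"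
  shows "well_formed \<Phi> t \<Longrightarrow> (\<And>v. v \<in> set (leaves t) \<Longrightarrow> well_formed \<Phi> (s v)) \<Longrightarrow>
     planar_eval h (graft s t)
     = opcomp P (map (\<lambda>v. length (leaves (s v))) (leaves t)) (planar_eval h t)
         (map (\<lambda>v. planar_eval h (s v)) (leaves t))"
proof (induction t)
  case (Leaf v)
  then have "well_formed \<Phi> (s v)" by simp
  from unit_left[OF planar_eval_closed[where h = h and \<Phi> = \<Phi>, OF h this]]
  show ?case by simp
next
  case (Node g ts)
  let ?kss = "map (\<lambda>t. map (\<lambda>v. length (leaves (s v))) (leaves t)) ts"
  let ?hss = "map (\<lambda>t. map (\<lambda>v. planar_eval h (s v)) (leaves t)) ts"
  let ?gs = "map (planar_eval h) ts"
  have wf: "\<And>t. t \<in> set ts \<Longrightarrow> well_formed \<Phi> t" "g \<in> \<Phi> (length ts)"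
    using Node.prems by (auto simp: list_all_iff)
  have IH: "planar_eval h (graft s t) = opcomp P (map (\<lambda>v. length (leaves (s v))) (leaves t)) (planar_eval h t)
         (map (\<lambda>v. planar_eval h (s v)) (leaves t))" if "t \<in> set ts" for t
    using that Node.prems wf by (intro Node.IH) auto
  have wfs: "well_formed \<Phi> (s (leaves (ts ! i) ! j))" if "i < length ts" "j < length (leaves (ts ! i))" for i j
  proof (rule Node.prems(2))
    have "ts ! i \<in> set ts" "leaves (ts ! i) ! j \<in> set (leaves (ts ! i))" using that by simp_all
    then show "leaves (ts ! i) ! j \<in> set (leaves (Node g ts))" unfolding leaves.simps set_concat set_map by blast
  qed
  have a: "map (length \<circ> leaves) (map (graft s) ts) = map sum_list ?kss"
    by (simp add: leaves_graft length_concat o_def)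
  have b: "map (planar_eval h) (map (graft s) ts)
         = map2 (\<lambda>ks (g, hs). opcomp P ks g hs) ?kss (zip ?gs ?hss)"
    by (auto simp: list_eq_iff_nth_eq IH)
  have "planar_eval h (graft s (Node g ts)) = opcomp P (map sum_list ?kss) (h (length ts) g)
       (map2 (\<lambda>ks (g, hs). opcomp P ks g hs) ?kss (zip ?gs ?hss))"
    unfolding graft.simps planar_eval.simps length_map a b ..
  also have "\<dots> = opcomp P (concat ?kss) (opcomp P (map length ?kss) (h (length ts) g) ?gs) (concat ?hss)"
  proof (rule comp_assoc[symmetric])
    show "h (length ts) g \<in> ops P (length ?kss)" using h wf by simp
    show "?gs \<in> list_prod (map (ops P \<circ> length) ?kss)"
      using wf by (auto simp: in_list_prod_iff intro!: planar_eval_closed[where h = h and \<Phi> = \<Phi>, OF h])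
    show "list_all2 (\<lambda>hs ks. hs \<in> list_prod (map (ops P) ks)) ?hss ?kss"
      by (auto simp: list_all2_conv_all_nth in_list_prod_iff intro!: planar_eval_closed[where h = h and \<Phi> = \<Phi>, OF h] wfs)
  qed
  also have "concat ?kss = map (\<lambda>v. length (leaves (s v))) (leaves (Node g ts))"
    by (simp add: map_concat o_def)
  also have "concat ?hss = map (\<lambda>v. planar_eval h (s v)) (leaves (Node g ts))"
    by (simp add: map_concat o_def)
  also have "opcomp P (map length ?kss) (h (length ts) g) ?gs = planar_eval h (Node g ts)"
    by (simp add: o_def)
  finally show ?case .
qed

end

lemma perm_of_list_permutes:
  assumes "distinct xs" "set xs = {..<n}"
  shows "perm_of_list xs permutes {..<n}"
proof -
  have l: "length xs = n" using distinct_card[OF assms(1)] assms(2) by simp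
  show ?thesis
    by (rule permutesI_surj) (use assms l in \<open>auto simp: perm_of_list_def set_eq_iff in_set_conv_nth\<close>)
qed

lemma length_leaves: "t \<in> ops (free_operad \<Phi>) n \<Longrightarrow> length (leaves t) = n"
  by (metis (no_types) free_ops_iff distinct_card card_lessThan)

lemma word_permutes: "t \<in> ops (free_operad \<Phi>) n \<Longrightarrow> perm_of_list (leaves t) permutes {..<n}"
  by (auto simp: free_ops_iff intro: perm_of_list_permutes)

lemma generator_closed: "g \<in> \<Phi> n \<Longrightarrow> generator n g \<in> ops (free_operad \<Phi>) n"
  by (auto simp: free_ops_iff generator_def list_all_iff o_def concat_map_singleton)

lemma word_comp:
  assumes t: "t \<in> ops (free_operad \<Phi>) (length ks)" and ts: "ts \<in> list_prod (map (ops (free_operad \<Phi>)) ks)"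
  defines "\<sigma> \<equiv> perm_of_list (leaves t)" and "\<tau>s \<equiv> map (perm_of_list \<circ> leaves) ts"
  shows "perm_of_list (leaves (opcomp (free_operad \<Phi>) ks t ts))
       = block_perm ks \<sigma> \<circ> perm_sum (permute_list \<sigma> ks) (permute_list \<sigma> \<tau>s)"
proof
  fix p
  have s: "\<sigma> permutes {..<length ks}" unfolding \<sigma>_def by (rule word_permutes[OF t])
  have lt: "length (leaves t) = length ks" by (rule length_leaves[OF t])
  have lts: "length ts = length ks" using ts by (simp add: in_list_prod_iff)
  then have s': "\<sigma> permutes {..<length \<tau>s}" using s by (simp add: \<tau>s_def)
  let ?xss = "map (\<lambda>v. map ((+) (block_start ks v)) (leaves (ts ! v))) (leaves t)"
  have lv: "leaves (opcomp (free_operad \<Phi>) ks t ts) = concat ?xss"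
    by (simp add: free_opcomp leaves_graft leaves_relabel)
  have len: "length (leaves (ts ! i)) = ks ! i" if "i < length ks" for i
    using ts that by (auto simp: in_list_prod_iff intro!: length_leaves)
  have tl: "leaves t ! i = \<sigma> i" if "i < length ks" for i
    using that lt by (simp add: \<sigma>_def perm_of_list_def)
  have ml: "map length ?xss = permute_list \<sigma> ks"
    using permutes_lt[OF s] by (auto simp: list_eq_iff_nth_eq lt tl len permute_list_nth[OF s])
  have sl: "sum_list (permute_list \<sigma> ks) = sum_list ks" by (rule sum_list_permute[OF s])
  have lc: "length (concat ?xss) = sum_list ks"
    unfolding length_concat_block[OF ml] by (rule sl)
  show "perm_of_list (leaves (opcomp (free_operad \<Phi>) ks t ts)) p
      = (block_perm ks \<sigma> \<circ> perm_sum (permute_list \<sigma> ks) (permute_list \<sigma> \<tau>s)) p"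
  proof (cases "p < sum_list ks")
    case True
    then have "p < sum_list (permute_list \<sigma> ks)" by (simp add: sl)
    then obtain i j where ij: "i < length (permute_list \<sigma> ks)" "j < permute_list \<sigma> ks ! i"
        "p = block_start (permute_list \<sigma> ks) i + j" by (rule block_start_exhaust)
    have i: "i < length ks" using ij by simp
    have j: "j < ks ! \<sigma> i" using ij i by (simp add: permute_list_nth[OF s])
    have si: "\<sigma> i < length ks" using permutes_lt[OF s i] .
    have "ts ! \<sigma> i \<in> ops (free_operad \<Phi>) (ks ! \<sigma> i)"
      using ts si by (auto simp: in_list_prod_iff)
    from permutes_lt[OF word_permutes[OF this] j]
    have j': "perm_of_list (leaves (ts ! \<sigma> i)) j < ks ! \<sigma> i" .
    have t': "permute_list \<sigma> \<tau>s ! i = perm_of_list (leaves (ts ! \<sigma> i))"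
      using permute_list_nth[OF s'] i si lts by (simp add: \<tau>s_def)
    have "perm_of_list (leaves (opcomp (free_operad \<Phi>) ks t ts)) p = concat ?xss ! p"
      using True lc by (simp add: lv perm_of_list_def)
    also have "\<dots> = block_start ks (\<sigma> i) + leaves (ts ! \<sigma> i) ! j"
      using nth_concat_block[OF ml ij(1,2)] ij(3) i j si by (simp add: lt tl len)
    also have "\<dots> = block_perm ks \<sigma> (block_start (permute_list \<sigma> ks) i + perm_of_list (leaves (ts ! \<sigma> i)) j)"
      using block_perm_eq[OF s i j'] j si by (simp add: perm_of_list_def len)
    also have "\<dots> = block_perm ks \<sigma> (perm_sum (permute_list \<sigma> ks) (permute_list \<sigma> \<tau>s) p)"
      using perm_sum_eq[OF ij(1,2)] ij(3) t' by simp
    finally show ?thesis by simp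
  next
    case False
    then show ?thesis
      using lc by (simp add: perm_of_list_def lv perm_sum_outside sl block_perm_outside[OF s])
  qed
qed

lemma permute_list_map2:
  assumes "\<sigma> permutes {..<length xs}" "length ys = length xs"
  shows "permute_list \<sigma> (map2 f xs ys) = map2 f (permute_list \<sigma> xs) (permute_list \<sigma> ys)"
proof -
  have "\<sigma> permutes {..<length (map2 f xs ys)}" "\<sigma> permutes {..<length ys}" using assms by simp_all
  then show ?thesis using assms permutes_lt[OF assms(1)]
    by (auto simp: list_eq_iff_nth_eq permute_list_nth)
qed

context symmetric_operad begin

lemma tree_eval_comp:
  assumes h: "\<And>n g. g \<in> \<Phi> n \<Longrightarrow> h n g \<in> ops P n"
    and t: "t \<in> ops (free_operad \<Phi>) (length ks)" and ts: "ts \<in> list_prod (map (ops (free_operad \<Phi>)) ks)"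
  shows "tree_eval h (sum_list ks) (opcomp (free_operad \<Phi>) ks t ts)
       = opcomp P ks (tree_eval h (length ks) t) (map2 (tree_eval h) ks ts)"
proof -
  let ?\<sigma> = "perm_of_list (leaves t)" and ?\<tau>s = "map (perm_of_list \<circ> leaves) ts"
  let ?ps = "map (planar_eval h) ts"
  have wft: "well_formed \<Phi> t" using t by (simp add: free_ops_iff)
  have s: "?\<sigma> permutes {..<length ks}" by (rule word_permutes[OF t])
  have lt: "length (leaves t) = length ks" by (rule length_leaves[OF t])
  have lts: "length ts = length ks" using ts by (simp add: in_list_prod_iff)
  have tsi: "ts ! i \<in> ops (free_operad \<Phi>) (ks ! i)" if "i < length ks" for i
    using ts that by (auto simp: in_list_prod_iff)
  have psi: "planar_eval h (ts ! i) \<in> ops P (ks ! i)" if "i < length ks" for i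
  proof -
    have "well_formed \<Phi> (ts ! i)" using tsi[OF that] by (simp add: free_ops_iff)
    from planar_eval_closed[where h = h and \<Phi> = \<Phi>, OF h this]
    show ?thesis unfolding length_leaves[OF tsi[OF that]] .
  qed
  have pt: "planar_eval h t \<in> ops P (length ks)"
    using planar_eval_closed[where h = h and \<Phi> = \<Phi>, OF h wft] unfolding lt .
  have tl: "leaves t = map ?\<sigma> [0..<length ks]"
    by (rule nth_equalityI) (simp_all add: lt perm_of_list_def)
  have tau: "list_all2 (\<lambda>\<sigma> k. \<sigma> permutes {..<k}) ?\<tau>s ks"
    using lts by (simp add: list_all2_conv_all_nth word_permutes[OF tsi])
  have tau': "list_all2 (\<lambda>\<sigma> k. \<sigma> permutes {..<k}) (permute_list ?\<sigma> ?\<tau>s) (permute_list ?\<sigma> ks)"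
    unfolding list_all2_conv_all_nth
  proof (intro conjI allI impI)
    fix i assume "i < length (permute_list ?\<sigma> ?\<tau>s)"
    then have i: "i < length ks" by (simp add: lts)
    have "?\<sigma> permutes {..<length ?\<tau>s}" using s lts by simp
    from permute_list_nth[OF this, of i] permute_list_nth[OF s i] i lts
      word_permutes[OF tsi[OF permutes_lt[OF s i]]] permutes_lt[OF s i]
    show "permute_list ?\<sigma> ?\<tau>s ! i permutes {..<permute_list ?\<sigma> ks ! i}" by simp
  qed (simp add: lts)
  have ps': "permute_list ?\<sigma> ?ps \<in> list_prod (map (ops P) (permute_list ?\<sigma> ks))"
    unfolding in_list_prod_iff
  proof (intro conjI allI impI)
    fix i assume "i < length (map (ops P) (permute_list ?\<sigma> ks))"
    then have i: "i < length ks" by simp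
    have "?\<sigma> permutes {..<length ?ps}" using s lts by simp
    from permute_list_nth[OF this, of i] permute_list_nth[OF s i] i lts
      psi[OF permutes_lt[OF s i]] permutes_lt[OF s i]
    show "permute_list ?\<sigma> ?ps ! i \<in> map (ops P) (permute_list ?\<sigma> ks) ! i" by simp
  qed (simp add: lts)
  have ev: "map2 (tree_eval h) ks ts = map2 (\<lambda>k (\<tau>, p). opact P k \<tau> p) ks (zip ?\<tau>s ?ps)"
    by (auto simp: list_eq_iff_nth_eq lts tree_eval_def)
  have evc: "map2 (tree_eval h) ks ts \<in> list_prod (map (ops P) ks)"
    using tsi psi lts by (auto simp: in_list_prod_iff tree_eval_def intro!: act_closed word_permutes)
  have z: "permute_list ?\<sigma> (zip ?\<tau>s ?ps) = zip (permute_list ?\<sigma> ?\<tau>s) (permute_list ?\<sigma> ?ps)"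
    by (rule permute_list_zip[OF s]) (simp_all add: lts)
  let ?pc = "opcomp P (permute_list ?\<sigma> ks) (planar_eval h t) (permute_list ?\<sigma> ?ps)"
  have "opcomp P ks (tree_eval h (length ks) t) (map2 (tree_eval h) ks ts)
      = opact P (sum_list ks) (block_perm ks ?\<sigma>)
          (opcomp P (permute_list ?\<sigma> ks) (planar_eval h t) (permute_list ?\<sigma> (map2 (tree_eval h) ks ts)))"
    unfolding tree_eval_def[of h "length ks" t] by (rule equivariant_outer[OF s pt evc])
  also have "permute_list ?\<sigma> (map2 (tree_eval h) ks ts)
      = map2 (\<lambda>k (\<tau>, p). opact P k \<tau> p) (permute_list ?\<sigma> ks) (zip (permute_list ?\<sigma> ?\<tau>s) (permute_list ?\<sigma> ?ps))"
  proof -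
    have l: "length (zip ?\<tau>s ?ps) = length ks" by (simp add: lts)
    show ?thesis unfolding ev z[symmetric] by (rule permute_list_map2[OF s l])
  qed
  also have "opcomp P (permute_list ?\<sigma> ks) (planar_eval h t) \<dots>
      = opact P (sum_list ks) (perm_sum (permute_list ?\<sigma> ks) (permute_list ?\<sigma> ?\<tau>s)) ?pc"
    using equivariant_inner[of "planar_eval h t" "permute_list ?\<sigma> ks", OF _ ps' tau'] pt
    by (simp add: sum_list_permute[OF s])
  also have "opact P (sum_list ks) (block_perm ks ?\<sigma>) \<dots>
      = opact P (sum_list ks) (block_perm ks ?\<sigma> \<circ> perm_sum (permute_list ?\<sigma> ks) (permute_list ?\<sigma> ?\<tau>s)) ?pc"
  proof (rule act_comp[symmetric])
    show "block_perm ks ?\<sigma> permutes {..<sum_list ks}" by (rule block_perm_permutes[OF s])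
    show "perm_sum (permute_list ?\<sigma> ks) (permute_list ?\<sigma> ?\<tau>s) permutes {..<sum_list ks}"
      using perm_sum_permutes[OF tau'] by (simp add: sum_list_permute[OF s])
    show "?pc \<in> ops P (sum_list ks)"
      using comp_closed[of "planar_eval h t" "permute_list ?\<sigma> ks", OF _ ps'] pt by (simp add: sum_list_permute[OF s])
  qed
  also have "?pc = planar_eval h (opcomp (free_operad \<Phi>) ks t ts)"
  proof -
    have w: "well_formed \<Phi> (relabel ((+) (block_start ks v)) (ts ! v))" if "v \<in> set (leaves t)" for v
      using that t tsi by (auto simp: free_ops_iff intro: wf_relabel)
    have k: "map (\<lambda>v. length (leaves (relabel ((+) (block_start ks v)) (ts ! v)))) (leaves t) = permute_list ?\<sigma> ks"
    proof (rule nth_equalityI)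
      fix i assume "i < length (map (\<lambda>v. length (leaves (relabel ((+) (block_start ks v)) (ts ! v)))) (leaves t))"
      then have i: "i < length ks" by (simp add: lt)
      then have "leaves t ! i = ?\<sigma> i" by (simp add: lt perm_of_list_def)
      then show "map (\<lambda>v. length (leaves (relabel ((+) (block_start ks v)) (ts ! v)))) (leaves t) ! i = permute_list ?\<sigma> ks ! i"
        using i permute_list_nth[OF s i] length_leaves[OF tsi[OF permutes_lt[OF s i]]] by (simp add: lt leaves_relabel)
    qed (simp add: lt)
    have p: "map (\<lambda>v. planar_eval h (relabel ((+) (block_start ks v)) (ts ! v))) (leaves t) = permute_list ?\<sigma> ?ps"
    proof (rule nth_equalityI)
      fix i assume "i < length (map (\<lambda>v. planar_eval h (relabel ((+) (block_start ks v)) (ts ! v))) (leaves t))"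
      then have i: "i < length ks" by (simp add: lt)
      then have "leaves t ! i = ?\<sigma> i" by (simp add: lt perm_of_list_def)
      moreover have "?\<sigma> permutes {..<length ?ps}" using s lts by simp
      ultimately show "map (\<lambda>v. planar_eval h (relabel ((+) (block_start ks v)) (ts ! v))) (leaves t) ! i = permute_list ?\<sigma> ?ps ! i"
        using i permute_list_nth[of ?\<sigma> ?ps i] permutes_lt[OF s i] lts by (simp add: lt planar_eval_relabel)
    qed (simp add: lt lts)
    have "planar_eval h (opcomp (free_operad \<Phi>) ks t ts)
       = opcomp P (map (\<lambda>v. length (leaves (relabel ((+) (block_start ks v)) (ts ! v)))) (leaves t)) (planar_eval h t)
         (map (\<lambda>v. planar_eval h (relabel ((+) (block_start ks v)) (ts ! v))) (leaves t))"
      unfolding free_opcomp by (rule planar_eval_graft[where \<Phi> = \<Phi>, OF h wft w])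
    then show ?thesis unfolding k p ..
  qed
  also have "block_perm ks ?\<sigma> \<circ> perm_sum (permute_list ?\<sigma> ks) (permute_list ?\<sigma> ?\<tau>s)
      = perm_of_list (leaves (opcomp (free_operad \<Phi>) ks t ts))"
    by (rule word_comp[OF t ts, symmetric])
  finally show ?thesis by (simp add: tree_eval_def)
qed

end

lemma planar_free:
  fixes t :: "('g, nat) optree"
  assumes "well_formed \<Phi> t"
  shows "relabel (\<lambda>j. leaves t ! j) (symmetric_operad.planar_eval (free_operad \<Phi>) generator t) = t"
    and "leaves (symmetric_operad.planar_eval (free_operad \<Phi>) generator t) = [0..<length (leaves t)]"
proof -
  interpret F: symmetric_operad "free_operad \<Phi>" by (rule free_symmetric_operad)
  have "relabel (\<lambda>j. leaves t ! j) (F.planar_eval generator t) = t \<and>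
     leaves (F.planar_eval generator t) = [0..<length (leaves t)]"
    using assms
  proof (induction t)
    case (Leaf v)
    show ?case by (simp add: free_opunit relabel_def)
  next
    case (Node g ts)
    let ?ks = "map (length \<circ> leaves) ts"
    let ?p = "F.planar_eval generator"
    have IH: "relabel (\<lambda>j. leaves (ts ! i) ! j) (?p (ts ! i)) = ts ! i"
         "leaves (?p (ts ! i)) = [0..<length (leaves (ts ! i))]" if "i < length ts" for i
      using Node.IH[of "ts ! i"] Node.prems that by (auto simp: list_all_iff)
    have p: "?p (Node g ts) = Node g (map (\<lambda>i. relabel ((+) (block_start ?ks i)) (?p (ts ! i))) [0..<length ts])"
      by (auto simp: generator_def free_opcomp)
    have nt: "leaves (Node g ts) ! (block_start ?ks i + j) = leaves (ts ! i) ! j"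
      if "i < length ts" "j < length (leaves (ts ! i))" for i j
      using nth_concat_block[of "map leaves ts" ?ks i j] that by simp
    have A: "relabel (\<lambda>j. leaves (Node g ts) ! (block_start ?ks i + j)) (?p (ts ! i)) = ts ! i"
      if "i < length ts" for i
      by (rule trans[OF relabel_cong IH(1)[OF that]]) (use IH(2)[OF that] nt[OF that] in auto)
    have "relabel (\<lambda>j. leaves (Node g ts) ! j) (?p (Node g ts))
        = Node g (map (\<lambda>i. relabel (\<lambda>j. leaves (Node g ts) ! (block_start ?ks i + j)) (?p (ts ! i))) [0..<length ts])"
      unfolding p by (simp add: relabel_def graft_graft o_def)
    also have "\<dots> = Node g ts"
    proof -
      have "map (\<lambda>i. relabel (\<lambda>j. leaves (Node g ts) ! (block_start ?ks i + j)) (?p (ts ! i))) [0..<length ts]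
          = map ((!) ts) [0..<length ts]"
        by (rule map_cong[OF refl]) (rule A, simp)
      then show ?thesis by (simp only: map_nth)
    qed
    finally have 1: "relabel (\<lambda>j. leaves (Node g ts) ! j) (?p (Node g ts)) = Node g ts" .
    have "leaves (?p (Node g ts)) = concat (map (\<lambda>i. map ((+) (block_start ?ks i)) [0..<?ks ! i]) [0..<length ts])"
      unfolding p leaves.simps map_map
      by (rule arg_cong[of _ _ concat], rule map_cong[OF refl]) (simp add: leaves_relabel IH(2))
    also have "\<dots> = [0..<sum_list ?ks]"
    proof -
      let ?xss = "map (\<lambda>i. map ((+) (block_start ?ks i)) [0..<?ks ! i]) [0..<length ts]"
      have m: "map length ?xss = ?ks" by (rule nth_equalityI) simp_all
      have "length (concat ?xss) = sum_list ?ks" by (rule length_concat_block[OF m])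
      moreover have "concat ?xss ! q = q" if "q < sum_list ?ks" for q
      proof -
        from that obtain i j where ij: "i < length ?ks" "j < ?ks ! i" "q = block_start ?ks i + j"
          by (rule block_start_exhaust)
        have "concat ?xss ! q = ?xss ! i ! j" unfolding ij(3) by (rule nth_concat_block[OF m ij(1,2)])
        then show ?thesis using ij by simp
      qed
      ultimately show ?thesis by (intro nth_equalityI) simp_all
    qed
    also have "sum_list ?ks = length (leaves (Node g ts))" by (simp add: length_concat o_def)
    finally show ?case using 1 by blast
  qed
  then show "relabel (\<lambda>j. leaves t ! j) (F.planar_eval generator t) = t"
    "leaves (F.planar_eval generator t) = [0..<length (leaves t)]" by auto
qed

theorem free_operad_universal:
  fixes P :: "'p operad" and \<Phi> :: "nat \<Rightarrow> 'g set"
  assumes P: "symmetric_operad P" and h: "\<And>n g. g \<in> \<Phi> n \<Longrightarrow> h n g \<in> ops P n"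
  shows "\<exists>!H. operad_morphism (free_operad \<Phi>) P H \<and> (\<forall>n. \<forall>g\<in>\<Phi> n. H n (generator n g) = h n g)"
proof -
  interpret symmetric_operad P by (rule P)
  interpret F: symmetric_operad "free_operad \<Phi>" by (rule free_symmetric_operad)
  have pcl: "planar_eval h t \<in> ops P n" if "t \<in> ops (free_operad \<Phi>) n" for t n
  proof -
    have "well_formed \<Phi> t" using that by (simp add: free_ops_iff)
    from planar_eval_closed[where h = h and \<Phi> = \<Phi>, OF h this]
    show ?thesis unfolding length_leaves[OF that] .
  qed
  have ecl: "tree_eval h n t \<in> ops P n" if "t \<in> ops (free_operad \<Phi>) n" for t n
    unfolding tree_eval_def by (rule act_closed[OF word_permutes[OF that] pcl[OF that]])
  let ?H = "\<lambda>n. restrict (tree_eval h n) (ops (free_operad \<Phi>) n)"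
  have poid: "perm_of_list [0..<n] = id" for n by (auto simp: perm_of_list_def)
  show ?thesis
  proof (rule ex1I[of _ ?H])
    have "operad_morphism (free_operad \<Phi>) P ?H"
      unfolding operad_morphism_def
    proof (intro conjI allI impI)
      show "?H n \<in> ops (free_operad \<Phi>) n \<rightarrow>\<^sub>E ops P n" for n using ecl by auto
      have "tree_eval h 1 (opunit (free_operad \<Phi>)) = opunit P"
        using act_id[OF unit_closed] poid[of 1] by (simp add: tree_eval_def free_opunit)
      then show "?H 1 (opunit (free_operad \<Phi>)) = opunit P" using F.unit_closed by simp
    next
      fix n \<sigma> t assume s: "\<sigma> permutes {..<n}" and t: "t \<in> ops (free_operad \<Phi>) n"
      have "perm_of_list (map \<sigma> (leaves t)) = \<sigma> \<circ> perm_of_list (leaves t)"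
        using length_leaves[OF t] permutes_not_in[OF s] by (auto simp: perm_of_list_def)
      then show "?H n (opact (free_operad \<Phi>) n \<sigma> t) = opact P n \<sigma> (?H n t)"
        using F.act_closed[OF s t] t act_comp[OF s word_permutes[OF t] pcl[OF t]]
        by (simp add: tree_eval_def free_opact leaves_relabel planar_eval_relabel)
    next
      fix ks t ts assume t: "t \<in> ops (free_operad \<Phi>) (length ks)" and ts: "ts \<in> list_prod (map (ops (free_operad \<Phi>)) ks)"
      have "map2 ?H ks ts = map2 (tree_eval h) ks ts"
        using ts by (auto simp: list_eq_iff_nth_eq in_list_prod_iff)
      then show "?H (sum_list ks) (opcomp (free_operad \<Phi>) ks t ts) = opcomp P ks (?H (length ks) t) (map2 ?H ks ts)"
        using tree_eval_comp[where h = h and \<Phi> = \<Phi>, OF h t ts] F.comp_closed[OF t ts] t by (simp only: restrict_apply' simp_thms)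
    qed
    moreover have "?H n (generator n g) = h n g" if g: "g \<in> \<Phi> n" for n g
    proof -
      have "leaves (generator n g) = [0..<n]" by (simp add: generator_def o_def concat_map_singleton)
      moreover have "planar_eval h (generator n g) = h n g"
        using unit_right[OF h[OF g]] by (simp add: generator_def o_def map_replicate_const)
      ultimately show ?thesis
        using generator_closed[where \<Phi> = \<Phi>, OF g] act_id[OF h[OF g]] by (simp add: tree_eval_def poid)
    qed
    ultimately show "operad_morphism (free_operad \<Phi>) P ?H \<and> (\<forall>n. \<forall>g\<in>\<Phi> n. ?H n (generator n g) = h n g)"
      by blast
  next
    fix H assume H: "operad_morphism (free_operad \<Phi>) P H \<and> (\<forall>n. \<forall>g\<in>\<Phi> n. H n (generator n g) = h n g)"
    let ?p = "F.planar_eval generator"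
    have pc: "?p t \<in> ops (free_operad \<Phi>) (length (leaves t))" if "well_formed \<Phi> t" for t :: "('g, nat) optree"
      using F.planar_eval_closed[where h = generator and \<Phi> = \<Phi>, OF generator_closed that] .
    have Hp: "well_formed \<Phi> t \<Longrightarrow> H (length (leaves t)) (?p t) = planar_eval h t" for t :: "('g, nat) optree"
    proof (induction t)
      case (Leaf v)
      then show ?case using H by (simp add: operad_morphism_def)
    next
      case (Node g ts)
      let ?ks = "map (length \<circ> leaves) ts"
      have g: "g \<in> \<Phi> (length ts)" using Node.prems by simp
      have lp: "map ?p ts \<in> list_prod (map (ops (free_operad \<Phi>)) ?ks)"
        using pc Node.prems by (auto simp: in_list_prod_iff list_all_iff)
      have gc: "generator (length ts) g \<in> ops (free_operad \<Phi>) (length ?ks)"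
        using generator_closed[where \<Phi> = \<Phi>, OF g] by simp
      have "H (sum_list ?ks) (?p (Node g ts)) = opcomp P ?ks (H (length ?ks) (generator (length ts) g)) (map2 H ?ks (map ?p ts))"
        using H gc lp by (simp add: operad_morphism_def del: map_map length_map)
      also have "H (length ?ks) (generator (length ts) g) = h (length ts) g" using H g by simp
      also have "map2 H ?ks (map ?p ts) = map (planar_eval h) ts"
        using Node by (auto simp: list_eq_iff_nth_eq list_all_iff)
      finally show ?case by (simp add: length_concat o_def)
    qed
    show "H = ?H"
    proof (intro ext)
      fix n t
      show "H n t = ?H n t"
      proof (cases "t \<in> ops (free_operad \<Phi>) n")
        case True
        then have wf: "well_formed \<Phi> t" by (simp add: free_ops_iff)
        have len: "length (leaves t) = n" by (rule length_leaves[OF True])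
        have "relabel (perm_of_list (leaves t)) (?p t) = relabel (\<lambda>j. leaves t ! j) (?p t)"
          by (rule relabel_cong) (simp add: planar_free(2)[OF wf] perm_of_list_def)
        then have "t = opact (free_operad \<Phi>) n (perm_of_list (leaves t)) (?p t)"
          by (simp add: free_opact planar_free(1)[OF wf])
        then have "H n t = H n (opact (free_operad \<Phi>) n (perm_of_list (leaves t)) (?p t))" by simp
        also have "\<dots> = opact P n (perm_of_list (leaves t)) (H n (?p t))"
          using H word_permutes[OF True] pc[OF wf] len by (simp add: operad_morphism_def)
        also have "\<dots> = tree_eval h n t" using Hp[OF wf] len by (simp add: tree_eval_def)
        finally show ?thesis using True by simp
      next
        case False
        then show ?thesis using H by (auto simp: operad_morphism_def PiE_def extensional_def)
      qed
    qed
  qed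
qed

lemma terminal_symmetric_operad: "symmetric_operad terminal_operad"
  by unfold_locales (auto simp: terminal_operad_def)

lemma terminal_operad_universal:
  assumes "symmetric_operad P"
  shows "\<exists>!H. operad_morphism P terminal_operad H"
proof -
  interpret symmetric_operad P by fact
  show ?thesis
  proof (rule ex1I[of _ "\<lambda>n. \<lambda>x\<in>ops P n. ()"])
    show "operad_morphism P terminal_operad (\<lambda>n. \<lambda>x\<in>ops P n. ())"
      by (auto simp: operad_morphism_def terminal_operad_def)
  next
    fix H assume "operad_morphism P terminal_operad H"
    then have "H n \<in> extensional (ops P n)" for n by (auto simp: operad_morphism_def PiE_def)
    then show "H = (\<lambda>n. \<lambda>x\<in>ops P n. ())"
      by (auto intro!: ext)
  qed
qed


section \<open>Existence of categorifications\<close>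

text \<open>The categorification with respect to \<open>\<phi>\<close>: its arrows are the pairs of trees that \<open>\<phi>\<close>
  identifies.\<close>

definition categorification ::
  "'p operad \<Rightarrow> (nat \<Rightarrow> 'g set) \<Rightarrow> (nat \<Rightarrow> ('g, nat) optree \<Rightarrow> 'p) \<Rightarrow>
     (('g, nat) optree, ('g, nat) optree \<times> ('g, nat) optree) cat_operad" where
  "categorification P \<Phi> \<phi> =
     \<lparr> cat_at = (\<lambda>n.
         \<lparr> Ob = ops (free_operad \<Phi>) n,
           Arr = {(t, u). t \<in> ops (free_operad \<Phi>) n \<and> u \<in> ops (free_operad \<Phi>) n \<and> \<phi> n t = \<phi> n u},
           Dom = fst, Cod = snd, Idn = (\<lambda>t. (t, t)), Cmp = (\<lambda>g f. (fst f, snd g)) \<rparr>),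
       ccomp = (\<lambda>ks.
         \<lparr> omap = (\<lambda>(t, ts). opcomp (free_operad \<Phi>) ks t ts),
           amap = (\<lambda>(a, as). (opcomp (free_operad \<Phi>) ks (fst a) (map fst as),
                              opcomp (free_operad \<Phi>) ks (snd a) (map snd as))) \<rparr>),
       cunit = opunit (free_operad \<Phi>),
       cact = (\<lambda>n \<sigma>.
         \<lparr> omap = opact (free_operad \<Phi>) n \<sigma>,
           amap = map_prod (opact (free_operad \<Phi>) n \<sigma>) (opact (free_operad \<Phi>) n \<sigma>) \<rparr>) \<rparr>"

theorem categorification_exists:
  fixes P :: "'p operad" and \<Phi> :: "nat \<Rightarrow> 'g set"
  assumes P: "symmetric_operad P" and \<phi>: "operad_morphism (free_operad \<Phi>) P \<phi>"
  shows "\<exists>b f. is_categorification P \<Phi> \<phi> (categorification P \<Phi> \<phi>) b f"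
proof -
  interpret P: symmetric_operad P by fact
  interpret F: symmetric_operad "free_operad \<Phi>" by (rule free_symmetric_operad)
  let ?F = "free_operad \<Phi>" and ?Q = "categorification P \<Phi> \<phi>"
  have \<phi>_closed: "\<phi> n t \<in> ops P n" if "t \<in> ops ?F n" for n t
    using \<phi> that by (auto simp: operad_morphism_def)
  have \<phi>_act: "\<phi> n (opact ?F n \<sigma> t) = opact P n \<sigma> (\<phi> n t)" if "\<sigma> permutes {..<n}" "t \<in> ops ?F n" for n \<sigma> t
    using \<phi> that by (auto simp: operad_morphism_def)
  have \<phi>_comp: "\<phi> (sum_list ks) (opcomp ?F ks t ts) = opcomp P ks (\<phi> (length ks) t) (map2 \<phi> ks ts)"
    if "t \<in> ops ?F (length ks)" "ts \<in> list_prod (map (ops ?F) ks)" for ks t ts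
    using \<phi> that by (auto simp: operad_morphism_def)
  have obj: "obj_operad ?Q = ?F"
    by (simp add: obj_operad_def categorification_def)
  have arr_ops: "ops (arr_operad ?Q) n = {(t, u). t \<in> ops ?F n \<and> u \<in> ops ?F n \<and> \<phi> n t = \<phi> n u}" for n
    by (simp add: arr_operad_def categorification_def)
  have arr_comp: "opcomp (arr_operad ?Q) ks a as = (opcomp ?F ks (fst a) (map fst as), opcomp ?F ks (snd a) (map snd as))"
    for ks a as by (simp add: arr_operad_def categorification_def)
  have arr_unit: "opunit (arr_operad ?Q) = (opunit ?F, opunit ?F)"
    by (simp add: arr_operad_def categorification_def)
  have arr_act: "opact (arr_operad ?Q) n \<sigma> a = (opact ?F n \<sigma> (fst a), opact ?F n \<sigma> (snd a))" for n \<sigma> a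
    by (cases a) (simp add: arr_operad_def categorification_def)
  have lp: "map fst as \<in> list_prod (map (ops ?F) ks) \<and> map snd as \<in> list_prod (map (ops ?F) ks) \<and>
      map2 \<phi> ks (map fst as) = map2 \<phi> ks (map snd as)"
    if "as \<in> list_prod (map (ops (arr_operad ?Q)) ks)" for as ks
  proof -
    have l: "length as = length ks" using that by (simp add: in_list_prod_iff)
    have i: "fst (as ! i) \<in> ops ?F (ks ! i) \<and> snd (as ! i) \<in> ops ?F (ks ! i) \<and> \<phi> (ks ! i) (fst (as ! i)) = \<phi> (ks ! i) (snd (as ! i))"
      if "i < length ks" for i
    proof -
      have "as ! i \<in> ops (arr_operad ?Q) (ks ! i)"
        using that \<open>as \<in> _\<close> by (simp add: in_list_prod_iff)
      then show ?thesis unfolding arr_ops by auto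
    qed
    have "map2 \<phi> ks (map fst as) = map2 \<phi> ks (map snd as)"
      by (rule nth_equalityI) (use i l in auto)
    with i l show ?thesis by (simp add: in_list_prod_iff)
  qed
  have ops1: "fst a \<in> ops ?F n" "snd a \<in> ops ?F n" "\<phi> n (fst a) = \<phi> n (snd a)"
    if "a \<in> ops (arr_operad ?Q) n" for a n using that by (auto simp: arr_ops)
  have arr_closed: "opcomp (arr_operad ?Q) ks a as \<in> ops (arr_operad ?Q) (sum_list ks)"
    if "a \<in> ops (arr_operad ?Q) (length ks)" "as \<in> list_prod (map (ops (arr_operad ?Q)) ks)" for ks a as
    using lp[OF that(2)] ops1[OF that(1)]
    by (auto simp: arr_ops arr_comp \<phi>_comp F.comp_closed)
  have arr: "symmetric_operad (arr_operad ?Q)"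
  proof
    show "opcomp (arr_operad ?Q) ks f gs \<in> ops (arr_operad ?Q) (sum_list ks)"
      if "f \<in> ops (arr_operad ?Q) (length ks)" "gs \<in> list_prod (map (ops (arr_operad ?Q)) ks)" for f ks gs
      using that by (rule arr_closed)
    show "opunit (arr_operad ?Q) \<in> ops (arr_operad ?Q) 1"
      by (simp add: arr_unit arr_ops F.unit_closed[simplified])
    show "opact (arr_operad ?Q) n \<sigma> f \<in> ops (arr_operad ?Q) n"
      if "\<sigma> permutes {..<n}" "f \<in> ops (arr_operad ?Q) n" for \<sigma> n f
      using that ops1[OF that(2)] by (simp add: arr_ops arr_act F.act_closed \<phi>_act)
    fix f kss gs hss
    assume f: "f \<in> ops (arr_operad ?Q) (length kss)" and gs: "gs \<in> list_prod (map (ops (arr_operad ?Q) \<circ> length) kss)"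
      and hss: "list_all2 (\<lambda>hs ks. hs \<in> list_prod (map (ops (arr_operad ?Q)) ks)) hss kss"
    have gs': "gs \<in> list_prod (map (ops (arr_operad ?Q)) (map length kss))" using gs by simp
    have len: "length gs = length kss" "length hss = length kss"
      using gs hss by (auto simp: in_list_prod_iff list_all2_lengthD)
    have hf: "list_all2 (\<lambda>hs ks. hs \<in> list_prod (map (ops ?F) ks)) (map (map fst) hss) kss"
      and hs: "list_all2 (\<lambda>hs ks. hs \<in> list_prod (map (ops ?F) ks)) (map (map snd) hss) kss"
      using hss lp unfolding list_all2_conv_all_nth by auto
    note 1 = F.comp_assoc[OF ops1(1)[OF f], of "map fst gs", OF _ hf]
      and 2 = F.comp_assoc[OF ops1(2)[OF f], of "map snd gs", OF _ hs]
    have m: "map fst (map2 (\<lambda>ks (g, hs). opcomp (arr_operad ?Q) ks g hs) kss (zip gs hss))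
        = map2 (\<lambda>ks (g, hs). opcomp ?F ks g hs) kss (zip (map fst gs) (map (map fst) hss))"
      "map snd (map2 (\<lambda>ks (g, hs). opcomp (arr_operad ?Q) ks g hs) kss (zip gs hss))
        = map2 (\<lambda>ks (g, hs). opcomp ?F ks g hs) kss (zip (map snd gs) (map (map snd) hss))"
      by (rule nth_equalityI; simp add: len arr_comp)+
    show "opcomp (arr_operad ?Q) (concat kss) (opcomp (arr_operad ?Q) (map length kss) f gs) (concat hss)
        = opcomp (arr_operad ?Q) (map sum_list kss) f (map2 (\<lambda>ks (g, hs). opcomp (arr_operad ?Q) ks g hs) kss (zip gs hss))"
      using 1 2 lp[OF gs'] unfolding arr_comp[of "concat kss"] arr_comp[of "map length kss"] arr_comp[of "map sum_list kss"] m
      by (simp add: map_concat)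
  next
    fix f n assume f: "f \<in> ops (arr_operad ?Q) n"
    show "opcomp (arr_operad ?Q) [n] (opunit (arr_operad ?Q)) [f] = f"
      using ops1[OF f] by (simp add: arr_comp arr_unit F.unit_left)
    show "opcomp (arr_operad ?Q) (replicate n 1) f (replicate n (opunit (arr_operad ?Q))) = f"
      using ops1[OF f] F.unit_right by (simp add: arr_comp arr_unit)
    show "opact (arr_operad ?Q) n id f = f"
      using ops1[OF f] by (simp add: arr_act F.act_id)
    show "opact (arr_operad ?Q) n (\<sigma> \<circ> \<tau>) f = opact (arr_operad ?Q) n \<sigma> (opact (arr_operad ?Q) n \<tau> f)"
      if "\<sigma> permutes {..<n}" "\<tau> permutes {..<n}" for \<sigma> \<tau>
      using ops1[OF f] F.act_comp[OF that] by (simp add: arr_act)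
  next
    fix \<sigma> ks f gs assume s: "\<sigma> permutes {..<length ks}" and f: "f \<in> ops (arr_operad ?Q) (length ks)"
      and gs: "gs \<in> list_prod (map (ops (arr_operad ?Q)) ks)"
    have "\<sigma> permutes {..<length gs}" using s gs by (simp add: in_list_prod_iff)
    note p = permute_list_map[OF this]
    show "opcomp (arr_operad ?Q) ks (opact (arr_operad ?Q) (length ks) \<sigma> f) gs
        = opact (arr_operad ?Q) (sum_list ks) (block_perm ks \<sigma>) (opcomp (arr_operad ?Q) (permute_list \<sigma> ks) f (permute_list \<sigma> gs))"
      using F.equivariant_outer[OF s ops1(1)[OF f], of "map fst gs"] F.equivariant_outer[OF s ops1(2)[OF f], of "map snd gs"] lp[OF gs]
      by (simp add: arr_comp arr_act p)
  next
    fix f ks gs \<sigma>s assume f: "f \<in> ops (arr_operad ?Q) (length ks)" and gs: "gs \<in> list_prod (map (ops (arr_operad ?Q)) ks)"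
      and s: "list_all2 (\<lambda>\<sigma> k. \<sigma> permutes {..<k}) \<sigma>s ks"
    have len: "length gs = length ks" "length \<sigma>s = length ks" using gs s by (auto simp: in_list_prod_iff list_all2_lengthD)
    have m: "map fst (map2 (\<lambda>k (\<sigma>, g). opact (arr_operad ?Q) k \<sigma> g) ks (zip \<sigma>s gs)) = map2 (\<lambda>k (\<sigma>, g). opact ?F k \<sigma> g) ks (zip \<sigma>s (map fst gs))"
      "map snd (map2 (\<lambda>k (\<sigma>, g). opact (arr_operad ?Q) k \<sigma> g) ks (zip \<sigma>s gs)) = map2 (\<lambda>k (\<sigma>, g). opact ?F k \<sigma> g) ks (zip \<sigma>s (map snd gs))"
      by (rule nth_equalityI; simp add: len arr_act)+
    show "opcomp (arr_operad ?Q) ks f (map2 (\<lambda>k (\<sigma>, g). opact (arr_operad ?Q) k \<sigma> g) ks (zip \<sigma>s gs))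
        = opact (arr_operad ?Q) (sum_list ks) (perm_sum ks \<sigma>s) (opcomp (arr_operad ?Q) ks f gs)"
      using F.equivariant_inner[OF ops1(1)[OF f] _ s, of "map fst gs"] F.equivariant_inner[OF ops1(2)[OF f] _ s, of "map snd gs"] lp[OF gs]
      unfolding arr_comp[of ks] m by (simp add: arr_act)
  qed
  have cat_at: "cat_at ?Q n = \<lparr> Ob = ops ?F n, Arr = ops (arr_operad ?Q) n,
       Dom = fst, Cod = snd, Idn = (\<lambda>t. (t, t)), Cmp = (\<lambda>g f. (fst f, snd g)) \<rparr>" for n
    unfolding arr_ops by (simp add: categorification_def)
  have Q: "symmetric_cat_operad ?Q"
  proof (rule symmetric_cat_operad.intro)
    show "is_category (cat_at ?Q n)" for n
      unfolding cat_at by (auto simp: is_category_def Hom_def arr_ops)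
    show "symmetric_operad (obj_operad ?Q)" unfolding obj by (rule free_symmetric_operad)
    show "symmetric_operad (arr_operad ?Q)" by (rule arr)
    show "is_functor (cat_at ?Q n) (cat_at ?Q n) (cact ?Q n \<sigma>)" if s: "\<sigma> permutes {..<n}" for n \<sigma>
    proof -
      have "omap (cact ?Q n \<sigma>) = opact ?F n \<sigma>" "amap (cact ?Q n \<sigma>) = map_prod (opact ?F n \<sigma>) (opact ?F n \<sigma>)"
        by (simp_all add: categorification_def)
      then show ?thesis
        using s F.act_closed[OF s] unfolding cat_at
        by (auto simp: is_functor_def Hom_def arr_ops \<phi>_act)
    qed
    fix ks
    have "map Ob (map (cat_at ?Q) ks) = map (ops ?F) ks" "map Arr (map (cat_at ?Q) ks) = map (ops (arr_operad ?Q)) ks"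
      by (simp_all add: cat_at)
    note o = this
    let ?A = "prod_cat (cat_at ?Q (length ks)) (list_prod_cat (map (cat_at ?Q) ks))"
    have A: "Ob ?A = ops ?F (length ks) \<times> list_prod (map (ops ?F) ks)"
      "Arr ?A = ops (arr_operad ?Q) (length ks) \<times> list_prod (map (ops (arr_operad ?Q)) ks)"
      by (simp_all add: prod_cat_def list_prod_cat_def cat_at o_def)
    have D: "Dom ?A (a, as) = (fst a, map fst as)" "Cod ?A (a, as) = (snd a, map snd as)"
      "Cmp ?A (a', as') (a, as) = ((fst a, snd a'), map2 (\<lambda>g f. (fst f, snd g)) as' as)"
      if "length as = length ks" "length as' = length ks" for a as a' as'
      using that by (auto simp: prod_cat_def list_prod_cat_def cat_at intro!: nth_equalityI)
    have I: "Idn ?A (t, ts) = ((t, t), map (\<lambda>t. (t, t)) ts)" if "length ts = length ks" for t ts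
      using that by (auto simp: prod_cat_def list_prod_cat_def cat_at intro!: nth_equalityI)
    have C: "omap (ccomp ?Q ks) (t, ts) = opcomp ?F ks t ts"
      "amap (ccomp ?Q ks) (a, as) = opcomp (arr_operad ?Q) ks a as" for t ts a as
      unfolding arr_comp by (simp_all add: categorification_def)
    show "is_functor ?A (cat_at ?Q (sum_list ks)) (ccomp ?Q ks)"
      unfolding is_functor_def
    proof (intro conjI ballI impI)
      fix x assume "x \<in> Ob ?A"
      then obtain t ts where x: "x = (t, ts)" "t \<in> ops ?F (length ks)" "ts \<in> list_prod (map (ops ?F) ks)" by (auto simp: A)
      then have l: "length ts = length ks" by (simp add: in_list_prod_iff)
      show "omap (ccomp ?Q ks) x \<in> Ob (cat_at ?Q (sum_list ks))"
        using x F.comp_closed by (simp add: C cat_at)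
      show "amap (ccomp ?Q ks) (Idn ?A x) = Idn (cat_at ?Q (sum_list ks)) (omap (ccomp ?Q ks) x)"
        unfolding x I[OF l] C by (simp add: cat_at arr_comp o_def)
    next
      fix x assume "x \<in> Arr ?A"
      then obtain a as where x: "x = (a, as)" "a \<in> ops (arr_operad ?Q) (length ks)" "as \<in> list_prod (map (ops (arr_operad ?Q)) ks)" by (auto simp: A)
      then have l: "length as = length ks" by (simp add: in_list_prod_iff)
      show "amap (ccomp ?Q ks) x \<in> Hom (cat_at ?Q (sum_list ks)) (omap (ccomp ?Q ks) (Dom ?A x)) (omap (ccomp ?Q ks) (Cod ?A x))"
        using arr_closed[OF x(2,3)] unfolding x D[OF l l] C by (simp add: cat_at Hom_def arr_comp)
      fix y assume "y \<in> Arr ?A" and yx: "Dom ?A y = Cod ?A x"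
      then obtain a' as' where y: "y = (a', as')" "a' \<in> ops (arr_operad ?Q) (length ks)" "as' \<in> list_prod (map (ops (arr_operad ?Q)) ks)" by (auto simp: A)
      then have l': "length as' = length ks" by (simp add: in_list_prod_iff)
      have m: "map fst (map2 (\<lambda>g f. (fst f, snd g)) as' as) = map fst as" "map snd (map2 (\<lambda>g f. (fst f, snd g)) as' as) = map snd as'"
        by (rule nth_equalityI; simp add: l l')+
      show "amap (ccomp ?Q ks) (Cmp ?A y x) = Cmp (cat_at ?Q (sum_list ks)) (amap (ccomp ?Q ks) y) (amap (ccomp ?Q ks) x)"
        unfolding x y D[OF l l'] C by (simp only: cat_at arr_comp m category.simps fst_conv snd_conv)
    qed
  qed
  let ?b = "\<lambda>n. \<lparr>omap = (\<lambda>t\<in>ops ?F n. t), amap = (\<lambda>t\<in>ops ?F n. (t, t))\<rparr>"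
  let ?f = "\<lambda>n. \<lparr>omap = \<phi> n, amap = (\<lambda>a\<in>ops (arr_operad ?Q) n. \<phi> n (fst a))\<rparr>"
  have disc: "obj_operad (discrete_operad R) = \<lparr>ops = ops R, opcomp = opcomp R, opunit = opunit R, opact = opact R\<rparr>"
    "arr_operad (discrete_operad R) = \<lparr>ops = ops R, opcomp = opcomp R, opunit = opunit R, opact = opact R\<rparr>"
    "cat_at (discrete_operad R) n = discrete_cat (ops R n)" for R :: "'x operad" and n
    by (simp_all add: obj_operad_def arr_operad_def discrete_operad_def discrete_cat_def)
  have b: "cat_operad_morphism (discrete_operad ?F) ?Q ?b"
    unfolding cat_operad_morphism_def
  proof (intro conjI allI)
    show "?b n \<in> functors (cat_at (discrete_operad ?F) n) (cat_at ?Q n)" for n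
      by (simp add: functors_def is_functor_def disc cat_at discrete_cat_def Hom_def arr_ops)
    have m: "map2 (\<lambda>n. \<lambda>t\<in>ops ?F n. t) ks gs = gs" "map2 (\<lambda>n. \<lambda>t\<in>ops ?F n. (t, t)) ks gs = map (\<lambda>t. (t, t)) gs"
      if "gs \<in> list_prod (map (ops ?F) ks)" for gs ks
      using that by (auto intro!: nth_equalityI simp: in_list_prod_iff)
    show "operad_morphism (obj_operad (discrete_operad ?F)) (obj_operad ?Q) (\<lambda>n. omap (?b n))"
      using F.unit_closed unfolding obj disc
      by (auto simp: operad_morphism_def m[unfolded restrict_def] F.comp_closed F.act_closed)
    show "operad_morphism (arr_operad (discrete_operad ?F)) (arr_operad ?Q) (\<lambda>n. amap (?b n))"
      using F.unit_closed unfolding disc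
      by (auto simp: operad_morphism_def m[unfolded restrict_def] F.comp_closed F.act_closed arr_ops arr_comp arr_act arr_unit o_def)
  qed
  have f: "cat_operad_morphism ?Q (discrete_operad P) ?f"
    unfolding cat_operad_morphism_def
  proof (intro conjI allI)
    have e: "\<phi> n \<in> extensional (ops ?F n)" for n
      using \<phi> by (auto simp: operad_morphism_def PiE_def)
    show "?f n \<in> functors (cat_at ?Q n) (cat_at (discrete_operad P) n)" for n
      using e by (auto simp: functors_def is_functor_def disc cat_at discrete_cat_def Hom_def arr_ops \<phi>_closed)
    show "operad_morphism (obj_operad ?Q) (obj_operad (discrete_operad P)) (\<lambda>n. omap (?f n))"
      using \<phi> unfolding obj disc by (simp add: operad_morphism_def)
    have m: "map2 (\<lambda>n. \<lambda>a\<in>ops (arr_operad ?Q) n. \<phi> n (fst a)) ks gs = map2 \<phi> ks (map fst gs)"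
      if "gs \<in> list_prod (map (ops (arr_operad ?Q)) ks)" for gs ks
      using that by (auto intro!: nth_equalityI simp: in_list_prod_iff)
    have u: "\<phi> 1 (opunit ?F) = opunit P" using \<phi> by (simp add: operad_morphism_def)
    interpret A: symmetric_operad "arr_operad ?Q" by (rule arr)
    show "operad_morphism (arr_operad ?Q) (arr_operad (discrete_operad P)) (\<lambda>n. amap (?f n))"
      unfolding operad_morphism_def disc
    proof (intro conjI allI impI)
      show "amap (?f n) \<in> ops (arr_operad ?Q) n \<rightarrow>\<^sub>E ops \<lparr>ops = ops P, opcomp = opcomp P, opunit = opunit P, opact = opact P\<rparr> n" for n
        using ops1 \<phi>_closed by auto
      show "amap (?f 1) (opunit (arr_operad ?Q)) = opunit \<lparr>ops = ops P, opcomp = opcomp P, opunit = opunit P, opact = opact P\<rparr>"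
        using A.unit_closed u by (simp add: arr_unit)
    next
      fix n \<sigma> a assume "\<sigma> permutes {..<n}" and a: "a \<in> ops (arr_operad ?Q) n"
      then show "amap (?f n) (opact (arr_operad ?Q) n \<sigma> a) = opact \<lparr>ops = ops P, opcomp = opcomp P, opunit = opunit P, opact = opact P\<rparr> n \<sigma> (amap (?f n) a)"
        using A.act_closed ops1(1)[OF a] by (simp add: arr_act \<phi>_act)
    next
      fix ks a as assume a: "a \<in> ops (arr_operad ?Q) (length ks)" and as: "as \<in> list_prod (map (ops (arr_operad ?Q)) ks)"
      have "map2 (\<lambda>n. amap (?f n)) ks as = map2 \<phi> ks (map fst as)" using m[OF as] by simp
      then show "amap (?f (sum_list ks)) (opcomp (arr_operad ?Q) ks a as)
         = opcomp \<lparr>ops = ops P, opcomp = opcomp P, opunit = opunit P, opact = opact P\<rparr> ks (amap (?f (length ks)) a) (map2 (\<lambda>n. amap (?f n)) ks as)"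
        using arr_closed[OF a as] a ops1(1)[OF a] lp[OF as] by (simp add: arr_comp \<phi>_comp)
    qed
  qed
  have "is_categorification P \<Phi> \<phi> ?Q ?b ?f"
    unfolding is_categorification_def
  proof (intro conjI allI ballI Q b f)
    show "bij_betw (omap (?b n)) (ops ?F n) (Ob (cat_at ?Q n))" for n
      by (auto simp: bij_betw_def inj_on_def cat_at)
    show "full_and_faithful (cat_at ?Q n) (discrete_cat (ops P n)) (?f n)" for n
      by (auto simp: full_and_faithful_def cat_at bij_betw_def inj_on_def Hom_def discrete_cat_def arr_ops \<phi>_closed image_def)
  qed simp
  then show ?thesis by blast
qed

lemma surj_operad_morphism_coequalizes:
  assumes F: "symmetric_operad F" and P: "symmetric_operad P" and \<phi>: "operad_morphism F P \<phi>"
    and surj: "\<And>n. \<phi> n ` ops F n = ops P n"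
    and \<psi>: "operad_morphism F R \<psi>"
    and kernel: "\<And>n t u. \<lbrakk>t \<in> ops F n; u \<in> ops F n; \<phi> n t = \<phi> n u\<rbrakk> \<Longrightarrow> \<psi> n t = \<psi> n u"
  shows "\<exists>!\<chi>. operad_morphism P R \<chi> \<and> (\<forall>n. \<forall>t\<in>ops F n. \<chi> n (\<phi> n t) = \<psi> n t)"
proof -
  interpret F: symmetric_operad F by fact
  interpret P: symmetric_operad P by fact
  define s where "s n p = (SOME t. t \<in> ops F n \<and> \<phi> n t = p)" for n p
  have s: "s n p \<in> ops F n" "\<phi> n (s n p) = p" if "p \<in> ops P n" for n p
  proof -
    have "\<exists>t. t \<in> ops F n \<and> \<phi> n t = p" using surj[of n] that by (metis imageE)
    from someI_ex[OF this] show "s n p \<in> ops F n" "\<phi> n (s n p) = p" by (simp_all add: s_def)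
  qed
  let ?\<chi> = "\<lambda>n. \<lambda>p\<in>ops P n. \<psi> n (s n p)"
  have \<phi>_closed: "\<phi> n t \<in> ops P n" if "t \<in> ops F n" for n t using surj that by blast
  have \<chi>: "?\<chi> n (\<phi> n t) = \<psi> n t" if "t \<in> ops F n" for n t
    using kernel[of "s n (\<phi> n t)" n t] s[OF \<phi>_closed[OF that]] \<phi>_closed[OF that] that by simp
  have lift: "ops P n \<subseteq> \<phi> n ` ops F n" for n by (simp add: surj)
  have "operad_morphism P R ?\<chi>"
    unfolding operad_morphism_def
  proof (intro conjI allI impI)
    show "?\<chi> n \<in> ops P n \<rightarrow>\<^sub>E ops R n" for n
    proof -
      have "\<psi> n t \<in> ops R n" if "t \<in> ops F n" for t using \<psi> that by (auto simp: operad_morphism_def)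
      then show ?thesis using s(1) by auto
    qed
    have "\<phi> 1 (opunit F) = opunit P" "\<psi> 1 (opunit F) = opunit R" using \<phi> \<psi> by (simp_all add: operad_morphism_def)
    then show "?\<chi> 1 (opunit P) = opunit R" using \<chi>[OF F.unit_closed] by simp
  next
    fix n \<sigma> p assume \<sigma>: "\<sigma> permutes {..<n}" and p: "p \<in> ops P n"
    have "\<phi> n (opact F n \<sigma> (s n p)) = opact P n \<sigma> p" "\<psi> n (opact F n \<sigma> (s n p)) = opact R n \<sigma> (\<psi> n (s n p))"
      using \<phi> \<psi> \<sigma> s[OF p] by (simp_all add: operad_morphism_def)
    then show "?\<chi> n (opact P n \<sigma> p) = opact R n \<sigma> (?\<chi> n p)"
      using \<chi>[OF F.act_closed[OF \<sigma> s(1)[OF p]]] p by simp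
  next
    fix ks p ps assume p: "p \<in> ops P (length ks)" and ps: "ps \<in> list_prod (map (ops P) ks)"
    let ?ts = "map2 s ks ps"
    have len: "length ps = length ks" using ps by (simp add: in_list_prod_iff)
    have i: "ps ! i \<in> ops P (ks ! i)" if "i < length ks" for i using ps that by (simp add: in_list_prod_iff)
    have ts: "?ts \<in> list_prod (map (ops F) ks)" using i s len by (simp add: in_list_prod_iff)
    have 1: "map2 \<phi> ks ?ts = ps" "map2 \<psi> ks ?ts = map2 ?\<chi> ks ps"
      by (rule nth_equalityI; simp add: len i s)+
    have "\<phi> (sum_list ks) (opcomp F ks (s (length ks) p) ?ts) = opcomp P ks p ps"
      "\<psi> (sum_list ks) (opcomp F ks (s (length ks) p) ?ts) = opcomp R ks (\<psi> (length ks) (s (length ks) p)) (map2 ?\<chi> ks ps)"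
      proof -
      have "\<phi> (sum_list ks) (opcomp F ks (s (length ks) p) ?ts) = opcomp P ks (\<phi> (length ks) (s (length ks) p)) (map2 \<phi> ks ?ts)"
        "\<psi> (sum_list ks) (opcomp F ks (s (length ks) p) ?ts) = opcomp R ks (\<psi> (length ks) (s (length ks) p)) (map2 \<psi> ks ?ts)"
        using \<phi> \<psi> s(1)[OF p] ts unfolding operad_morphism_def by blast+
      then show "\<phi> (sum_list ks) (opcomp F ks (s (length ks) p) ?ts) = opcomp P ks p ps"
        "\<psi> (sum_list ks) (opcomp F ks (s (length ks) p) ?ts) = opcomp R ks (\<psi> (length ks) (s (length ks) p)) (map2 ?\<chi> ks ps)"
        unfolding 1 s(2)[OF p] .
    qed
    then show "?\<chi> (sum_list ks) (opcomp P ks p ps) = opcomp R ks (?\<chi> (length ks) p) (map2 ?\<chi> ks ps)"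
      using \<chi>[OF F.comp_closed[OF s(1)[OF p] ts]] by (simp only: restrict_apply'[OF p])
  qed
  moreover have "\<chi> = ?\<chi>" if c: "operad_morphism P R \<chi>" "\<forall>n. \<forall>t\<in>ops F n. \<chi> n (\<phi> n t) = \<psi> n t" for \<chi>
  proof (intro ext)
    fix n p
    have "\<chi> n \<in> ops P n \<rightarrow>\<^sub>E ops R n" using c(1) unfolding operad_morphism_def by blast
    then have e: "\<chi> n \<in> extensional (ops P n)" by (simp add: PiE_def)
    show "\<chi> n p = ?\<chi> n p"
    proof (cases "p \<in> ops P n")
      case True
      then show ?thesis using bspec[OF spec[OF c(2), of n] s(1)[OF True]] s(2)[OF True] by simp
    next
      case False
      then show ?thesis using extensional_arb[OF e False] by simp
    qed
  qed
  moreover have "\<forall>n. \<forall>t\<in>ops F n. ?\<chi> n (\<phi> n t) = \<psi> n t"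
    by (intro allI ballI) (rule \<chi>)
  ultimately show ?thesis
    by (intro ex1I[of _ ?\<chi>]) (rule conjI, assumption, assumption, elim conjE, assumption)
qed

lemma cmon_signature_onto:
  fixes \<phi> :: "nat \<Rightarrow> (cmon_gen, nat) optree \<Rightarrow> unit"
  shows "\<phi> n ` ops (free_operad cmon_signature) n = ops terminal_operad n"
proof -
  have "\<exists>t. t \<in> ops (free_operad cmon_signature) n"
  proof (induction n)
    case 0
    have "Node Gen_e [] \<in> ops (free_operad cmon_signature) 0" by (simp add: free_ops_iff cmon_signature_def)
    then show ?case ..
  next
    case (Suc n)
    then obtain t where "t \<in> ops (free_operad cmon_signature) n" ..
    then have "well_formed cmon_signature t" "distinct (leaves t)" "set (leaves t) = {..<n}"
      by (simp_all add: free_ops_iff)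
    then have "Node Gen_dot [Leaf n, t] \<in> ops (free_operad cmon_signature) (Suc n)"
      by (simp add: free_ops_iff cmon_signature_def lessThan_Suc)
    then show ?case ..
  qed
  then obtain t where "t \<in> ops (free_operad cmon_signature) n" ..
  then have "\<phi> n t \<in> \<phi> n ` ops (free_operad cmon_signature) n" by (rule imageI)
  then have "() \<in> \<phi> n ` ops (free_operad cmon_signature) n" by simp
  then show ?thesis unfolding terminal_operad_def operad.simps by (intro equalityI subsetI) simp_all
qed

text \<open>The morphism to the terminal operad is the coequalizer of its kernel pair, hence a regular
  epimorphism.\<close>

theorem cmon_signature_regular_epi:
  assumes "operad_morphism (free_operad cmon_signature) terminal_operad \<phi>"
    and "operad_morphism (free_operad cmon_signature) R \<psi>"
    and "\<And>n t u. \<lbrakk>t \<in> ops (free_operad cmon_signature) n; u \<in> ops (free_operad cmon_signature) n;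
            \<phi> n t = \<phi> n u\<rbrakk> \<Longrightarrow> \<psi> n t = \<psi> n u"
  shows "\<exists>!\<chi>. operad_morphism terminal_operad R \<chi> \<and>
           (\<forall>n. \<forall>t\<in>ops (free_operad cmon_signature) n. \<chi> n (\<phi> n t) = \<psi> n t)"
  using free_symmetric_operad terminal_symmetric_operad assms(1) cmon_signature_onto assms(2,3)
  by (rule surj_operad_morphism_coequalizes)

end

theory Submission
  imports Defs
begin

text \<open>
  An object of \<open>Q\<^sub>n\<close> is a tree of binary and nullary products whose leaves are numbered
  \<open>0, \<dots>, n - 1\<close>, and between two such trees there is exactly one arrow. A \<open>Q\<close>-algebra therefore
  assigns to every tree a functor and to every pair of trees a natural transformation, compatibly with
  the grafting of trees and the renumbering of leaves; the locale \<open>tree_algebra\<close> records this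
  data. The statement thus is the coherence theorem for symmetric monoidal categories, in a
  form that keeps track of the leaves.

  Given a symmetric monoidal structure, the relation \<open>coh t u a\<close> says that the family \<open>a\<close>, indexed by
  assignments of objects to leaves, is a composite of instances of the structure isomorphisms
  leading from \<open>t\<close> to \<open>u\<close>. It is closed under grafting by construction. If no leaf occurs twice
  in \<open>t\<close> or in \<open>u\<close>, then \<open>a\<close> exists as soon as \<open>t\<close> and \<open>u\<close> have the same leaves (\<open>coh_exists\<close>), and it
  is determined by \<open>t\<close> and \<open>u\<close> (\<open>coh_unique\<close>). For the proof, trees act on words: every tree \<open>t\<close> and word \<open>w\<close> yield an
  isomorphism \<open>norm x t w\<close> from \<open>t \<otimes> w\<close> to the word obtained by inserting the leaves
  of \<open>t\<close> into \<open>w\<close> one by one, as in insertion sort. The structure isomorphisms are compatible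
  with this action (\<open>coh_norm\<close>). For \<open>\<alpha>\<close>, \<open>\<lambda>\<close> and \<open>\<rho>\<close> this is the pentagon and the triangles; for
  \<open>\<tau>\<close> it says that two trees without a common leaf act by commuting operations
  (\<open>commute_disjoint\<close>), which reduces to the case of two leaves and there to the Yang-Baxter
  equation \<open>swap_braid\<close>. The trees with the arrows of \<open>coh\<close> then form a tree algebra
  (\<open>sym_mon_cat.tree_algebra\<close>).

  Conversely, in a tree algebra all composites of structure isomorphisms from \<open>t\<close> to \<open>u\<close>
  are equal to the transformation assigned to \<open>(t, u)\<close> (\<open>coh_represents\<close>). Applied to the two sides of each axiom
  of Mac Lane, this shows that the structure read off from the algebra is symmetric monoidal;
  together with \<open>coh_exists\<close> it shows that this structure determines the algebra.
\<close>

section \<open>Categories and invertible arrows\<close>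

text \<open>A chosen inverse is needed because coherence arrows are built as terms, which contain
  inverses of structure isomorphisms.\<close>

definition arr_inv :: "('o, 'a) category \<Rightarrow> 'a \<Rightarrow> 'a" where
  "arr_inv C f = (THE g. g \<in> Hom C (Cod C f) (Dom C f) \<and>
     Cmp C g f = Idn C (Dom C f) \<and> Cmp C f g = Idn C (Cod C f))"

locale cat =
  fixes C :: "('o, 'a) category"
  assumes category: "is_category C"
begin

abbreviation comp :: "'a \<Rightarrow> 'a \<Rightarrow> 'a" (infixr "\<cdot>" 60) where "g \<cdot> f \<equiv> Cmp C g f"

lemma dom_cod_ob [simp]: "f \<in> Arr C \<Longrightarrow> Dom C f \<in> Ob C" "f \<in> Arr C \<Longrightarrow> Cod C f \<in> Ob C"
  using category by (auto simp: is_category_def)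

lemma id_arr [simp]: "A \<in> Ob C \<Longrightarrow> Idn C A \<in> Arr C" "A \<in> Ob C \<Longrightarrow> Dom C (Idn C A) = A"
    "A \<in> Ob C \<Longrightarrow> Cod C (Idn C A) = A"
  using category by (auto simp: is_category_def Hom_def)

lemma comp_arr [simp]:
  assumes "f \<in> Arr C" "g \<in> Arr C" "Dom C g = Cod C f"
  shows "g \<cdot> f \<in> Arr C" "Dom C (g \<cdot> f) = Dom C f" "Cod C (g \<cdot> f) = Cod C g"
  using category assms by (auto simp: is_category_def Hom_def)

lemma comp_id [simp]: "f \<in> Arr C \<Longrightarrow> Dom C f = A \<Longrightarrow> f \<cdot> Idn C A = f"
    "f \<in> Arr C \<Longrightarrow> Cod C f = A \<Longrightarrow> Idn C A \<cdot> f = f"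
  using category by (auto simp: is_category_def)

lemma comp_assoc [simp]:
  "\<lbrakk>f \<in> Arr C; g \<in> Arr C; h \<in> Arr C; Dom C g = Cod C f; Dom C h = Cod C g\<rbrakk>
     \<Longrightarrow> (h \<cdot> g) \<cdot> f = h \<cdot> g \<cdot> f"
  using category by (simp add: is_category_def)

text \<open>With composites bracketed to the right, an equation \<open>g \<cdot> f = k\<close> has to be applied in front
  of a further arrow \<open>h\<close>; \<open>comp_extend\<close> and \<open>comp_extend2\<close> provide this form.\<close>

lemma comp_extend:
  "\<lbrakk>g \<cdot> f = k; f \<in> Arr C; g \<in> Arr C; Dom C g = Cod C f; h \<in> Arr C; Cod C h = Dom C f\<rbrakk>
     \<Longrightarrow> g \<cdot> f \<cdot> h = k \<cdot> h"
  using comp_assoc[of h f g] by simp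

lemma comp_extend2:
  assumes eq: "g \<cdot> f = g' \<cdot> f'"
    and f: "f \<in> Arr C" "g \<in> Arr C" "Dom C g = Cod C f" and f': "f' \<in> Arr C" "g' \<in> Arr C" "Dom C g' = Cod C f'"
    and h: "h \<in> Arr C" "Cod C h = Dom C f"
  shows "g \<cdot> f \<cdot> h = g' \<cdot> f' \<cdot> h"
proof -
  have "Dom C f' = Dom C f" using arg_cong[OF eq, of "Dom C"] f f' by simp
  then have "g' \<cdot> f' \<cdot> h = (g' \<cdot> f') \<cdot> h" using f' h by simp
  then show ?thesis unfolding eq[symmetric] using f h by simp
qed

lemma inverse_unique:
  assumes "f \<in> Arr C" "g \<in> Hom C (Cod C f) (Dom C f)" "g' \<in> Hom C (Cod C f) (Dom C f)"
    "g \<cdot> f = Idn C (Dom C f)" "f \<cdot> g' = Idn C (Cod C f)"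
  shows "g = g'"
proof -
  have "g = g \<cdot> f \<cdot> g'" using assms by (simp add: Hom_def)
  also have "\<dots> = (g \<cdot> f) \<cdot> g'" using assms by (subst comp_assoc) (auto simp: Hom_def)
  also have "\<dots> = g'" using assms by (simp add: Hom_def)
  finally show ?thesis .
qed

lemma arr_inv_eq:
  assumes "f \<in> Arr C" "g \<in> Hom C (Cod C f) (Dom C f)"
    "g \<cdot> f = Idn C (Dom C f)" "f \<cdot> g = Idn C (Cod C f)"
  shows "arr_inv C f = g"
  unfolding arr_inv_def
proof (rule the_equality)
  show "k = g" if "k \<in> Hom C (Cod C f) (Dom C f) \<and> k \<cdot> f = Idn C (Dom C f) \<and> f \<cdot> k = Idn C (Cod C f)" for k
    using inverse_unique[OF assms(1), of k g] that assms by simp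
qed (use assms in simp)

lemma iso_arr [simp]: "is_iso C f \<Longrightarrow> f \<in> Arr C" by (simp add: is_iso_def)

lemma inv_arr:
  assumes "is_iso C f"
  shows "arr_inv C f \<in> Arr C" "Dom C (arr_inv C f) = Cod C f" "Cod C (arr_inv C f) = Dom C f"
    "arr_inv C f \<cdot> f = Idn C (Dom C f)" "f \<cdot> arr_inv C f = Idn C (Cod C f)"
proof -
  obtain g where g: "g \<in> Hom C (Cod C f) (Dom C f)" "g \<cdot> f = Idn C (Dom C f)" "f \<cdot> g = Idn C (Cod C f)"
    using assms by (auto simp: is_iso_def)
  have "arr_inv C f = g" using assms g by (intro arr_inv_eq) (auto simp: is_iso_def)
  then show "arr_inv C f \<in> Arr C" "Dom C (arr_inv C f) = Cod C f" "Cod C (arr_inv C f) = Dom C f"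
    "arr_inv C f \<cdot> f = Idn C (Dom C f)" "f \<cdot> arr_inv C f = Idn C (Cod C f)"
    using g by (auto simp: Hom_def)
qed
declare inv_arr [simp]

lemma inv_comp_extend [simp]:
  assumes "is_iso C f"
  shows "\<lbrakk>h \<in> Arr C; Cod C h = Dom C f\<rbrakk> \<Longrightarrow> arr_inv C f \<cdot> f \<cdot> h = h"
    "\<lbrakk>h \<in> Arr C; Cod C h = Cod C f\<rbrakk> \<Longrightarrow> f \<cdot> arr_inv C f \<cdot> h = h"
  using assms comp_extend[of "arr_inv C f" f _ h] comp_extend[of f "arr_inv C f" _ h] by simp_all

lemma isoI:
  assumes "f \<in> Arr C" "g \<in> Arr C" "Dom C g = Cod C f" "Cod C g = Dom C f"
    "g \<cdot> f = Idn C (Dom C f)" "f \<cdot> g = Idn C (Cod C f)"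
  shows "is_iso C f"
  unfolding is_iso_def using assms by (intro conjI bexI[of _ g]) (simp_all add: Hom_def)

lemma iso_id [simp]: "A \<in> Ob C \<Longrightarrow> is_iso C (Idn C A)"
  by (rule isoI[of _ "Idn C A"]) auto

lemma iso_inv [simp]: "is_iso C f \<Longrightarrow> is_iso C (arr_inv C f)"
  by (rule isoI[of _ f]) simp_all

lemma iso_comp [simp]: "\<lbrakk>is_iso C f; is_iso C g; Dom C g = Cod C f\<rbrakk> \<Longrightarrow> is_iso C (g \<cdot> f)"
  by (rule isoI[of _ "arr_inv C f \<cdot> arr_inv C g"]) simp_all

lemma cancel_left:
  assumes "is_iso C f" "g \<in> Arr C" "h \<in> Arr C" "Cod C g = Dom C f" "Cod C h = Dom C f" "f \<cdot> g = f \<cdot> h"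
  shows "g = h"
proof -
  have "g = arr_inv C f \<cdot> f \<cdot> g" using assms(1-5) by simp
  also have "\<dots> = h" unfolding assms(6) using assms(1-5) by simp
  finally show ?thesis .
qed

lemma cancel_right:
  assumes "is_iso C f" "g \<in> Arr C" "h \<in> Arr C" "Dom C g = Cod C f" "Dom C h = Cod C f" "g \<cdot> f = h \<cdot> f"
  shows "g = h"
proof -
  have "g = (g \<cdot> f) \<cdot> arr_inv C f" using assms(1-5) by simp
  also have "\<dots> = h" unfolding assms(6) using assms(1-5) by simp
  finally show ?thesis .
qed

lemma inv_natural:
  assumes "is_iso C a" "is_iso C b" "f \<in> Arr C" "g \<in> Arr C" "Dom C f = Dom C a" "Cod C f = Dom C b"
    "Dom C g = Cod C a" "Cod C g = Cod C b" "b \<cdot> f = g \<cdot> a"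
  shows "arr_inv C b \<cdot> g = f \<cdot> arr_inv C a"
proof -
  have "arr_inv C b \<cdot> g = arr_inv C b \<cdot> (g \<cdot> a) \<cdot> arr_inv C a" using assms(1-8) by simp
  also have "\<dots> = f \<cdot> arr_inv C a" unfolding assms(9)[symmetric] using assms(1-8) by simp
  finally show ?thesis .
qed

end

section \<open>Symmetric monoidal categories\<close>

locale sym_mon_ops = cat C for C :: "('o, 'a) category" +
  fixes S :: "('o, 'a) sym_mon"
begin

abbreviation tens (infixr "\<otimes>" 70) where "A \<otimes> B \<equiv> omap (tensor S) (A, B)"
abbreviation tensa (infixr "\<star>" 70) where "f \<star> g \<equiv> amap (tensor S) (f, g)"
abbreviation "I \<equiv> unit_ob S"
abbreviation "\<alpha> A B D \<equiv> assoc S (A, B, D)"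
abbreviation "\<tau> A B \<equiv> symm S (A, B)"
abbreviation "one A \<equiv> Idn C A"
abbreviation "inva f \<equiv> arr_inv C f"

end

locale sym_mon_cat = sym_mon_ops C S for C :: "('o, 'a) category" and S +
  assumes sym_mon: "is_sym_mon C S"
begin

lemmas sym_mon' = sym_mon[unfolded is_sym_mon_def Let_def]

lemma tensor_functor: "tensor S \<in> functors (prod_cat C C) C"
  using sym_mon' by (elim conjE)

lemma unit_ob [simp]: "I \<in> Ob C" using sym_mon' by (elim conjE)

lemma structure_natural_iso:
  "is_natural_iso (prod_cat C (prod_cat C C)) C
     \<lparr>omap = (\<lambda>(A, B, D). A \<otimes> B \<otimes> D), amap = (\<lambda>(f, g, h). f \<star> g \<star> h)\<rparr>
     \<lparr>omap = (\<lambda>(A, B, D). (A \<otimes> B) \<otimes> D), amap = (\<lambda>(f, g, h). (f \<star> g) \<star> h)\<rparr> (assoc S)"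
  "is_natural_iso C C \<lparr>omap = (\<lambda>A. I \<otimes> A), amap = (\<lambda>f. one I \<star> f)\<rparr> \<lparr>omap = (\<lambda>A. A), amap = (\<lambda>f. f)\<rparr> (lunit S)"
  "is_natural_iso C C \<lparr>omap = (\<lambda>A. A \<otimes> I), amap = (\<lambda>f. f \<star> one I)\<rparr> \<lparr>omap = (\<lambda>A. A), amap = (\<lambda>f. f)\<rparr> (runit S)"
  "is_natural_iso (prod_cat C C) C \<lparr>omap = (\<lambda>(A, B). B \<otimes> A), amap = (\<lambda>(f, g). g \<star> f)\<rparr> (tensor S) (symm S)"
  using sym_mon' by - ((elim conjE, assumption)+)

lemma coherence_axioms:
  "\<forall>A\<in>Ob C. \<forall>B\<in>Ob C. \<forall>D\<in>Ob C. \<forall>E\<in>Ob C.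
     \<alpha> (A \<otimes> B) D E \<cdot> \<alpha> A B (D \<otimes> E) = (\<alpha> A B D \<star> one E) \<cdot> \<alpha> A (B \<otimes> D) E \<cdot> (one A \<star> \<alpha> B D E)"
  "\<forall>A\<in>Ob C. \<forall>B\<in>Ob C. (runit S A \<star> one B) \<cdot> \<alpha> A I B = one A \<star> lunit S B"
  "\<forall>A\<in>Ob C. \<forall>B\<in>Ob C. \<tau> A B \<cdot> \<tau> B A = one (A \<otimes> B)"
  "\<forall>A\<in>Ob C. lunit S A \<cdot> \<tau> I A = runit S A"
  "\<forall>A\<in>Ob C. \<forall>B\<in>Ob C. \<forall>D\<in>Ob C.
     (\<tau> A D \<star> one B) \<cdot> \<alpha> D A B \<cdot> \<tau> D (A \<otimes> B) \<cdot> \<alpha> A B D = \<alpha> A D B \<cdot> (one A \<star> \<tau> D B)"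
  using sym_mon' by - ((elim conjE, assumption)+)

lemmas pentagon = coherence_axioms(1)[rule_format]
  and triangle = coherence_axioms(2)[rule_format]
  and symmetry [simp] = coherence_axioms(3)[rule_format]
  and symm_unit = coherence_axioms(4)[rule_format]
  and hexagon = coherence_axioms(5)[rule_format]

lemma tens_ob [simp]: "A \<in> Ob C \<Longrightarrow> B \<in> Ob C \<Longrightarrow> A \<otimes> B \<in> Ob C"
  using tensor_functor by (auto simp: functors_def is_functor_def prod_cat_def)

lemma tens_arr [simp]:
  assumes "f \<in> Arr C" "g \<in> Arr C"
  shows "f \<star> g \<in> Arr C" "Dom C (f \<star> g) = Dom C f \<otimes> Dom C g" "Cod C (f \<star> g) = Cod C f \<otimes> Cod C g"
  using tensor_functor assms by (auto simp: functors_def is_functor_def prod_cat_def Hom_def)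

lemma tens_id [simp]: "A \<in> Ob C \<Longrightarrow> B \<in> Ob C \<Longrightarrow> one A \<star> one B = one (A \<otimes> B)"
  using tensor_functor by (auto simp: functors_def is_functor_def prod_cat_def)

lemma interchange [simp]:
  assumes "f \<in> Arr C" "g \<in> Arr C" "f' \<in> Arr C" "g' \<in> Arr C" "Dom C g = Cod C f" "Dom C g' = Cod C f'"
  shows "(g \<star> g') \<cdot> (f \<star> f') = (g \<cdot> f) \<star> (g' \<cdot> f')"
proof -
  have "is_functor (prod_cat C C) C (tensor S)" using tensor_functor by (simp add: functors_def)
  then have *: "\<forall>p\<in>Arr C \<times> Arr C. \<forall>q\<in>Arr C \<times> Arr C. Dom (prod_cat C C) q = Cod (prod_cat C C) p \<longrightarrow>
      amap (tensor S) (Cmp (prod_cat C C) q p) = amap (tensor S) q \<cdot> amap (tensor S) p"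
    by (simp add: is_functor_def prod_cat_def)
  show ?thesis using *[rule_format, of "(f, f')" "(g, g')"] assms by (simp add: prod_cat_def)
qed

lemma interchange_extend [simp]:
  assumes "f \<in> Arr C" "g \<in> Arr C" "f' \<in> Arr C" "g' \<in> Arr C" "Dom C g = Cod C f" "Dom C g' = Cod C f'"
    "h \<in> Arr C" "Cod C h = Dom C f \<otimes> Dom C f'"
  shows "(g \<star> g') \<cdot> (f \<star> f') \<cdot> h = ((g \<cdot> f) \<star> (g' \<cdot> f')) \<cdot> h"
  using assms by (intro comp_extend) simp_all

lemma iso_tens [simp]: "is_iso C f \<Longrightarrow> is_iso C g \<Longrightarrow> is_iso C (f \<star> g)"
  by (rule isoI[of _ "inva f \<star> inva g"]) simp_all

lemma assoc_iso [simp]: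
  assumes "A \<in> Ob C" "B \<in> Ob C" "D \<in> Ob C"
  shows "is_iso C (\<alpha> A B D)" "\<alpha> A B D \<in> Arr C" "Dom C (\<alpha> A B D) = A \<otimes> (B \<otimes> D)" "Cod C (\<alpha> A B D) = (A \<otimes> B) \<otimes> D"
  using structure_natural_iso(1) assms by (auto simp: is_natural_iso_def is_natural_def prod_cat_def Hom_def)

lemma assoc_natural:
  assumes "f \<in> Arr C" "g \<in> Arr C" "h \<in> Arr C"
  shows "\<alpha> (Cod C f) (Cod C g) (Cod C h) \<cdot> (f \<star> (g \<star> h)) = ((f \<star> g) \<star> h) \<cdot> \<alpha> (Dom C f) (Dom C g) (Dom C h)"
  using structure_natural_iso(1) assms by (auto simp: is_natural_iso_def is_natural_def prod_cat_def)

lemma lunit_iso [simp]: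
  assumes "A \<in> Ob C"
  shows "is_iso C (lunit S A)" "lunit S A \<in> Arr C" "Dom C (lunit S A) = I \<otimes> A" "Cod C (lunit S A) = A"
  using structure_natural_iso(2) assms by (auto simp: is_natural_iso_def is_natural_def Hom_def)

lemma lunit_natural: "f \<in> Arr C \<Longrightarrow> lunit S (Cod C f) \<cdot> (one I \<star> f) = f \<cdot> lunit S (Dom C f)"
  using structure_natural_iso(2) by (auto simp: is_natural_iso_def is_natural_def)

lemma runit_iso [simp]:
  assumes "A \<in> Ob C"
  shows "is_iso C (runit S A)" "runit S A \<in> Arr C" "Dom C (runit S A) = A \<otimes> I" "Cod C (runit S A) = A"
  using structure_natural_iso(3) assms by (auto simp: is_natural_iso_def is_natural_def Hom_def)

lemma runit_natural: "f \<in> Arr C \<Longrightarrow> runit S (Cod C f) \<cdot> (f \<star> one I) = f \<cdot> runit S (Dom C f)"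
  using structure_natural_iso(3) by (auto simp: is_natural_iso_def is_natural_def)

lemma symm_iso [simp]:
  assumes "A \<in> Ob C" "B \<in> Ob C"
  shows "is_iso C (\<tau> A B)" "\<tau> A B \<in> Arr C" "Dom C (\<tau> A B) = B \<otimes> A" "Cod C (\<tau> A B) = A \<otimes> B"
  using structure_natural_iso(4) assms by (auto simp: is_natural_iso_def is_natural_def prod_cat_def Hom_def)

lemma symm_natural:
  assumes "f \<in> Arr C" "g \<in> Arr C"
  shows "\<tau> (Cod C f) (Cod C g) \<cdot> (g \<star> f) = (f \<star> g) \<cdot> \<tau> (Dom C f) (Dom C g)"
  using structure_natural_iso(4) assms by (auto simp: is_natural_iso_def is_natural_def prod_cat_def)

lemma symmetry_extend [simp]:
  "\<lbrakk>A \<in> Ob C; B \<in> Ob C; h \<in> Arr C; Cod C h = A \<otimes> B\<rbrakk> \<Longrightarrow> \<tau> A B \<cdot> \<tau> B A \<cdot> h = h"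
  using comp_extend[OF symmetry[of A B], of h] by simp

lemma inv_assoc_natural:
  assumes "f \<in> Arr C" "g \<in> Arr C" "h \<in> Arr C"
  shows "inva (\<alpha> (Cod C f) (Cod C g) (Cod C h)) \<cdot> ((f \<star> g) \<star> h) = (f \<star> (g \<star> h)) \<cdot> inva (\<alpha> (Dom C f) (Dom C g) (Dom C h))"
  by (rule inv_natural) (simp_all add: assms assoc_natural)

end

context sym_mon_cat begin

text \<open>Kelly's argument: by naturality of \<open>\<lambda>\<close> the functor \<open>I \<otimes> _\<close> is faithful, and after applying it
  both sides agree by the pentagon for \<open>I, I, A, B\<close> and the triangle.\<close>

lemma lunit_tens:
  assumes A: "A \<in> Ob C" and B: "B \<in> Ob C"
  shows "(lunit S A \<star> one B) \<cdot> \<alpha> I A B = lunit S (A \<otimes> B)" (is "?l = ?r")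
proof -
  note [simp] = A B
  have "\<alpha> I A B \<cdot> (one I \<star> ?l) = \<alpha> I A B \<cdot> (one I \<star> (lunit S A \<star> one B)) \<cdot> (one I \<star> \<alpha> I A B)"
    by simp
  also have "\<dots> = ((one I \<star> lunit S A) \<star> one B) \<cdot> \<alpha> I (I \<otimes> A) B \<cdot> (one I \<star> \<alpha> I A B)"
    using comp_extend2[OF assoc_natural[of "one I" "lunit S A" "one B"], of "one I \<star> \<alpha> I A B"] by simp
  also have "\<dots> = ((runit S I \<star> one A) \<star> one B) \<cdot> (\<alpha> I I A \<star> one B) \<cdot> \<alpha> I (I \<otimes> A) B \<cdot> (one I \<star> \<alpha> I A B)"
    using triangle[of I A] by simp
  also have "\<dots> = ((runit S I \<star> one A) \<star> one B) \<cdot> \<alpha> (I \<otimes> I) A B \<cdot> \<alpha> I I (A \<otimes> B)"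
    by (simp add: pentagon)
  also have "\<dots> = \<alpha> I A B \<cdot> (runit S I \<star> one (A \<otimes> B)) \<cdot> \<alpha> I I (A \<otimes> B)"
    using comp_extend2[OF assoc_natural[of "runit S I" "one A" "one B"], of "\<alpha> I I (A \<otimes> B)"] by simp
  also have "\<dots> = \<alpha> I A B \<cdot> (one I \<star> ?r)" by (simp add: triangle)
  finally have "one I \<star> ?l = one I \<star> ?r" by (rule cancel_left[rotated -1]) simp_all
  then have "?l \<cdot> lunit S (I \<otimes> A \<otimes> B) = ?r \<cdot> lunit S (I \<otimes> A \<otimes> B)"
    using lunit_natural[of ?l] lunit_natural[of ?r] by simp
  then show ?thesis by (rule cancel_right[rotated -1]) simp_all
qed

text \<open>The symmetry in the form in which it acts on right-bracketed words: it exchanges the first two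
  letters.\<close>

definition swap :: "'o \<Rightarrow> 'o \<Rightarrow> 'o \<Rightarrow> 'a" where
  "swap A B W = inva (\<alpha> B A W) \<cdot> (\<tau> B A \<star> one W) \<cdot> \<alpha> A B W"

lemma swap_arr [simp]:
  assumes "A \<in> Ob C" "B \<in> Ob C" "W \<in> Ob C"
  shows "swap A B W \<in> Arr C" "Dom C (swap A B W) = A \<otimes> B \<otimes> W" "Cod C (swap A B W) = B \<otimes> A \<otimes> W"
  using assms by (simp_all add: swap_def)

lemma swap_natural:
  assumes [simp]: "f \<in> Arr C" "g \<in> Arr C" "h \<in> Arr C"
  shows "swap (Cod C f) (Cod C g) (Cod C h) \<cdot> (f \<star> g \<star> h) = (g \<star> f \<star> h) \<cdot> swap (Dom C f) (Dom C g) (Dom C h)"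
proof -
  have "swap (Cod C f) (Cod C g) (Cod C h) \<cdot> (f \<star> g \<star> h)
      = inva (\<alpha> (Cod C g) (Cod C f) (Cod C h)) \<cdot> (\<tau> (Cod C g) (Cod C f) \<star> one (Cod C h)) \<cdot> ((f \<star> g) \<star> h) \<cdot> \<alpha> (Dom C f) (Dom C g) (Dom C h)"
    by (simp add: swap_def assoc_natural)
  also have "\<dots> = inva (\<alpha> (Cod C g) (Cod C f) (Cod C h)) \<cdot> ((g \<star> f) \<star> h) \<cdot> (\<tau> (Dom C g) (Dom C f) \<star> one (Dom C h)) \<cdot> \<alpha> (Dom C f) (Dom C g) (Dom C h)"
    using symm_natural[of g f] by simp
  also have "\<dots> = (g \<star> f \<star> h) \<cdot> swap (Dom C f) (Dom C g) (Dom C h)"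
    using comp_extend2[OF inv_assoc_natural[of g f h], of "(\<tau> (Dom C g) (Dom C f) \<star> one (Dom C h)) \<cdot> \<alpha> (Dom C f) (Dom C g) (Dom C h)"]
    by (simp add: swap_def)
  finally show ?thesis .
qed

lemma swap_swap [simp]:
  assumes "A \<in> Ob C" "B \<in> Ob C" "W \<in> Ob C"
  shows "swap B A W \<cdot> swap A B W = one (A \<otimes> B \<otimes> W)"
  using assms by (simp add: swap_def)

lemma swap_unit:
  assumes [simp]: "B \<in> Ob C" "W \<in> Ob C"
  shows "(one B \<star> lunit S W) \<cdot> swap I B W = lunit S (B \<otimes> W)"
proof -
  have "(one B \<star> lunit S W) \<cdot> swap I B W
      = (runit S B \<star> one W) \<cdot> \<alpha> B I W \<cdot> swap I B W"
    using comp_extend[OF triangle[of B W], of "swap I B W"] by simp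
  also have "\<dots> = ((runit S B \<cdot> \<tau> B I) \<star> one W) \<cdot> \<alpha> I B W" by (simp add: swap_def)
  also have "runit S B \<cdot> \<tau> B I = lunit S B"
    using symm_unit[of B, symmetric] by simp
  finally show ?thesis by (simp add: lunit_tens)
qed

text \<open>The hexagon in terms of \<open>swap\<close>. Both sides are compared after composition with the two equal sides of
  a pentagon, which clears the inverse associativities.\<close>

lemma swap_tens:
  assumes [simp]: "A \<in> Ob C" "B \<in> Ob C" "D \<in> Ob C" "W \<in> Ob C"
  shows "swap A D (B \<otimes> W) \<cdot> (one A \<star> swap B D W) = (one D \<star> inva (\<alpha> A B W)) \<cdot> swap (A \<otimes> B) D W \<cdot> \<alpha> A B (D \<otimes> W)"
    (is "?l = ?r")
proof -
  let ?K = "\<alpha> (D \<otimes> A) B W \<cdot> \<alpha> D A (B \<otimes> W)"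
  let ?s = "\<tau> D A" and ?s' = "\<tau> D B"
  have hex: "\<alpha> D A B \<cdot> \<tau> D (A \<otimes> B) \<cdot> \<alpha> A B D = (?s \<star> one B) \<cdot> \<alpha> A D B \<cdot> (one A \<star> ?s')"
    using arg_cong[OF hexagon[of A B D], of "Cmp C (?s \<star> one B)"] by simp
  have "?K \<cdot> ?l = \<alpha> (D \<otimes> A) B W \<cdot> (?s \<star> one (B \<otimes> W)) \<cdot> \<alpha> A D (B \<otimes> W) \<cdot> (one A \<star> (inva (\<alpha> D B W) \<cdot> (?s' \<star> one W) \<cdot> \<alpha> B D W))"
    by (simp add: swap_def)
  also have "\<dots> = ((?s \<star> one B) \<star> one W) \<cdot> \<alpha> (A \<otimes> D) B W \<cdot> \<alpha> A D (B \<otimes> W) \<cdot> (one A \<star> (inva (\<alpha> D B W) \<cdot> (?s' \<star> one W) \<cdot> \<alpha> B D W))"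
    using comp_extend2[OF assoc_natural[of ?s "one B" "one W"], of "\<alpha> A D (B \<otimes> W) \<cdot> (one A \<star> (inva (\<alpha> D B W) \<cdot> (?s' \<star> one W) \<cdot> \<alpha> B D W))"]
    by simp
  also have "\<dots> = ((?s \<star> one B) \<star> one W) \<cdot> (\<alpha> A D B \<star> one W) \<cdot> \<alpha> A (D \<otimes> B) W \<cdot> (one A \<star> ((?s' \<star> one W) \<cdot> \<alpha> B D W))"
    using comp_extend[OF pentagon[of A D B W], of "one A \<star> (inva (\<alpha> D B W) \<cdot> (?s' \<star> one W) \<cdot> \<alpha> B D W)"]
    by simp
  also have "\<dots> = ((?s \<star> one B) \<star> one W) \<cdot> (\<alpha> A D B \<star> one W) \<cdot> ((one A \<star> ?s') \<star> one W) \<cdot> \<alpha> A (B \<otimes> D) W \<cdot> (one A \<star> \<alpha> B D W)"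
    using comp_extend2[OF assoc_natural[of "one A" ?s' "one W"], of "one A \<star> \<alpha> B D W"] by simp
  also have "\<dots> = ((\<alpha> D A B \<cdot> \<tau> D (A \<otimes> B) \<cdot> \<alpha> A B D) \<star> one W) \<cdot> \<alpha> A (B \<otimes> D) W \<cdot> (one A \<star> \<alpha> B D W)"
    unfolding hex by simp
  also have "\<dots> = (\<alpha> D A B \<star> one W) \<cdot> (\<tau> D (A \<otimes> B) \<star> one W) \<cdot> \<alpha> (A \<otimes> B) D W \<cdot> \<alpha> A B (D \<otimes> W)"
    by (simp add: pentagon)
  also have "\<dots> = (\<alpha> D A B \<star> one W) \<cdot> \<alpha> D (A \<otimes> B) W \<cdot> (one D \<star> \<alpha> A B W) \<cdot> ?r"
    by (simp add: swap_def)
  also have "\<dots> = ?K \<cdot> ?r" by (simp add: pentagon)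
  finally show ?thesis by (rule cancel_left[rotated -1]) simp_all
qed

text \<open>The Yang-Baxter equation: by \<open>swap_tens\<close> it expresses that exchanging \<open>A \<otimes> B\<close> with \<open>D\<close> is natural
  in the argument \<open>A \<otimes> B\<close>, applied to the symmetry of \<open>A\<close> and \<open>B\<close>.\<close>

lemma swap_braid:
  assumes [simp]: "A \<in> Ob C" "B \<in> Ob C" "D \<in> Ob C" "W \<in> Ob C"
  shows "(one D \<star> swap A B W) \<cdot> swap A D (B \<otimes> W) \<cdot> (one A \<star> swap B D W)
    = swap B D (A \<otimes> W) \<cdot> (one B \<star> swap A D W) \<cdot> swap A B (D \<otimes> W)"
proof -
  have "(one D \<star> swap A B W) \<cdot> swap A D (B \<otimes> W) \<cdot> (one A \<star> swap B D W)
      = (one D \<star> inva (\<alpha> B A W)) \<cdot> (one D \<star> \<tau> B A \<star> one W) \<cdot> swap (A \<otimes> B) D W \<cdot> \<alpha> A B (D \<otimes> W)"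
    by (simp add: swap_tens swap_def[of A B])
  also have "\<dots> = (one D \<star> inva (\<alpha> B A W)) \<cdot> swap (B \<otimes> A) D W \<cdot> (\<tau> B A \<star> one (D \<otimes> W)) \<cdot> \<alpha> A B (D \<otimes> W)"
    using comp_extend2[OF swap_natural[of "\<tau> B A" "one D" "one W"], of "\<alpha> A B (D \<otimes> W)"] by simp
  also have "\<dots> = (one D \<star> inva (\<alpha> B A W)) \<cdot> swap (B \<otimes> A) D W \<cdot> \<alpha> B A (D \<otimes> W) \<cdot> swap A B (D \<otimes> W)"
    by (simp add: swap_def[of A B])
  also have "\<dots> = ((one D \<star> inva (\<alpha> B A W)) \<cdot> swap (B \<otimes> A) D W \<cdot> \<alpha> B A (D \<otimes> W)) \<cdot> swap A B (D \<otimes> W)"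
    by simp
  also have "\<dots> = swap B D (A \<otimes> W) \<cdot> (one B \<star> swap A D W) \<cdot> swap A B (D \<otimes> W)"
    unfolding swap_tens[of B A D W, simplified, symmetric] by simp
  finally show ?thesis .
qed

end

section \<open>Trees of tensor products\<close>

type_synonym cmon_tree = "(cmon_gen, nat) optree"

abbreviation unit_tree :: cmon_tree ("\<epsilon>") where "\<epsilon> \<equiv> Node Gen_e []"
abbreviation tens_tree :: "cmon_tree \<Rightarrow> cmon_tree \<Rightarrow> cmon_tree" (infixr "\<odot>" 70) where
  "t \<odot> u \<equiv> Node Gen_dot [t, u]"
abbreviation wf_tree :: "cmon_tree \<Rightarrow> bool" where "wf_tree \<equiv> well_formed cmon_signature"

lemma cmon_signature_simps [simp]: "Gen_e \<in> cmon_signature 0" "Gen_dot \<in> cmon_signature 2"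
    "Gen_dot \<in> cmon_signature (Suc (Suc 0))"
  by (simp_all add: cmon_signature_def)

lemma wf_tree_induct [consumes 1, case_names Leaf unit tens]:
  assumes "wf_tree t" "\<And>v. P (Leaf v)" "P \<epsilon>"
    "\<And>t u. \<lbrakk>wf_tree t; wf_tree u; P t; P u\<rbrakk> \<Longrightarrow> P (t \<odot> u)"
  shows "P t"
  using assms(1)
proof (induction t)
  case (Node g ts)
  show ?case
  proof (cases g)
    case Gen_e
    then show ?thesis using Node.prems assms(3) by (simp add: cmon_signature_def split: if_splits)
  next
    case Gen_dot
    then have "length ts = 2" using Node.prems by (simp add: cmon_signature_def split: if_splits)
    then obtain t u where "ts = [t, u]" by (auto simp: numeral_2_eq_2 length_Suc_conv)
    then show ?thesis using Node assms(4) Gen_dot by auto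
  qed
qed (rule assms)

text \<open>The operations have arity 2 and 0 only, so the default branch is met, for well-formed
  trees, only at the nullary operation. One function serves objects and arrows alike.\<close>

primrec tree_fold :: "('c \<Rightarrow> 'c \<Rightarrow> 'c) \<Rightarrow> 'c \<Rightarrow> (nat \<Rightarrow> 'c) \<Rightarrow> cmon_tree \<Rightarrow> 'c" where
  "tree_fold m e x (Leaf v) = x v"
| "tree_fold m e x (Node g ts) = (case map (tree_fold m e x) ts of [a, b] \<Rightarrow> m a b | _ \<Rightarrow> e)"

lemma tree_fold_graft:
  "wf_tree t \<Longrightarrow> tree_fold m e x (graft s t) = tree_fold m e (\<lambda>v. tree_fold m e x (s v)) t"
  by (induction t rule: wf_tree_induct) simp_all

lemma tree_fold_relabel: "wf_tree t \<Longrightarrow> tree_fold m e x (relabel h t) = tree_fold m e (\<lambda>v. x (h v)) t"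
  by (simp add: relabel_def tree_fold_graft)

lemma tree_fold_cong:
  "wf_tree t \<Longrightarrow> (\<And>v. v \<in> set (leaves t) \<Longrightarrow> x v = y v) \<Longrightarrow> tree_fold m e x t = tree_fold m e y t"
  by (induction t rule: wf_tree_induct) simp_all

primrec word_tree :: "nat list \<Rightarrow> cmon_tree" where
  "word_tree [] = \<epsilon>"
| "word_tree (a # w) = Leaf a \<odot> word_tree w"

lemma wf_word_tree [simp]: "wf_tree (word_tree w)" by (induction w) simp_all

abbreviation sort_into :: "cmon_tree \<Rightarrow> nat list \<Rightarrow> nat list" where
  "sort_into t w \<equiv> foldr insort (leaves t) w"

lemma foldr_insort_mset:
  assumes "mset xs = mset ys"
  shows "foldr insort xs (w::nat list) = foldr insort ys w"
proof -
  have "fold insort (rev xs) = fold insort (rev ys)"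
    by (rule fold_multiset_equiv) (use assms in \<open>auto simp: fun_eq_iff insort_left_comm\<close>)
  then show ?thesis by (simp add: foldr_conv_fold)
qed

lemma foldr_insort_insort: "foldr insort xs (insort a w) = insort a (foldr insort xs (w::nat list))"
  by (induction xs) (simp_all add: insort_left_comm)

lemma foldr_insort_commute:
  "foldr insort xs (foldr insort ys w) = foldr insort ys (foldr insort xs (w::nat list))"
  by (induction xs) (simp_all add: foldr_insort_insort)

section \<open>Coherence arrows\<close>

context sym_mon_ops begin

abbreviation ev :: "(nat \<Rightarrow> 'o) \<Rightarrow> cmon_tree \<Rightarrow> 'o" where "ev \<equiv> tree_fold (\<otimes>) I"
abbreviation eva :: "(nat \<Rightarrow> 'a) \<Rightarrow> cmon_tree \<Rightarrow> 'a" where "eva \<equiv> tree_fold (\<star>) (one I)"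

text \<open>The arrows are families over all assignments \<open>x\<close>, so that naturality and substitution can be
  proved by induction on the derivation. Inverses are taken of arbitrary derived families rather than
  of the structure isomorphisms alone; the definition makes sense before these are known to be invertible.\<close>

inductive coh :: "cmon_tree \<Rightarrow> cmon_tree \<Rightarrow> ((nat \<Rightarrow> 'o) \<Rightarrow> 'a) \<Rightarrow> bool" where
  coh_id: "wf_tree t \<Longrightarrow> coh t t (\<lambda>x. one (ev x t))"
| coh_comp: "coh t u a \<Longrightarrow> coh u v b \<Longrightarrow> coh t v (\<lambda>x. b x \<cdot> a x)"
| coh_inv: "coh t u a \<Longrightarrow> coh u t (\<lambda>x. inva (a x))"
| coh_tens: "coh t u a \<Longrightarrow> coh t' u' a' \<Longrightarrow> coh (t \<odot> t') (u \<odot> u') (\<lambda>x. a x \<star> a' x)"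
| coh_assoc: "\<lbrakk>wf_tree t; wf_tree u; wf_tree v\<rbrakk> \<Longrightarrow>
    coh (t \<odot> u \<odot> v) ((t \<odot> u) \<odot> v) (\<lambda>x. \<alpha> (ev x t) (ev x u) (ev x v))"
| coh_lunit: "wf_tree t \<Longrightarrow> coh (\<epsilon> \<odot> t) t (\<lambda>x. lunit S (ev x t))"
| coh_runit: "wf_tree t \<Longrightarrow> coh (t \<odot> \<epsilon>) t (\<lambda>x. runit S (ev x t))"
| coh_symm: "\<lbrakk>wf_tree t; wf_tree u\<rbrakk> \<Longrightarrow> coh (u \<odot> t) (t \<odot> u) (\<lambda>x. \<tau> (ev x t) (ev x u))"

lemma coh_wf: "coh t u a \<Longrightarrow> wf_tree t \<and> wf_tree u"
  by (induction rule: coh.induct) simp_all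

lemma coh_mset_leaves: "coh t u a \<Longrightarrow> mset (leaves t) = mset (leaves u)"
  by (induction rule: coh.induct) simp_all

lemma coh_leaves:
  assumes "coh t u a"
  shows "set (leaves u) = set (leaves t)" "distinct (leaves u) \<longleftrightarrow> distinct (leaves t)"
  using coh_mset_leaves[OF assms] mset_eq_setD mset_eq_imp_distinct_iff by metis+

lemma coh_graft:
  "coh t u a \<Longrightarrow> (\<And>v. v \<in> set (leaves t) \<Longrightarrow> wf_tree (s v)) \<Longrightarrow>
     coh (graft s t) (graft s u) (\<lambda>x. a (\<lambda>v. ev x (s v)))"
proof (induction rule: coh.induct)
  case (coh_comp t u a v b)
  then show ?case using coh.coh_comp coh_leaves(1)[OF coh_comp(1)] by simp
next
  case (coh_inv t u a)
  then show ?case using coh.coh_inv coh_leaves(1)[OF coh_inv(1)] by simp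
next
  case (coh_tens t u a t' u' a')
  then show ?case using coh.coh_tens by simp
next
  case (coh_id t)
  then show ?case using coh.coh_id[of "graft s t"] by (simp add: tree_fold_graft wf_graft)
next
  case (coh_assoc t u v)
  then show ?case using coh.coh_assoc[of "graft s t" "graft s u" "graft s v"] by (simp add: tree_fold_graft wf_graft)
next
  case (coh_lunit t)
  then show ?case using coh.coh_lunit[of "graft s t"] by (simp add: tree_fold_graft wf_graft)
next
  case (coh_runit t)
  then show ?case using coh.coh_runit[of "graft s t"] by (simp add: tree_fold_graft wf_graft)
next
  case (coh_symm t u)
  then show ?case using coh.coh_symm[of "graft s t" "graft s u"] by (simp add: tree_fold_graft wf_graft)
qed

text \<open>The operadic composite in \<open>Q\<close> of arrows is a composite of an instance of \<open>coh_graft\<close>, which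
  changes the outer tree, and one of \<open>coh_subst\<close>, which changes the trees grafted onto it.\<close>

lemma coh_subst:
  "wf_tree t \<Longrightarrow> (\<And>v. v \<in> set (leaves t) \<Longrightarrow> coh (s v) (s' v) (\<theta> v)) \<Longrightarrow>
     coh (graft s t) (graft s' t) (\<lambda>x. eva (\<lambda>v. \<theta> v x) t)"
proof (induction t rule: wf_tree_induct)
  case unit
  then show ?case using coh_id[of \<epsilon>] by simp
next
  case (tens t u)
  then show ?case using coh_tens by simp
qed simp

end

context sym_mon_cat begin

lemma ev_ob [simp]: "wf_tree t \<Longrightarrow> (\<And>v. v \<in> set (leaves t) \<Longrightarrow> x v \<in> Ob C) \<Longrightarrow> ev x t \<in> Ob C"
  by (induction t rule: wf_tree_induct) simp_all

lemma eva_arr [simp]: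
  assumes "wf_tree t" "\<And>v. v \<in> set (leaves t) \<Longrightarrow> f v \<in> Arr C"
  shows "eva f t \<in> Arr C" "Dom C (eva f t) = ev (\<lambda>v. Dom C (f v)) t" "Cod C (eva f t) = ev (\<lambda>v. Cod C (f v)) t"
  using assms by (induction t rule: wf_tree_induct) simp_all

lemma eva_id: "wf_tree t \<Longrightarrow> (\<And>v. v \<in> set (leaves t) \<Longrightarrow> x v \<in> Ob C) \<Longrightarrow> eva (\<lambda>v. one (x v)) t = one (ev x t)"
  by (induction t rule: wf_tree_induct) simp_all

lemma eva_comp:
  "wf_tree t \<Longrightarrow> (\<And>v. v \<in> set (leaves t) \<Longrightarrow> f v \<in> Arr C \<and> g v \<in> Arr C \<and> Dom C (g v) = Cod C (f v)) \<Longrightarrow>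
   eva (\<lambda>v. g v \<cdot> f v) t = eva g t \<cdot> eva f t"
proof (induction t rule: wf_tree_induct)
  case (tens t u)
  have "ev (\<lambda>v. Dom C (g v)) s = ev (\<lambda>v. Cod C (f v)) s" if "s = t \<or> s = u" for s
    using that tens by (auto intro!: tree_fold_cong)
  then show ?case using tens by simp
qed simp_all

lemma coh_arr:
  "coh t u a \<Longrightarrow> (\<And>v. v \<in> set (leaves t) \<Longrightarrow> x v \<in> Ob C) \<Longrightarrow>
     is_iso C (a x) \<and> Dom C (a x) = ev x t \<and> Cod C (a x) = ev x u"
proof (induction rule: coh.induct)
  case (coh_comp t u a v b)
  then show ?case using coh_leaves(1)[OF coh_comp(1)] by simp
next
  case (coh_inv t u a)
  then show ?case using coh_leaves(1)[OF coh_inv(1)] by simp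
qed simp_all

lemma coh_natural:
  "coh t u a \<Longrightarrow> (\<And>v. v \<in> set (leaves t) \<Longrightarrow> f v \<in> Arr C) \<Longrightarrow>
     a (\<lambda>v. Cod C (f v)) \<cdot> eva f t = eva f u \<cdot> a (\<lambda>v. Dom C (f v))"
proof (induction rule: coh.induct)
  case (coh_id t)
  then show ?case by simp
next
  case (coh_comp t u a v b)
  let ?x = "\<lambda>v. Dom C (f v)" and ?y = "\<lambda>v. Cod C (f v)"
  have l: "set (leaves u) = set (leaves t)" using coh_leaves(1)[OF coh_comp.hyps(1)] .
  note [simp] = conjunct1[OF coh_wf[OF coh_comp.hyps(1)]] conjunct1[OF coh_wf[OF coh_comp.hyps(2)]] conjunct2[OF coh_wf[OF coh_comp.hyps(2)]]
  note [simp] = coh_arr[OF coh_comp.hyps(1), of ?x] coh_arr[OF coh_comp.hyps(1), of ?y]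
  note [simp] = coh_comp.prems
  have l': "set (leaves v) = set (leaves t)" using coh_leaves(1)[OF coh_comp.hyps(2)] l by simp
  have [simp]: "f w \<in> Arr C" if "w \<in> set (leaves s)" "s = u \<or> s = v" for w s
    using that l l' coh_comp.prems by auto
  have [simp]: "eva f s \<in> Arr C" "Dom C (eva f s) = ev ?x s" "Cod C (eva f s) = ev ?y s" if "s = u \<or> s = v" for s
    using that by auto
  have [simp]: "is_iso C (b z)" "Dom C (b z) = ev z u" "Cod C (b z) = ev z v" if "z = ?x \<or> z = ?y" for z
    using coh_arr[OF coh_comp.hyps(2), of z] that l coh_comp.prems by auto
  have "(b ?y \<cdot> a ?y) \<cdot> eva f t = b ?y \<cdot> a ?y \<cdot> eva f t" by (simp add: l l')
  also have "\<dots> = b ?y \<cdot> eva f u \<cdot> a ?x" using coh_comp.IH(1) by simp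
  also have "\<dots> = eva f v \<cdot> b ?x \<cdot> a ?x"
    by (rule comp_extend2[OF coh_comp.IH(2)]) simp_all
  finally show ?case .
next
  case (coh_inv t u a)
  let ?x = "\<lambda>v. Dom C (f v)" and ?y = "\<lambda>v. Cod C (f v)"
  have l: "set (leaves u) = set (leaves t)" using coh_leaves(1)[OF coh_inv(1)] .
  note [simp] = conjunct1[OF coh_wf[OF coh_inv(1)]] conjunct2[OF coh_wf[OF coh_inv(1)]]
  note [simp] = coh_arr[OF coh_inv(1), of ?x] coh_arr[OF coh_inv(1), of ?y]
  have f: "f w \<in> Arr C" if "w \<in> set (leaves t)" for w using that l coh_inv.prems by simp
  show ?case by (rule inv_natural) (simp_all add: f coh_inv.IH coh_inv.prems)
next
  case (coh_tens t u a t' u' a')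
  let ?x = "\<lambda>v. Dom C (f v)" and ?y = "\<lambda>v. Cod C (f v)"
  note [simp] = conjunct1[OF coh_wf[OF coh_tens.hyps(1)]] conjunct2[OF coh_wf[OF coh_tens.hyps(1)]]
    conjunct1[OF coh_wf[OF coh_tens.hyps(2)]] conjunct2[OF coh_wf[OF coh_tens.hyps(2)]]
  note l = coh_leaves(1)[OF coh_tens.hyps(1)] coh_leaves(1)[OF coh_tens.hyps(2)]
  have [simp]: "f w \<in> Arr C" if "w \<in> set (leaves s)" "s \<in> {t, u, t', u'}" for w s
    using that l coh_tens.prems by auto
  have [simp]: "is_iso C (a z)" "Dom C (a z) = ev z t" "Cod C (a z) = ev z u"
    "is_iso C (a' z)" "Dom C (a' z) = ev z t'" "Cod C (a' z) = ev z u'" if "z = ?x \<or> z = ?y" for z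
    using coh_arr[OF coh_tens.hyps(1), of z] coh_arr[OF coh_tens.hyps(2), of z] that by auto
  have "a ?y \<cdot> eva f t = eva f u \<cdot> a ?x" "a' ?y \<cdot> eva f t' = eva f u' \<cdot> a' ?x"
    using coh_tens.IH by auto
  then show ?case by simp
next
  case (coh_assoc t u v)
  then show ?case using assoc_natural[of "eva f t" "eva f u" "eva f v"] by simp
next
  case (coh_lunit t)
  then show ?case using lunit_natural[of "eva f t"] by simp
next
  case (coh_runit t)
  then show ?case using runit_natural[of "eva f t"] by simp
next
  case (coh_symm t u)
  then show ?case using symm_natural[of "eva f t" "eva f u"] by simp
qed

end

context sym_mon_ops begin

lemma coh_cong: "coh t u a \<Longrightarrow> (\<And>v. v \<in> set (leaves t) \<Longrightarrow> x v = y v) \<Longrightarrow> a x = a y"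
proof (induction rule: coh.induct)
  case (coh_comp t u a v b)
  then show ?case using coh_leaves(1)[OF coh_comp.hyps(1)] by simp
next
  case (coh_inv t u a)
  then show ?case using coh_leaves(1)[OF coh_inv.hyps(1)] by simp
next
  case (coh_id t)
  then show ?case using tree_fold_cong[of t x y] by metis
next
  case (coh_assoc t u v)
  then show ?case using tree_fold_cong[of t x y] tree_fold_cong[of u x y] tree_fold_cong[of v x y] by auto
next
  case (coh_lunit t)
  then show ?case using tree_fold_cong[of t x y] by auto
next
  case (coh_runit t)
  then show ?case using tree_fold_cong[of t x y] by auto
next
  case (coh_symm t u)
  then show ?case using tree_fold_cong[of t x y] tree_fold_cong[of u x y] by auto
qed auto

end

section \<open>The coherence theorem\<close>

context sym_mon_cat begin

abbreviation word :: "(nat \<Rightarrow> 'o) \<Rightarrow> nat list \<Rightarrow> 'o" where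
  "word x w \<equiv> ev x (word_tree w)"

text \<open>\<open>ins\<close> and \<open>norm\<close> follow the recursion of \<^const>\<open>insort\<close>: a letter moves to the right, one \<open>swap\<close> at a
  time, until it meets a letter that is not smaller.\<close>

primrec ins :: "(nat \<Rightarrow> 'o) \<Rightarrow> nat \<Rightarrow> nat list \<Rightarrow> 'a" where
  "ins x a [] = one (x a \<otimes> I)"
| "ins x a (c # w) = (if a \<le> c then one (x a \<otimes> x c \<otimes> word x w)
     else (one (x c) \<star> ins x a w) \<cdot> swap (x a) (x c) (word x w))"

primrec norm :: "(nat \<Rightarrow> 'o) \<Rightarrow> cmon_tree \<Rightarrow> nat list \<Rightarrow> 'a" where
  "norm x (Leaf a) = ins x a"
| "norm x (Node g ts) = (\<lambda>w. case map (norm x) ts of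
     [m, n] \<Rightarrow> m (sort_into (ts ! 1) w) \<cdot> (one (ev x (ts ! 0)) \<star> n w)
                 \<cdot> inva (\<alpha> (ev x (ts ! 0)) (ev x (ts ! 1)) (word x w))
   | _ \<Rightarrow> lunit S (word x w))"

context
  fixes x :: "nat \<Rightarrow> 'o"
  assumes x [simp]: "\<And>v. x v \<in> Ob C"
begin

lemma ins_arr [simp]: "ins x a w \<in> Arr C" "Dom C (ins x a w) = x a \<otimes> word x w"
    "Cod C (ins x a w) = word x (insort a w)"
  by (induction w) simp_all

lemma norm_arr:
  "wf_tree t \<Longrightarrow> norm x t w \<in> Arr C \<and> Dom C (norm x t w) = ev x t \<otimes> word x w \<and>
     Cod C (norm x t w) = word x (sort_into t w)"
  by (induction t arbitrary: w rule: wf_tree_induct) simp_all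
declare norm_arr [THEN conjunct1, simp] norm_arr [THEN conjunct2, THEN conjunct1, simp]
  norm_arr [THEN conjunct2, THEN conjunct2, simp]

text \<open>This is what the compatibility of \<open>norm\<close> with \<open>\<tau>\<close> amounts to once the associativities in the definition
  of \<open>norm\<close> are cancelled.\<close>

definition commute :: "cmon_tree \<Rightarrow> cmon_tree \<Rightarrow> nat list \<Rightarrow> bool" where
  "commute t u w \<longleftrightarrow>
     norm x t (sort_into u w) \<cdot> (one (ev x t) \<star> norm x u w)
     = norm x u (sort_into t w) \<cdot> (one (ev x u) \<star> norm x t w) \<cdot> swap (ev x t) (ev x u) (word x w)"

lemma commute_sym: "wf_tree t \<Longrightarrow> wf_tree u \<Longrightarrow> commute t u w \<Longrightarrow> commute u t w"
  unfolding commute_def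
proof -
  assume [simp]: "wf_tree t" "wf_tree u" and
    c: "norm x t (sort_into u w) \<cdot> (one (ev x t) \<star> norm x u w)
     = norm x u (sort_into t w) \<cdot> (one (ev x u) \<star> norm x t w) \<cdot> swap (ev x t) (ev x u) (word x w)"
  have "norm x t (sort_into u w) \<cdot> (one (ev x t) \<star> norm x u w) \<cdot> swap (ev x u) (ev x t) (word x w)
      = (norm x t (sort_into u w) \<cdot> (one (ev x t) \<star> norm x u w)) \<cdot> swap (ev x u) (ev x t) (word x w)"
    by simp
  also have "\<dots> = norm x u (sort_into t w) \<cdot> (one (ev x u) \<star> norm x t w)"
    unfolding c by simp
  finally show "norm x u (sort_into t w) \<cdot> (one (ev x u) \<star> norm x t w) =
     norm x t (sort_into u w) \<cdot> (one (ev x t) \<star> norm x u w) \<cdot> swap (ev x u) (ev x t) (word x w)" ..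
qed

text \<open>If both letters pass the first letter \<open>c\<close> of the word, then the three exchanges
  involved are rearranged by \<open>swap_braid\<close>.\<close>

lemma ins_ins:
  assumes "a < b"
  shows "ins x a (insort b w) \<cdot> (one (x a) \<star> ins x b w)
    = ins x b (insort a w) \<cdot> (one (x b) \<star> ins x a w) \<cdot> swap (x a) (x b) (word x w)"
proof (induction w)
  case Nil
  show ?case using assms by simp
next
  case (Cons c w)
  show ?case
  proof (cases "a \<le> c")
    case True
    then show ?thesis using assms by simp
  next
    case False
    then have lt: "\<not> a \<le> c" "\<not> b \<le> c" using assms by auto
    let ?W = "word x w"
    let ?s = "\<lambda>p q. swap (x p) (x q)"
    have "ins x a (insort b (c # w)) \<cdot> (one (x a) \<star> ins x b (c # w))
        = (one (x c) \<star> ins x a (insort b w)) \<cdot> ?s a c (word x (insort b w)) \<cdot> (one (x a) \<star> one (x c) \<star> ins x b w)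
            \<cdot> (one (x a) \<star> ?s b c ?W)"
      using lt by simp
    also have "\<dots> = (one (x c) \<star> ins x a (insort b w)) \<cdot> (one (x c) \<star> one (x a) \<star> ins x b w) \<cdot> ?s a c (x b \<otimes> ?W)
            \<cdot> (one (x a) \<star> ?s b c ?W)"
      using comp_extend2[OF swap_natural[of "one (x a)" "one (x c)" "ins x b w"], of "one (x a) \<star> ?s b c ?W"] by simp
    also have "\<dots> = (one (x c) \<star> (ins x b (insort a w) \<cdot> (one (x b) \<star> ins x a w))) \<cdot> (one (x c) \<star> ?s a b ?W) \<cdot> ?s a c (x b \<otimes> ?W)
            \<cdot> (one (x a) \<star> ?s b c ?W)"
      by (simp add: Cons.IH)
    also have "\<dots> = (one (x c) \<star> (ins x b (insort a w) \<cdot> (one (x b) \<star> ins x a w))) \<cdot> ?s b c (x a \<otimes> ?W)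
            \<cdot> (one (x b) \<star> ?s a c ?W) \<cdot> ?s a b (x c \<otimes> ?W)"
      by (simp add: swap_braid)
    also have "\<dots> = (one (x c) \<star> ins x b (insort a w)) \<cdot> (one (x c) \<star> one (x b) \<star> ins x a w) \<cdot> ?s b c (x a \<otimes> ?W)
            \<cdot> (one (x b) \<star> ?s a c ?W) \<cdot> ?s a b (x c \<otimes> ?W)"
      by simp
    also have "\<dots> = (one (x c) \<star> ins x b (insort a w)) \<cdot> ?s b c (word x (insort a w)) \<cdot> (one (x b) \<star> one (x c) \<star> ins x a w)
            \<cdot> (one (x b) \<star> ?s a c ?W) \<cdot> ?s a b (x c \<otimes> ?W)"
      using comp_extend2[OF swap_natural[of "one (x b)" "one (x c)" "ins x a w"], of "(one (x b) \<star> ?s a c ?W) \<cdot> ?s a b (x c \<otimes> ?W)"] by simp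
    also have "\<dots> = ins x b (insort a (c # w)) \<cdot> (one (x b) \<star> ins x a (c # w)) \<cdot> ?s a b (word x (c # w))"
      using lt by simp
    finally show ?thesis .
  qed
qed

lemma commute_unit: "wf_tree u \<Longrightarrow> commute \<epsilon> u w"
proof -
  assume [simp]: "wf_tree u"
  have "norm x u w \<cdot> (one (ev x u) \<star> lunit S (word x w)) \<cdot> swap I (ev x u) (word x w)
      = norm x u w \<cdot> lunit S (ev x u \<otimes> word x w)" by (simp add: swap_unit)
  also have "\<dots> = lunit S (word x (sort_into u w)) \<cdot> (one I \<star> norm x u w)"
    using lunit_natural[of "norm x u w"] by simp
  finally show ?thesis by (simp add: commute_def)
qed

lemma commute_tens:
  assumes [simp]: "wf_tree t" "wf_tree t'" "wf_tree u" and t: "\<And>w. commute t u w" and t': "commute t' u w"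
  shows "commute (t \<odot> t') u w"
proof -
  let ?A = "ev x t" and ?B = "ev x t'" and ?D = "ev x u" and ?W = "word x w"
  let ?W' = "word x (sort_into t' w)"
  have [simp]: "foldr insort (leaves t) (sort_into u v) = sort_into u (sort_into t v)"
    "foldr insort (leaves t') (sort_into u v) = sort_into u (sort_into t' v)" for v
    by (rule foldr_insort_commute)+
  have "norm x (t \<odot> t') (sort_into u w) \<cdot> (one (?A \<otimes> ?B) \<star> norm x u w)
      = norm x t (sort_into u (sort_into t' w)) \<cdot> (one ?A \<star> norm x t' (sort_into u w)) \<cdot>
          (inva (\<alpha> ?A ?B (word x (sort_into u w))) \<cdot> (one (?A \<otimes> ?B) \<star> norm x u w))"
    by simp
  also have "inva (\<alpha> ?A ?B (word x (sort_into u w))) \<cdot> (one (?A \<otimes> ?B) \<star> norm x u w)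
      = (one ?A \<star> one ?B \<star> norm x u w) \<cdot> inva (\<alpha> ?A ?B (?D \<otimes> ?W))"
    using inv_assoc_natural[of "one ?A" "one ?B" "norm x u w"] by simp
  also have "norm x t (sort_into u (sort_into t' w)) \<cdot> (one ?A \<star> norm x t' (sort_into u w)) \<cdot> \<dots>
      = norm x t (sort_into u (sort_into t' w)) \<cdot>
          (one ?A \<star> (norm x t' (sort_into u w) \<cdot> (one ?B \<star> norm x u w))) \<cdot> inva (\<alpha> ?A ?B (?D \<otimes> ?W))"
    by simp
  also have "\<dots> = (norm x t (sort_into u (sort_into t' w)) \<cdot> (one ?A \<star> norm x u (sort_into t' w))) \<cdot>
      (one ?A \<star> ((one ?D \<star> norm x t' w) \<cdot> swap ?B ?D ?W)) \<cdot> inva (\<alpha> ?A ?B (?D \<otimes> ?W))"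
    unfolding t'[unfolded commute_def] by simp
  also have "\<dots> = norm x u (sort_into t (sort_into t' w)) \<cdot> (one ?D \<star> norm x t (sort_into t' w)) \<cdot>
      swap ?A ?D ?W' \<cdot> (one ?A \<star> one ?D \<star> norm x t' w) \<cdot> (one ?A \<star> swap ?B ?D ?W) \<cdot> inva (\<alpha> ?A ?B (?D \<otimes> ?W))"
    unfolding t[unfolded commute_def] by simp
  also have "swap ?A ?D ?W' \<cdot> (one ?A \<star> one ?D \<star> norm x t' w) \<cdot> (one ?A \<star> swap ?B ?D ?W) \<cdot> inva (\<alpha> ?A ?B (?D \<otimes> ?W))
     = (one ?D \<star> one ?A \<star> norm x t' w) \<cdot> (swap ?A ?D (?B \<otimes> ?W) \<cdot> (one ?A \<star> swap ?B ?D ?W)) \<cdot> inva (\<alpha> ?A ?B (?D \<otimes> ?W))"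
    using comp_extend2[OF swap_natural[of "one ?A" "one ?D" "norm x t' w"],
        of "(one ?A \<star> swap ?B ?D ?W) \<cdot> inva (\<alpha> ?A ?B (?D \<otimes> ?W))"] by simp
  also have "\<dots> = (one ?D \<star> one ?A \<star> norm x t' w) \<cdot> (one ?D \<star> inva (\<alpha> ?A ?B ?W)) \<cdot> swap (?A \<otimes> ?B) ?D ?W"
    by (subst swap_tens) simp_all
  also have "norm x u (sort_into t (sort_into t' w)) \<cdot> (one ?D \<star> norm x t (sort_into t' w)) \<cdot> \<dots>
    = norm x u (sort_into (t \<odot> t') w) \<cdot> (one ?D \<star> norm x (t \<odot> t') w) \<cdot> swap (?A \<otimes> ?B) ?D ?W"
    by simp
  finally show ?thesis by (simp add: commute_def)
qed

text \<open>Since \<open>commute\<close> is symmetric, decomposing the left tree suffices to decompose both. Only for two leaves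
  does disjointness matter: the letters have to be different for \<open>ins_ins\<close>.\<close>

lemma commute_disjoint:
  "wf_tree t \<Longrightarrow> wf_tree u \<Longrightarrow> set (leaves t) \<inter> set (leaves u) = {} \<Longrightarrow> commute t u w"
proof (induction t arbitrary: u w rule: wf_tree_induct)
  case (Leaf a u w)
  have "commute u (Leaf a) w" using Leaf
  proof (induction u arbitrary: w rule: wf_tree_induct)
    case (Leaf b w)
    have lt: "commute (Leaf p) (Leaf q) v" if "p < q" for p q v
      using ins_ins[OF that] by (simp add: commute_def)
    show ?case
      using Leaf lt[of a b w] lt[of b a w] commute_sym[of "Leaf a" "Leaf b" w] by (cases "a < b") auto
  next
    case (tens t t')
    then show ?case by (intro commute_tens) auto
  qed (simp add: commute_unit)
  then show ?case by (rule commute_sym[rotated 2]) (use Leaf in simp_all)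
next
  case (tens t t')
  show ?case by (intro commute_tens tens.IH) (use tens.hyps tens.prems in \<open>auto simp: Int_Un_distrib2\<close>)
qed (rule commute_unit)

text \<open>The key to uniqueness: as \<open>norm x u []\<close> turns out to be invertible, the equation leaves only one
  possibility for \<open>a x\<close>. Distinct leaves are essential, since \<open>\<tau>\<close> on two equal factors is not the identity in general.\<close>

lemma coh_norm:
  "coh t u a \<Longrightarrow> distinct (leaves t) \<Longrightarrow> norm x u w \<cdot> (a x \<star> one (word x w)) = norm x t w"
proof (induction arbitrary: w rule: coh.induct)
  case (coh_id t)
  then show ?case by simp
next
  case (coh_comp t u a v b)
  have [simp]: "wf_tree t" "wf_tree u" "wf_tree v" using coh_wf coh_comp.hyps by blast+
  have [simp]: "is_iso C (a x)" "Dom C (a x) = ev x t" "Cod C (a x) = ev x u"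
    "is_iso C (b x)" "Dom C (b x) = ev x u" "Cod C (b x) = ev x v"
    using coh_arr[OF coh_comp.hyps(1), of x] coh_arr[OF coh_comp.hyps(2), of x] by simp_all
  have d: "distinct (leaves u)" using coh_leaves(2)[OF coh_comp.hyps(1)] coh_comp.prems by simp
  have "norm x v w \<cdot> ((b x \<cdot> a x) \<star> one (word x w)) = (norm x v w \<cdot> (b x \<star> one (word x w))) \<cdot> (a x \<star> one (word x w))"
    by simp
  also have "\<dots> = norm x t w" unfolding coh_comp.IH(2)[OF d] by (rule coh_comp.IH(1)[OF coh_comp.prems])
  finally show ?case .
next
  case (coh_inv t u a)
  have [simp]: "wf_tree t" "wf_tree u" using coh_wf coh_inv.hyps by blast+
  have [simp]: "is_iso C (a x)" "Dom C (a x) = ev x t" "Cod C (a x) = ev x u"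
    using coh_arr[OF coh_inv.hyps(1), of x] by simp_all
  have d: "distinct (leaves t)" using coh_leaves(2)[OF coh_inv.hyps(1)] coh_inv.prems by simp
  show ?case unfolding coh_inv.IH[OF d, symmetric] by simp
next
  case (coh_tens t u a t' u' a')
  have [simp]: "wf_tree t" "wf_tree u" "wf_tree t'" "wf_tree u'" using coh_wf coh_tens.hyps by blast+
  have [simp]: "is_iso C (a x)" "Dom C (a x) = ev x t" "Cod C (a x) = ev x u"
    "is_iso C (a' x)" "Dom C (a' x) = ev x t'" "Cod C (a' x) = ev x u'"
    using coh_arr[OF coh_tens.hyps(1), of x] coh_arr[OF coh_tens.hyps(2), of x] by simp_all
  have d: "distinct (leaves t)" "distinct (leaves t')" using coh_tens.prems by simp_all
  have nf: "sort_into u' w = sort_into t' w"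
    by (rule foldr_insort_mset[OF coh_mset_leaves[OF coh_tens.hyps(2), symmetric]])
  let ?v = "sort_into t' w"
  have "norm x (u \<odot> u') w \<cdot> ((a x \<star> a' x) \<star> one (word x w))
      = norm x u ?v \<cdot> (one (ev x u) \<star> norm x u' w) \<cdot> inva (\<alpha> (ev x u) (ev x u') (word x w)) \<cdot> ((a x \<star> a' x) \<star> one (word x w))"
    by (simp add: nf)
  also have "\<dots> = norm x u ?v \<cdot> (one (ev x u) \<star> norm x u' w) \<cdot> (a x \<star> a' x \<star> one (word x w)) \<cdot> inva (\<alpha> (ev x t) (ev x t') (word x w))"
    using inv_assoc_natural[of "a x" "a' x" "one (word x w)"] by simp
  also have "\<dots> = norm x u ?v \<cdot> (a x \<star> (norm x u' w \<cdot> (a' x \<star> one (word x w)))) \<cdot> inva (\<alpha> (ev x t) (ev x t') (word x w))"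
    by simp
  also have "\<dots> = (norm x u ?v \<cdot> (a x \<star> one (word x ?v))) \<cdot> (one (ev x t) \<star> norm x t' w) \<cdot> inva (\<alpha> (ev x t) (ev x t') (word x w))"
    unfolding coh_tens.IH(2)[OF d(2)] by simp
  also have "\<dots> = norm x (t \<odot> t') w"
    unfolding coh_tens.IH(1)[OF d(1)] by simp
  finally show ?case .
next
  case (coh_assoc t u v)
  let ?A = "ev x t" and ?B = "ev x u" and ?D = "ev x v" and ?W = "word x w"
  note [simp] = coh_assoc.hyps
  have p: "inva (\<alpha> ?A ?B (?D \<otimes> ?W)) \<cdot> inva (\<alpha> (?A \<otimes> ?B) ?D ?W) \<cdot> (\<alpha> ?A ?B ?D \<star> one ?W)
      = (one ?A \<star> inva (\<alpha> ?B ?D ?W)) \<cdot> inva (\<alpha> ?A (?B \<otimes> ?D) ?W)" (is "?l = ?r")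
  proof (rule cancel_right)
    show "?l \<cdot> \<alpha> ?A (?B \<otimes> ?D) ?W \<cdot> (one ?A \<star> \<alpha> ?B ?D ?W) = ?r \<cdot> \<alpha> ?A (?B \<otimes> ?D) ?W \<cdot> (one ?A \<star> \<alpha> ?B ?D ?W)"
      by (simp flip: pentagon)
  qed simp_all
  let ?v = "sort_into v w"
  have "norm x ((t \<odot> u) \<odot> v) w \<cdot> (\<alpha> ?A ?B ?D \<star> one ?W)
      = norm x t (sort_into u ?v) \<cdot> (one ?A \<star> norm x u ?v) \<cdot> inva (\<alpha> ?A ?B (word x ?v)) \<cdot> (one (?A \<otimes> ?B) \<star> norm x v w)
          \<cdot> inva (\<alpha> (?A \<otimes> ?B) ?D ?W) \<cdot> (\<alpha> ?A ?B ?D \<star> one ?W)"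
    by simp
  also have "\<dots> = norm x t (sort_into u ?v) \<cdot> (one ?A \<star> norm x u ?v) \<cdot> (one ?A \<star> one ?B \<star> norm x v w) \<cdot> inva (\<alpha> ?A ?B (?D \<otimes> ?W))
          \<cdot> inva (\<alpha> (?A \<otimes> ?B) ?D ?W) \<cdot> (\<alpha> ?A ?B ?D \<star> one ?W)"
    using comp_extend2[OF inv_assoc_natural[of "one ?A" "one ?B" "norm x v w"],
        of "inva (\<alpha> (?A \<otimes> ?B) ?D ?W) \<cdot> (\<alpha> ?A ?B ?D \<star> one ?W)"] by simp
  also have "\<dots> = norm x (t \<odot> u \<odot> v) w" unfolding p by simp
  finally show ?case .
next
  case (coh_lunit t)
  have "lunit S (ev x t) \<star> one (word x w) = lunit S (ev x t \<otimes> word x w) \<cdot> inva (\<alpha> I (ev x t) (word x w))"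
    using coh_lunit lunit_tens[of "ev x t" "word x w", symmetric] by simp
  then show ?case using coh_lunit lunit_natural[of "norm x t w"]
    comp_extend2[OF lunit_natural[of "norm x t w"], of "inva (\<alpha> I (ev x t) (word x w))"] by simp
next
  case (coh_runit t)
  have "runit S (ev x t) \<star> one (word x w) = (one (ev x t) \<star> lunit S (word x w)) \<cdot> inva (\<alpha> (ev x t) I (word x w))"
    using coh_runit triangle[of "ev x t" "word x w", symmetric] by simp
  then show ?case using coh_runit by simp
next
  case (coh_symm t u)
  let ?A = "ev x t" and ?B = "ev x u" and ?W = "word x w"
  note [simp] = coh_symm.hyps
  have [simp]: "sort_into u (sort_into t w) = sort_into t (sort_into u w)" by (rule foldr_insort_commute)
  have c: "commute u t w" by (rule commute_disjoint) (use coh_symm.prems in auto)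
  have "norm x (u \<odot> t) w = (norm x u (sort_into t w) \<cdot> (one ?B \<star> norm x t w)) \<cdot> inva (\<alpha> ?B ?A ?W)" by simp
  also have "\<dots> = norm x t (sort_into u w) \<cdot> (one ?A \<star> norm x u w) \<cdot> swap ?B ?A ?W \<cdot> inva (\<alpha> ?B ?A ?W)"
    unfolding c[unfolded commute_def] by simp
  also have "\<dots> = norm x (t \<odot> u) w \<cdot> (\<tau> ?A ?B \<star> one ?W)"
    by (simp add: swap_def)
  finally show ?case ..
qed

end

lemma coh_swap:
  assumes "wf_tree t" "wf_tree u" "wf_tree v"
  shows "coh (t \<odot> u \<odot> v) (u \<odot> t \<odot> v) (\<lambda>x. swap (ev x t) (ev x u) (ev x v))"
  unfolding swap_def
  by (rule coh_comp[OF coh_comp[OF coh_assoc coh_tens[OF coh_symm coh_id]] coh_inv[OF coh_assoc]]) (fact assms)+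

lemma coh_ins: "coh (Leaf a \<odot> word_tree w) (word_tree (insort a w)) (\<lambda>x. ins x a w)"
proof (induction w)
  case Nil
  show ?case using coh_id[of "Leaf a \<odot> \<epsilon>"] by simp
next
  case (Cons c w)
  show ?case
  proof (cases "a \<le> c")
    case True
    then show ?thesis using coh_id[of "Leaf a \<odot> Leaf c \<odot> word_tree w"] by simp
  next
    case False
    then show ?thesis
      using coh_comp[OF coh_swap[of "Leaf a" "Leaf c" "word_tree w"] coh_tens[OF coh_id[of "Leaf c"] Cons.IH]] by simp
  qed
qed

text \<open>The normalization is itself a coherence arrow. This makes it invertible and connects every tree
  with a sorted word.\<close>

lemma coh_norm_tree:
  "wf_tree t \<Longrightarrow> coh (t \<odot> word_tree w) (word_tree (sort_into t w)) (\<lambda>x. norm x t w)"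
proof (induction t arbitrary: w rule: wf_tree_induct)
  case (Leaf a w)
  show ?case using coh_ins by simp
next
  case (unit w)
  show ?case using coh_lunit[of "word_tree w"] by simp
next
  case (tens t u w)
  then show ?case
    using coh_comp[OF coh_comp[OF coh_inv[OF coh_assoc[of t u "word_tree w"]] coh_tens[OF coh_id tens.IH(2)]] tens.IH(1)]
    by simp
qed

theorem coh_exists:
  assumes "wf_tree t" "wf_tree u" "distinct (leaves t)" "distinct (leaves u)" "set (leaves t) = set (leaves u)"
  shows "\<exists>a. coh t u a"
proof -
  have to_sorted: "\<exists>a. coh s (word_tree (sort_into s [])) a" if "wf_tree s" for s
    using coh_comp[OF coh_inv[OF coh_runit[OF that]] coh_norm_tree[OF that, of "[]", simplified word_tree.simps]] by blast
  have "sort_into t [] = sort_into u []"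
    by (rule foldr_insort_mset) (use assms set_eq_iff_mset_eq_distinct in blast)
  then show ?thesis using to_sorted[of t] to_sorted[of u] assms coh_comp coh_inv by metis
qed

lemma coh_unique_total:
  assumes a: "coh t u a" and b: "coh t u b" and d: "distinct (leaves t)" and x: "\<And>v. x v \<in> Ob C"
  shows "a x = b x"
proof -
  have [simp]: "wf_tree t" "wf_tree u" using coh_wf[OF a] by simp_all
  have n: "is_iso C (norm x u [])" using coh_arr[OF coh_norm_tree[of u "[]"], of x] x by simp
  have [simp]: "a x \<in> Arr C" "Dom C (a x) = ev x t" "Cod C (a x) = ev x u"
    "b x \<in> Arr C" "Dom C (b x) = ev x t" "Cod C (b x) = ev x u"
    using coh_arr[OF a, of x] coh_arr[OF b, of x] x by simp_all
  have "norm x u [] \<cdot> (a x \<star> one I) = norm x u [] \<cdot> (b x \<star> one I)"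
    using coh_norm[OF x a d, where w = "[]"] coh_norm[OF x b d, where w = "[]"] by simp
  then have "a x \<star> one I = b x \<star> one I"
    by (rule cancel_left[OF n, rotated -1]) (use norm_arr[of x u "[]"] x in simp_all)
  then have "a x \<cdot> runit S (ev x t) = b x \<cdot> runit S (ev x t)"
    using runit_natural[of "a x"] runit_natural[of "b x"] by simp
  then show ?thesis by (rule cancel_right[rotated -1]) (simp_all add: x)
qed

text \<open>Outside of the leaves an assignment may be arbitrary; it is replaced by \<open>I\<close> there in order to apply
  the total version.\<close>

theorem coh_unique:
  assumes a: "coh t u a" and b: "coh t u b" and d: "distinct (leaves t)"
    and x: "\<And>v. v \<in> set (leaves t) \<Longrightarrow> x v \<in> Ob C"
  shows "a x = b x"
proof -
  let ?y = "\<lambda>v. if v \<in> set (leaves t) then x v else I"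
  have "a x = a ?y" "b x = b ?y" by (rule coh_cong[OF a] coh_cong[OF b]; simp)+
  then show ?thesis using coh_unique_total[OF a b d, of ?y] x by simp
qed

end

section \<open>Algebras on trees\<close>

abbreviation free_cmon :: "cmon_tree operad" where "free_cmon \<equiv> free_operad cmon_signature"
abbreviation trees :: "nat \<Rightarrow> cmon_tree set" where "trees \<equiv> ops free_cmon"

interpretation free_cmon: symmetric_operad free_cmon by (rule free_symmetric_operad)

lemma power_cat_Ob: "xs \<in> Ob (power_cat C n) \<longleftrightarrow> length xs = n \<and> (\<forall>i<n. xs ! i \<in> Ob C)"
  and power_cat_Arr: "fs \<in> Arr (power_cat C n) \<longleftrightarrow> length fs = n \<and> (\<forall>i<n. fs ! i \<in> Arr C)"
  by (auto simp: power_cat_def list_prod_cat_def in_list_prod_iff)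

lemma power_cat_ops:
  "length fs = n \<Longrightarrow> Dom (power_cat C n) fs = map (Dom C) fs"
  "length fs = n \<Longrightarrow> Cod (power_cat C n) fs = map (Cod C) fs"
  "length xs = n \<Longrightarrow> Idn (power_cat C n) xs = map (Idn C) xs"
  "length gs = n \<Longrightarrow> length fs = n \<Longrightarrow> Cmp (power_cat C n) gs fs = map2 (Cmp C) gs fs"
  by (auto simp: power_cat_def list_prod_cat_def list_eq_iff_nth_eq)

lemma End_cat_at [simp]: "cat_at (End_operad C) n = functor_cat (power_cat C n) C"
  by (simp add: End_operad_def Let_def)

lemma functor_cat_Ob [simp]: "Ob (functor_cat A B) = functors A B"
  and functor_cat_Dom [simp]: "Dom (functor_cat A B) = nsrc"
  and functor_cat_Cod [simp]: "Cod (functor_cat A B) = ntgt"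
  by (simp_all add: functor_cat_def)

lemma functor_ob: "is_functor A B F \<Longrightarrow> x \<in> Ob A \<Longrightarrow> omap F x \<in> Ob B"
  and functor_hom: "is_functor A B F \<Longrightarrow> r \<in> Hom A x y \<Longrightarrow> amap F r \<in> Hom B (omap F x) (omap F y)"
  and functor_id: "is_functor A B F \<Longrightarrow> x \<in> Ob A \<Longrightarrow> amap F (Idn A x) = Idn B (omap F x)"
  and functor_comp: "is_functor A B F \<Longrightarrow> r \<in> Hom A x y \<Longrightarrow> s \<in> Hom A y z \<Longrightarrow>
    amap F (Cmp A s r) = Cmp B (amap F s) (amap F r)"
  by (auto simp: is_functor_def Hom_def)

text \<open>An algebra of the categorification in terms of trees: \<open>T n t\<close> is the functor assigned to \<open>t\<close>, and
  \<open>M n t u\<close> is the transformation assigned to the unique arrow from \<open>t\<close> to \<open>u\<close>.\<close>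

locale tree_algebra = cat C for C :: "('o, 'a) category" +
  fixes T :: "nat \<Rightarrow> cmon_tree \<Rightarrow> ('o list, 'a list, 'o, 'a) ftor"
    and M :: "nat \<Rightarrow> cmon_tree \<Rightarrow> cmon_tree \<Rightarrow> ('o list, 'a list, 'o, 'a) ntrans"
  assumes T_functor: "t \<in> trees n \<Longrightarrow> T n t \<in> functors (power_cat C n) C"
    and M_hom: "\<lbrakk>t \<in> trees n; u \<in> trees n\<rbrakk> \<Longrightarrow> M n t u \<in> Hom (functor_cat (power_cat C n) C) (T n t) (T n u)"
    and M_id: "t \<in> trees n \<Longrightarrow> M n t t = Idn (functor_cat (power_cat C n) C) (T n t)"
    and M_comp: "\<lbrakk>t \<in> trees n; u \<in> trees n; v \<in> trees n\<rbrakk> \<Longrightarrow>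
      Cmp (functor_cat (power_cat C n) C) (M n u v) (M n t u) = M n t v"
    and T_unit: "T 1 (Leaf 0) = cunit (End_operad C)"
    and T_act: "\<lbrakk>\<sigma> permutes {..<n}; t \<in> trees n\<rbrakk> \<Longrightarrow> T n (relabel \<sigma> t) = omap (cact (End_operad C) n \<sigma>) (T n t)"
    and M_act: "\<lbrakk>\<sigma> permutes {..<n}; t \<in> trees n; u \<in> trees n\<rbrakk> \<Longrightarrow>
      M n (relabel \<sigma> t) (relabel \<sigma> u) = amap (cact (End_operad C) n \<sigma>) (M n t u)"
    and T_graft: "\<lbrakk>t \<in> trees (length ks); ts \<in> list_prod (map trees ks)\<rbrakk> \<Longrightarrow>
      T (sum_list ks) (opcomp free_cmon ks t ts)
      = omap (ccomp (End_operad C) ks) (T (length ks) t, map2 T ks ts)"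
    and M_graft: "\<lbrakk>t \<in> trees (length ks); ts \<in> list_prod (map trees ks);
        u \<in> trees (length ks); us \<in> list_prod (map trees ks)\<rbrakk> \<Longrightarrow>
      M (sum_list ks) (opcomp free_cmon ks t ts) (opcomp free_cmon ks u us)
      = amap (ccomp (End_operad C) ks) (M (length ks) t u, map2 (\<lambda>k (t, u). M k t u) ks (zip ts us))"

locale cmon_categorification =
  fixes Q :: "('q, 'r) cat_operad"
    and \<phi> :: "nat \<Rightarrow> cmon_tree \<Rightarrow> unit"
    and b :: "nat \<Rightarrow> (cmon_tree, cmon_tree, 'q, 'r) ftor"
    and f :: "nat \<Rightarrow> ('q, 'r, unit, unit) ftor"
  assumes categorification: "is_categorification terminal_operad cmon_signature \<phi> Q b f"
begin

abbreviation b_ob :: "nat \<Rightarrow> cmon_tree \<Rightarrow> 'q" where "b_ob n \<equiv> omap (b n)"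

sublocale Q: symmetric_cat_operad Q
  using categorification by (simp add: is_categorification_def)

lemma b_bij: "bij_betw (b_ob n) (trees n) (Ob (cat_at Q n))"
  using categorification by (simp add: is_categorification_def)

lemma b_closed [simp]: "t \<in> trees n \<Longrightarrow> b_ob n t \<in> Ob (cat_at Q n)"
  using b_bij by (rule bij_betwE[rule_format])

lemma b_obj_morphism: "operad_morphism (obj_operad (discrete_operad free_cmon)) (obj_operad Q) b_ob"
  using categorification by (simp add: is_categorification_def cat_operad_morphism_def)

lemma b_unit: "b_ob 1 (Leaf 0) = cunit Q"
  using b_obj_morphism by (simp add: operad_morphism_def obj_operad_def discrete_operad_def free_opunit)

lemma b_act: "\<lbrakk>\<sigma> permutes {..<n}; t \<in> trees n\<rbrakk> \<Longrightarrow> b_ob n (relabel \<sigma> t) = omap (cact Q n \<sigma>) (b_ob n t)"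
  using b_obj_morphism
  by (simp add: operad_morphism_def obj_operad_def discrete_operad_def discrete_cat_def free_opact)

lemma b_graft: "\<lbrakk>t \<in> trees (length ks); ts \<in> list_prod (map trees ks)\<rbrakk> \<Longrightarrow>
    b_ob (sum_list ks) (opcomp free_cmon ks t ts) = omap (ccomp Q ks) (b_ob (length ks) t, map2 b_ob ks ts)"
  using b_obj_morphism
  by (simp add: operad_morphism_def obj_operad_def discrete_operad_def discrete_cat_def)

text \<open>\<open>f\<close> is full and faithful, and all hom-sets of the terminal operad are singletons.\<close>

lemma Hom_unique:
  assumes "p \<in> Ob (cat_at Q n)" "q \<in> Ob (cat_at Q n)"
  shows "\<exists>!r. r \<in> Hom (cat_at Q n) p q"
proof -
  have f: "full_and_faithful (cat_at Q n) (discrete_cat (ops terminal_operad n)) (f n)"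
    using categorification by (simp add: is_categorification_def)
  have "bij_betw (amap (f n)) (Hom (cat_at Q n) p q)
      (Hom (discrete_cat (ops terminal_operad n)) (omap (f n) p) (omap (f n) q))"
    using f assms by (simp add: full_and_faithful_def)
  moreover have "Hom (discrete_cat (ops terminal_operad n)) (omap (f n) p) (omap (f n) q) = {()}"
    by (auto simp: Hom_def discrete_cat_def terminal_operad_def)
  ultimately have "is_singleton (Hom (cat_at Q n) p q)"
    by (metis bij_betw_same_card is_singleton_altdef is_singletonI)
  then show ?thesis by (auto simp: is_singleton_def)
qed

definition arrow :: "nat \<Rightarrow> cmon_tree \<Rightarrow> cmon_tree \<Rightarrow> 'r" where
  "arrow n t u = (THE r. r \<in> Hom (cat_at Q n) (b_ob n t) (b_ob n u))"

lemma arrow_eqI: "\<lbrakk>t \<in> trees n; u \<in> trees n; r \<in> Hom (cat_at Q n) (b_ob n t) (b_ob n u)\<rbrakk> \<Longrightarrow> r = arrow n t u"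
  unfolding arrow_def by (rule the1_equality[OF Hom_unique[OF b_closed b_closed], symmetric])

lemma arrow_hom: "\<lbrakk>t \<in> trees n; u \<in> trees n\<rbrakk> \<Longrightarrow> arrow n t u \<in> Hom (cat_at Q n) (b_ob n t) (b_ob n u)"
  unfolding arrow_def by (rule theI'[OF Hom_unique[OF b_closed b_closed]])

lemma Hom_eq_arrow: "\<lbrakk>t \<in> trees n; u \<in> trees n\<rbrakk> \<Longrightarrow> Hom (cat_at Q n) (b_ob n t) (b_ob n u) = {arrow n t u}"
  using arrow_eqI arrow_hom by blast

lemma arrow_id: "t \<in> trees n \<Longrightarrow> Idn (cat_at Q n) (b_ob n t) = arrow n t t"
  using Q.cat[of n] by (intro arrow_eqI) (simp_all add: is_category_def)

lemma arrow_comp: "\<lbrakk>t \<in> trees n; u \<in> trees n; v \<in> trees n\<rbrakk> \<Longrightarrow>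
    Cmp (cat_at Q n) (arrow n u v) (arrow n t u) = arrow n t v"
  using Q.cat[of n] arrow_hom[of t n u] arrow_hom[of u n v]
  by (intro arrow_eqI) (auto simp: is_category_def Hom_def)

lemma arrow_act:
  assumes "\<sigma> permutes {..<n}" "t \<in> trees n" "u \<in> trees n"
  shows "amap (cact Q n \<sigma>) (arrow n t u) = arrow n (relabel \<sigma> t) (relabel \<sigma> u)"
proof (rule arrow_eqI)
  show "relabel \<sigma> t \<in> trees n" "relabel \<sigma> u \<in> trees n"
    using free_cmon.act_closed[OF assms(1)] assms by (simp_all add: free_opact)
  show "amap (cact Q n \<sigma>) (arrow n t u) \<in> Hom (cat_at Q n) (b_ob n (relabel \<sigma> t)) (b_ob n (relabel \<sigma> u))"
    using Q.act_functor[OF assms(1)] arrow_hom[OF assms(2,3)]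
    by (auto simp: b_act assms is_functor_def Hom_def)
qed

abbreviation arrows :: "nat list \<Rightarrow> cmon_tree list \<Rightarrow> cmon_tree list \<Rightarrow> 'r list" where
  "arrows ks ts us \<equiv> map2 (\<lambda>k (t, u). arrow k t u) ks (zip ts us)"

lemma arrows_closed:
  assumes "ts \<in> list_prod (map trees ks)" "us \<in> list_prod (map trees ks)"
  shows "arrows ks ts us \<in> list_prod (map (\<lambda>k. Arr (cat_at Q k)) ks)"
  using assms arrow_hom by (auto simp: in_list_prod_iff Hom_def)

lemma arrow_graft:
  assumes t: "t \<in> trees (length ks)" "ts \<in> list_prod (map trees ks)"
    and u: "u \<in> trees (length ks)" "us \<in> list_prod (map trees ks)"
  shows "amap (ccomp Q ks) (arrow (length ks) t u, arrows ks ts us)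
    = arrow (sum_list ks) (opcomp free_cmon ks t ts) (opcomp free_cmon ks u us)"
proof (rule arrow_eqI)
  let ?A = "prod_cat (cat_at Q (length ks)) (list_prod_cat (map (cat_at Q) ks))"
  have len: "length ts = length ks" "length us = length ks" using t u by (simp_all add: in_list_prod_iff)
  have h: "arrow (ks ! i) (ts ! i) (us ! i) \<in> Hom (cat_at Q (ks ! i)) (b_ob (ks ! i) (ts ! i)) (b_ob (ks ! i) (us ! i))"
    if "i < length ks" for i using t u that by (intro arrow_hom) (auto simp: in_list_prod_iff)
  have a: "(arrow (length ks) t u, arrows ks ts us) \<in> Arr ?A"
    using arrow_hom[OF t(1) u(1)] arrows_closed[OF t(2) u(2)]
    by (simp add: prod_cat_def list_prod_cat_def Hom_def o_def)
  have d: "Dom ?A (arrow (length ks) t u, arrows ks ts us) = (b_ob (length ks) t, map2 b_ob ks ts)"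
    "Cod ?A (arrow (length ks) t u, arrows ks ts us) = (b_ob (length ks) u, map2 b_ob ks us)"
    using arrow_hom[OF t(1) u(1)] h
    by (auto simp: prod_cat_def list_prod_cat_def Hom_def len intro!: nth_equalityI)
  have "amap (ccomp Q ks) (arrow (length ks) t u, arrows ks ts us)
    \<in> Hom (cat_at Q (sum_list ks)) (omap (ccomp Q ks) (b_ob (length ks) t, map2 b_ob ks ts))
        (omap (ccomp Q ks) (b_ob (length ks) u, map2 b_ob ks us))"
    using Q.comp_functor[of ks] a unfolding is_functor_def d[symmetric] by blast
  then show "amap (ccomp Q ks) (arrow (length ks) t u, arrows ks ts us)
    \<in> Hom (cat_at Q (sum_list ks)) (b_ob (sum_list ks) (opcomp free_cmon ks t ts)) (b_ob (sum_list ks) (opcomp free_cmon ks u us))"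
    by (simp only: b_graft[OF t] b_graft[OF u])
qed (use free_cmon.comp_closed t u in auto)

definition tree_of :: "nat \<Rightarrow> 'q \<Rightarrow> cmon_tree" where
  "tree_of n = the_inv_into (trees n) (b_ob n)"

lemma tree_of_b [simp]: "t \<in> trees n \<Longrightarrow> tree_of n (b_ob n t) = t"
  unfolding tree_of_def using b_bij[of n] by (simp add: bij_betw_def the_inv_into_f_f)

lemma tree_of_closed [simp]: "q \<in> Ob (cat_at Q n) \<Longrightarrow> tree_of n q \<in> trees n"
  unfolding tree_of_def using b_bij[of n] by (auto simp: bij_betw_def intro!: the_inv_into_into)

lemma b_tree_of [simp]: "q \<in> Ob (cat_at Q n) \<Longrightarrow> b_ob n (tree_of n q) = q"
  unfolding tree_of_def using b_bij[of n] by (auto simp: bij_betw_def intro!: f_the_inv_into_f)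

text \<open>Every arrow is determined by its ends; therefore an algebra is determined by its values on trees and
  pairs of trees, and every tree algebra extends along \<open>b\<close>.\<close>

lemma arrow_dom_cod:
  assumes "r \<in> Arr (cat_at Q n)"
  shows "r = arrow n (tree_of n (Dom (cat_at Q n) r)) (tree_of n (Cod (cat_at Q n) r))"
  using assms Q.cat[of n] by (intro arrow_eqI) (simp_all add: is_category_def Hom_def)

definition algebra_of ::
  "(nat \<Rightarrow> cmon_tree \<Rightarrow> ('o list, 'a list, 'o, 'a) ftor) \<Rightarrow>
   (nat \<Rightarrow> cmon_tree \<Rightarrow> cmon_tree \<Rightarrow> ('o list, 'a list, 'o, 'a) ntrans) \<Rightarrow>
   nat \<Rightarrow> ('q, 'r, ('o list, 'a list, 'o, 'a) ftor, ('o list, 'a list, 'o, 'a) ntrans) ftor" where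
  "algebra_of T M n =
     \<lparr>omap = (\<lambda>q\<in>Ob (cat_at Q n). T n (tree_of n q)),
      amap = (\<lambda>r\<in>Arr (cat_at Q n). M n (tree_of n (Dom (cat_at Q n) r)) (tree_of n (Cod (cat_at Q n) r)))\<rparr>"

lemma algebra_of_b:
  "t \<in> trees n \<Longrightarrow> omap (algebra_of T M n) (b_ob n t) = T n t"
  "\<lbrakk>t \<in> trees n; u \<in> trees n\<rbrakk> \<Longrightarrow> amap (algebra_of T M n) (arrow n t u) = M n t u"
  using arrow_hom[of t n u] by (auto simp: algebra_of_def Hom_def)

lemma algebra_of_cong:
  assumes "\<And>n t. t \<in> trees n \<Longrightarrow> T n t = T' n t" "\<And>n t u. \<lbrakk>t \<in> trees n; u \<in> trees n\<rbrakk> \<Longrightarrow> M n t u = M' n t u"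
  shows "algebra_of T M = algebra_of T' M'"
  using Q.cat unfolding algebra_of_def
  by (intro ext ftor.equality) (auto simp: assms is_category_def intro!: restrict_ext)

definition tree_T :: "(nat \<Rightarrow> ('q, 'r, 'x, 'y) ftor) \<Rightarrow> nat \<Rightarrow> cmon_tree \<Rightarrow> 'x" where
  "tree_T h n t = omap (h n) (b_ob n t)"

definition tree_M :: "(nat \<Rightarrow> ('q, 'r, 'x, 'y) ftor) \<Rightarrow> nat \<Rightarrow> cmon_tree \<Rightarrow> cmon_tree \<Rightarrow> 'y" where
  "tree_M h n t u = amap (h n) (arrow n t u)"

lemma algebra_determined:
  assumes "h \<in> algebra_structures Q C"
  shows "h = algebra_of (tree_T h) (tree_M h)"
proof
  fix n
  have h: "h n \<in> functors (cat_at Q n) (cat_at (End_operad C) n)"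
    using assms unfolding algebra_structures_def cat_operad_morphism_def by blast
  have o: "omap (h n) q = (\<lambda>q\<in>Ob (cat_at Q n). tree_T h n (tree_of n q)) q" for q
    using h by (auto simp: tree_T_def functors_def extensional_def)
  have a: "amap (h n) r = (\<lambda>r\<in>Arr (cat_at Q n). tree_M h n (tree_of n (Dom (cat_at Q n) r)) (tree_of n (Cod (cat_at Q n) r))) r" for r
    using h arrow_dom_cod[of r n] by (auto simp: tree_M_def functors_def extensional_def)
  show "h n = algebra_of (tree_T h) (tree_M h) n"
    unfolding algebra_of_def by (rule ftor.equality) (use o a in auto)
qed

lemma tree_algebra_of_algebra:
  assumes C: "is_category C" and alg: "h \<in> algebra_structures Q C"
  shows "tree_algebra C (tree_T h) (tree_M h)"
proof -
  interpret C: cat C by unfold_locales (rule C)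
  have h: "is_functor (cat_at Q n) (functor_cat (power_cat C n) C) (h n)" for n
    using alg by (simp add: algebra_structures_def cat_operad_morphism_def functors_def)
  have obj: "operad_morphism (obj_operad Q) (obj_operad (End_operad C)) (\<lambda>n. omap (h n))"
    and arr: "operad_morphism (arr_operad Q) (arr_operad (End_operad C)) (\<lambda>n. amap (h n))"
    using alg unfolding algebra_structures_def cat_operad_morphism_def by blast+
  show ?thesis
  proof
    show "tree_T h n t \<in> functors (power_cat C n) C" if "t \<in> trees n" for n t
      using h[of n] that by (simp add: tree_T_def is_functor_def)
    show "tree_M h n t u \<in> Hom (functor_cat (power_cat C n) C) (tree_T h n t) (tree_T h n u)"
      if "t \<in> trees n" "u \<in> trees n" for n t u
      unfolding tree_T_def tree_M_def by (rule functor_hom[OF h arrow_hom[OF that]])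
    show "tree_M h n t t = Idn (functor_cat (power_cat C n) C) (tree_T h n t)" if "t \<in> trees n" for n t
      unfolding tree_T_def tree_M_def arrow_id[OF that, symmetric] by (rule functor_id[OF h b_closed[OF that]])
    show "Cmp (functor_cat (power_cat C n) C) (tree_M h n u v) (tree_M h n t u) = tree_M h n t v"
      if "t \<in> trees n" "u \<in> trees n" "v \<in> trees n" for n t u v
      unfolding tree_M_def arrow_comp[OF that, symmetric]
      by (rule functor_comp[OF h arrow_hom[OF that(1,2)] arrow_hom[OF that(2,3)], symmetric])
    show "tree_T h 1 (Leaf 0) = cunit (End_operad C)"
      using obj unfolding tree_T_def b_unit operad_morphism_def by (simp add: obj_operad_def)
    show "tree_T h n (relabel \<sigma> t) = omap (cact (End_operad C) n \<sigma>) (tree_T h n t)"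
      if "\<sigma> permutes {..<n}" "t \<in> trees n" for \<sigma> n t
      using obj that unfolding tree_T_def b_act[OF that] operad_morphism_def by (simp add: obj_operad_def)
    show "tree_M h n (relabel \<sigma> t) (relabel \<sigma> u) = amap (cact (End_operad C) n \<sigma>) (tree_M h n t u)"
      if "\<sigma> permutes {..<n}" "t \<in> trees n" "u \<in> trees n" for \<sigma> n t u
      using arr that arrow_hom[OF that(2,3)] unfolding tree_M_def arrow_act[OF that, symmetric] operad_morphism_def
      by (simp add: arr_operad_def Hom_def)
    fix ks t ts assume t: "t \<in> trees (length ks)" "ts \<in> list_prod (map trees ks)"
    have len: "length ts = length ks" using t by (simp add: in_list_prod_iff)
    have "map2 (\<lambda>n. omap (h n)) ks (map2 b_ob ks ts) = map2 (tree_T h) ks ts"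
      by (rule nth_equalityI) (simp_all add: len tree_T_def)
    moreover have "map2 b_ob ks ts \<in> list_prod (map (\<lambda>n. Ob (cat_at Q n)) ks)"
      using t by (simp add: in_list_prod_iff)
    ultimately show "tree_T h (sum_list ks) (opcomp free_cmon ks t ts)
        = omap (ccomp (End_operad C) ks) (tree_T h (length ks) t, map2 (tree_T h) ks ts)"
      using obj t(1) unfolding tree_T_def[of h "sum_list ks"] tree_T_def[of h "length ks"] b_graft[OF t] operad_morphism_def
      by (simp add: obj_operad_def)
    fix u us assume u: "u \<in> trees (length ks)" "us \<in> list_prod (map trees ks)"
    have len': "length us = length ks" using u by (simp add: in_list_prod_iff)
    have "map2 (\<lambda>n. amap (h n)) ks (arrows ks ts us) = map2 (\<lambda>k (t, u). tree_M h k t u) ks (zip ts us)"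
      by (rule nth_equalityI) (simp_all add: len len' tree_M_def)
    moreover have "arrow (length ks) t u \<in> Arr (cat_at Q (length ks))" using arrow_hom[OF t(1) u(1)] by (simp add: Hom_def)
    ultimately show "tree_M h (sum_list ks) (opcomp free_cmon ks t ts) (opcomp free_cmon ks u us)
      = amap (ccomp (End_operad C) ks) (tree_M h (length ks) t u, map2 (\<lambda>k (t, u). tree_M h k t u) ks (zip ts us))"
      using arr arrows_closed[OF t(2) u(2)]
      unfolding tree_M_def[of h "sum_list ks"] tree_M_def[of h "length ks"] arrow_graft[OF t u, symmetric] operad_morphism_def
      by (simp add: arr_operad_def)
  qed
qed

lemma algebra_of_tree_algebra:
  assumes "tree_algebra C T M"
  shows "algebra_of T M \<in> algebra_structures Q C"
proof -
  interpret tree_algebra C T M by fact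
  let ?h = "algebra_of T M"
  have QD: "Dom (cat_at Q n) r \<in> Ob (cat_at Q n)" "Cod (cat_at Q n) r \<in> Ob (cat_at Q n)" if "r \<in> Arr (cat_at Q n)" for n r
    using Q.cat[of n] that by (auto simp: is_category_def)
  have obE: "\<exists>t. t \<in> trees n \<and> q = b_ob n t" if "q \<in> Ob (cat_at Q n)" for n q
    using that by (intro exI[of _ "tree_of n q"]) simp
  have arrE: "\<exists>t u. t \<in> trees n \<and> u \<in> trees n \<and> r = arrow n t u" if "r \<in> Arr (cat_at Q n)" for n r
    by (intro exI[of _ "tree_of n (Dom (cat_at Q n) r)"] exI[of _ "tree_of n (Cod (cat_at Q n) r)"] conjI
        tree_of_closed QD[OF that] arrow_dom_cod[OF that])
  have obsE: "\<exists>ts. ts \<in> list_prod (map trees ks) \<and> qs = map2 b_ob ks ts"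
    if "qs \<in> list_prod (map (\<lambda>n. Ob (cat_at Q n)) ks)" for ks qs
    using that by (intro exI[of _ "map2 tree_of ks qs"]) (auto simp: in_list_prod_iff list_eq_iff_nth_eq)
  have arrsE: "\<exists>ts us. ts \<in> list_prod (map trees ks) \<and> us \<in> list_prod (map trees ks) \<and> rs = arrows ks ts us"
    if "rs \<in> list_prod (map (\<lambda>n. Arr (cat_at Q n)) ks)" for ks rs
  proof (intro exI conjI)
    let ?ts = "map2 (\<lambda>n r. tree_of n (Dom (cat_at Q n) r)) ks rs" and ?us = "map2 (\<lambda>n r. tree_of n (Cod (cat_at Q n) r)) ks rs"
    show "?ts \<in> list_prod (map trees ks)" "?us \<in> list_prod (map trees ks)"
      using that by (simp_all add: in_list_prod_iff QD)
    show "rs = arrows ks ?ts ?us"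
    proof (rule nth_equalityI)
      fix i assume "i < length rs"
      then have "i < length ks" "rs ! i \<in> Arr (cat_at Q (ks ! i))" using that by (simp_all add: in_list_prod_iff)
      then show "rs ! i = arrows ks ?ts ?us ! i"
        using that arrow_dom_cod[of "rs ! i" "ks ! i"] by (simp add: in_list_prod_iff)
    qed (use that in \<open>simp add: in_list_prod_iff\<close>)
  qed
  have D: "Dom (cat_at Q n) (arrow n t u) = b_ob n t" "Cod (cat_at Q n) (arrow n t u) = b_ob n u" "arrow n t u \<in> Arr (cat_at Q n)"
    if "t \<in> trees n" "u \<in> trees n" for n t u using arrow_hom[OF that] by (simp_all add: Hom_def)
  have ftr: "?h n \<in> functors (cat_at Q n) (functor_cat (power_cat C n) C)" for n
    unfolding functors_def is_functor_def mem_Collect_eq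
  proof (intro conjI ballI impI)
    fix q assume "q \<in> Ob (cat_at Q n)"
    then obtain t where t: "t \<in> trees n" "q = b_ob n t" using obE by blast
    show "omap (?h n) q \<in> Ob (functor_cat (power_cat C n) C)" using t by (simp add: algebra_of_b T_functor)
    show "amap (?h n) (Idn (cat_at Q n) q) = Idn (functor_cat (power_cat C n) C) (omap (?h n) q)"
      using t by (simp add: algebra_of_b arrow_id M_id)
  next
    fix r assume "r \<in> Arr (cat_at Q n)"
    then obtain t u where t: "t \<in> trees n" "u \<in> trees n" "r = arrow n t u" using arrE by blast
    show "amap (?h n) r \<in> Hom (functor_cat (power_cat C n) C) (omap (?h n) (Dom (cat_at Q n) r)) (omap (?h n) (Cod (cat_at Q n) r))"
      using t M_hom by (simp add: algebra_of_b D)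
    fix s assume "s \<in> Arr (cat_at Q n)" and rs: "Dom (cat_at Q n) s = Cod (cat_at Q n) r"
    then obtain u' v where u: "u' \<in> trees n" "v \<in> trees n" "s = arrow n u' v" using arrE by blast
    have "b_ob n u' = b_ob n u" using rs D[OF t(1,2)] D[OF u(1,2)] by (simp add: t(3) u(3))
    then have "u' = u" using inj_onD[OF bij_betw_imp_inj_on[OF b_bij]] u(1) t(2) by blast
    then show "amap (?h n) (Cmp (cat_at Q n) s r) = Cmp (functor_cat (power_cat C n) C) (amap (?h n) s) (amap (?h n) r)"
      using t u M_comp by (simp add: algebra_of_b arrow_comp)
  qed (simp_all add: algebra_of_def)
  then have ftr': "is_functor (cat_at Q n) (functor_cat (power_cat C n) C) (?h n)" for n by (simp add: functors_def)
  have obj: "operad_morphism (obj_operad Q) (obj_operad (End_operad C)) (\<lambda>n. omap (?h n))"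
    unfolding operad_morphism_def
  proof (intro conjI allI impI)
    show "omap (?h n) \<in> ops (obj_operad Q) n \<rightarrow>\<^sub>E ops (obj_operad (End_operad C)) n" for n
      using ftr[of n] by (auto simp: functors_def is_functor_def obj_operad_def PiE_def)
    show "omap (?h 1) (opunit (obj_operad Q)) = opunit (obj_operad (End_operad C))"
      using algebra_of_b(1)[of "Leaf 0" 1 T M] free_cmon.unit_closed b_unit T_unit
      by (simp add: obj_operad_def free_opunit)
  next
    fix n \<sigma> q assume s: "\<sigma> permutes {..<n}" and "q \<in> ops (obj_operad Q) n"
    then obtain t where t: "t \<in> trees n" "q = b_ob n t" using obE by (auto simp: obj_operad_def)
    have "relabel \<sigma> t \<in> trees n" using free_cmon.act_closed[OF s t(1)] by (simp add: free_opact)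
    then show "omap (?h n) (opact (obj_operad Q) n \<sigma> q) = opact (obj_operad (End_operad C)) n \<sigma> (omap (?h n) q)"
      using t s by (simp add: obj_operad_def algebra_of_b T_act flip: b_act)
  next
    fix ks q qs assume "q \<in> ops (obj_operad Q) (length ks)" "qs \<in> list_prod (map (ops (obj_operad Q)) ks)"
    then obtain t ts where t: "t \<in> trees (length ks)" "ts \<in> list_prod (map trees ks)"
      and q: "q = b_ob (length ks) t" "qs = map2 b_ob ks ts"
      using obE[of q "length ks"] obsE[of qs ks] by (auto simp: obj_operad_def)
    have "map2 (\<lambda>n. omap (?h n)) ks (map2 b_ob ks ts) = map2 T ks ts"
      using t(2) by (auto simp: in_list_prod_iff algebra_of_b intro!: nth_equalityI)
    then show "omap (?h (sum_list ks)) (opcomp (obj_operad Q) ks q qs)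
       = opcomp (obj_operad (End_operad C)) ks (omap (?h (length ks)) q) (map2 (\<lambda>n. omap (?h n)) ks qs)"
      using t free_cmon.comp_closed[OF t] unfolding q
      by (simp add: obj_operad_def algebra_of_b T_graft flip: b_graft)
  qed
  have arr: "operad_morphism (arr_operad Q) (arr_operad (End_operad C)) (\<lambda>n. amap (?h n))"
    unfolding operad_morphism_def
  proof (intro conjI allI impI)
    show "amap (?h n) \<in> ops (arr_operad Q) n \<rightarrow>\<^sub>E ops (arr_operad (End_operad C)) n" for n
      using ftr[of n] by (auto simp: functors_def is_functor_def arr_operad_def PiE_def Hom_def)
    have l: "Leaf 0 \<in> trees 1" using free_cmon.unit_closed by (simp add: free_opunit)
    show "amap (?h 1) (opunit (arr_operad Q)) = opunit (arr_operad (End_operad C))"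
      using algebra_of_b(2)[OF l l, of T M] l arrow_id[OF l] M_id[OF l] unfolding T_unit b_unit
      by (simp add: arr_operad_def)
  next
    fix n \<sigma> r assume s: "\<sigma> permutes {..<n}" and "r \<in> ops (arr_operad Q) n"
    then obtain t u where t: "t \<in> trees n" "u \<in> trees n" "r = arrow n t u" using arrE by (fastforce simp: arr_operad_def)
    have "relabel \<sigma> t \<in> trees n" "relabel \<sigma> u \<in> trees n"
      using free_cmon.act_closed[OF s t(1)] free_cmon.act_closed[OF s t(2)] by (simp_all add: free_opact)
    then show "amap (?h n) (opact (arr_operad Q) n \<sigma> r) = opact (arr_operad (End_operad C)) n \<sigma> (amap (?h n) r)"
      using t s by (simp add: arr_operad_def arrow_act algebra_of_b M_act)
  next
    fix ks r rs assume "r \<in> ops (arr_operad Q) (length ks)" "rs \<in> list_prod (map (ops (arr_operad Q)) ks)"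
    then obtain t ts u us where t: "t \<in> trees (length ks)" "ts \<in> list_prod (map trees ks)"
      and u: "u \<in> trees (length ks)" "us \<in> list_prod (map trees ks)"
      and r: "r = arrow (length ks) t u" "rs = arrows ks ts us"
      using arrE[of r "length ks"] arrsE[of rs ks] by (auto simp: arr_operad_def)
    have "map2 (\<lambda>n. amap (?h n)) ks (arrows ks ts us) = map2 (\<lambda>k (t, u). M k t u) ks (zip ts us)"
      using t(2) u(2) by (auto simp: in_list_prod_iff algebra_of_b intro!: nth_equalityI)
    then show "amap (?h (sum_list ks)) (opcomp (arr_operad Q) ks r rs)
       = opcomp (arr_operad (End_operad C)) ks (amap (?h (length ks)) r) (map2 (\<lambda>n. amap (?h n)) ks rs)"
      using t u free_cmon.comp_closed[OF t] free_cmon.comp_closed[OF u] unfolding r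
      by (simp add: arr_operad_def arrow_graft algebra_of_b M_graft)
  qed
  show ?thesis
    using ftr obj arr by (simp add: algebra_structures_def cat_operad_morphism_def)
qed

end

section \<open>Symmetric monoidal categories are tree algebras\<close>

lemma End_ccomp_omap:
  "omap (ccomp (End_operad C) ks) (G, Hs) =
     \<lparr>omap = (\<lambda>xs\<in>Ob (power_cat C (sum_list ks)). omap G (map2 omap Hs (blocks ks xs))),
      amap = (\<lambda>fs\<in>Arr (power_cat C (sum_list ks)). amap G (map2 amap Hs (blocks ks fs)))\<rparr>"
  and End_ccomp_amap:
  "amap (ccomp (End_operad C) ks) (t, ss) =
     \<lparr>nsrc = omap (ccomp (End_operad C) ks) (nsrc t, map nsrc ss),
      ntgt = omap (ccomp (End_operad C) ks) (ntgt t, map ntgt ss),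
      ncmp = (\<lambda>xs\<in>Ob (power_cat C (sum_list ks)).
        Cmp C (ncmp t (map2 omap (map ntgt ss) (blocks ks xs))) (amap (nsrc t) (map2 ncmp ss (blocks ks xs))))\<rparr>"
  and End_cact_omap:
  "omap (cact (End_operad C) n \<sigma>) G =
     \<lparr>omap = (\<lambda>xs\<in>Ob (power_cat C n). omap G (permute_list \<sigma> xs)),
      amap = (\<lambda>fs\<in>Arr (power_cat C n). amap G (permute_list \<sigma> fs))\<rparr>"
  and End_cact_amap:
  "amap (cact (End_operad C) n \<sigma>) t =
     \<lparr>nsrc = omap (cact (End_operad C) n \<sigma>) (nsrc t),
      ntgt = omap (cact (End_operad C) n \<sigma>) (ntgt t),
      ncmp = (\<lambda>xs\<in>Ob (power_cat C n). ncmp t (permute_list \<sigma> xs))\<rparr>"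
  and End_cunit: "cunit (End_operad C) =
     \<lparr>omap = (\<lambda>xs\<in>Ob (power_cat C 1). hd xs), amap = (\<lambda>fs\<in>Arr (power_cat C 1). hd fs)\<rparr>"
  by (simp_all add: End_operad_def Let_def)

lemma length_blocks [simp]: "length (blocks ks xs) = length ks"
  by (induction ks arbitrary: xs) simp_all

lemma nth_blocks:
  "\<lbrakk>i < length ks; sum_list ks \<le> length xs\<rbrakk> \<Longrightarrow> blocks ks xs ! i = map (\<lambda>j. xs ! (block_start ks i + j)) [0..<ks ! i]"
proof (induction ks arbitrary: xs i)
  case (Cons k ks)
  show ?case
  proof (cases i)
    case 0
    then show ?thesis using Cons.prems by (auto intro!: nth_equalityI)
  next
    case (Suc i')
    then show ?thesis using Cons.prems Cons.IH[of i' "drop k xs"] by (auto intro!: nth_equalityI simp: add.assoc)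
  qed
qed simp

lemma blocks_power:
  assumes "i < length ks"
  shows "xs \<in> Ob (power_cat C (sum_list ks)) \<Longrightarrow> blocks ks xs ! i \<in> Ob (power_cat C (ks ! i))"
    "fs \<in> Arr (power_cat C (sum_list ks)) \<Longrightarrow> blocks ks fs ! i \<in> Arr (power_cat C (ks ! i))"
  using assms block_start_bound by (auto simp: power_cat_Ob power_cat_Arr nth_blocks)

lemma tree_props: "t \<in> trees n \<Longrightarrow> wf_tree t" "t \<in> trees n \<Longrightarrow> distinct (leaves t)"
    "t \<in> trees n \<Longrightarrow> set (leaves t) = {..<n}"
  by (simp_all add: free_ops_iff)

lemma tree_fold_map:
  "\<lbrakk>t \<in> trees n; length fs = n\<rbrakk> \<Longrightarrow> tree_fold m e ((!) (map g fs)) t = tree_fold m e (\<lambda>v. g (fs ! v)) t"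
  by (rule tree_fold_cong) (auto simp: tree_props)

text \<open>Evaluation turns grafting into substitution. As trees carry the numbers of their inputs at
  the leaves, the blocks of an argument list are simply selected by the shifted labels.\<close>

lemma tree_fold_opcomp:
  assumes "t \<in> trees (length ks)" "ts \<in> list_prod (map trees ks)" "length xs = sum_list ks"
  shows "tree_fold m e ((!) xs) (opcomp free_cmon ks t ts)
    = tree_fold m e ((!) (map2 (\<lambda>s. \<lambda>ys. tree_fold m e ((!) ys) s) ts (blocks ks xs))) t"
proof -
  have ts: "ts ! i \<in> trees (ks ! i)" "length ts = length ks" if "i < length ks" for i
    using assms(2) that by (auto simp: in_list_prod_iff)
  show ?thesis
    unfolding free_opcomp tree_fold_graft[OF tree_props(1)[OF assms(1)]]
  proof (rule tree_fold_cong[OF tree_props(1)[OF assms(1)]])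
    fix i assume "i \<in> set (leaves t)"
    then have i: "i < length ks" using tree_props(3)[OF assms(1)] by simp
    show "tree_fold m e ((!) xs) (relabel ((+) (block_start ks i)) (ts ! i))
       = map2 (\<lambda>s ys. tree_fold m e ((!) ys) s) ts (blocks ks xs) ! i"
      using i ts[OF i] assms(3)
      by (auto simp: tree_fold_relabel tree_props nth_blocks intro!: tree_fold_cong)
  qed
qed

lemma tree_fold_permute:
  assumes "\<sigma> permutes {..<n}" "t \<in> trees n" "length xs = n"
  shows "tree_fold m e ((!) xs) (relabel \<sigma> t) = tree_fold m e ((!) (permute_list \<sigma> xs)) t"
  using assms by (auto simp: tree_fold_relabel tree_props permute_list_nth intro!: tree_fold_cong)

lemma power_permute:
  assumes "\<sigma> permutes {..<n}"
  shows "xs \<in> Ob (power_cat C n) \<Longrightarrow> permute_list \<sigma> xs \<in> Ob (power_cat C n)"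
    "fs \<in> Arr (power_cat C n) \<Longrightarrow> permute_list \<sigma> fs \<in> Arr (power_cat C n)"
  using assms permutes_lt[OF assms] by (auto simp: power_cat_Ob power_cat_Arr permute_list_nth)

context sym_mon_ops begin

definition tree_functor :: "nat \<Rightarrow> cmon_tree \<Rightarrow> ('o list, 'a list, 'o, 'a) ftor" where
  "tree_functor n t =
     \<lparr>omap = (\<lambda>xs\<in>Ob (power_cat C n). ev ((!) xs) t), amap = (\<lambda>fs\<in>Arr (power_cat C n). eva ((!) fs) t)\<rparr>"

definition coh_arrow :: "cmon_tree \<Rightarrow> cmon_tree \<Rightarrow> (nat \<Rightarrow> 'o) \<Rightarrow> 'a" where
  "coh_arrow t u = (SOME a. coh t u a)"

definition coh_trans :: "nat \<Rightarrow> cmon_tree \<Rightarrow> cmon_tree \<Rightarrow> ('o list, 'a list, 'o, 'a) ntrans" where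
  "coh_trans n t u =
     \<lparr>nsrc = tree_functor n t, ntgt = tree_functor n u,
      ncmp = (\<lambda>xs\<in>Ob (power_cat C n). coh_arrow t u ((!) xs))\<rparr>"

end

context sym_mon_cat begin

lemma coh_arrow:
  assumes "t \<in> trees n" "u \<in> trees n"
  shows "coh t u (coh_arrow t u)"
  unfolding coh_arrow_def
  by (rule someI_ex[OF coh_exists]) (use assms in \<open>simp_all add: tree_props\<close>)

lemma coh_arrow_eq:
  assumes "coh t u a" "t \<in> trees n" "xs \<in> Ob (power_cat C n)"
  shows "coh_arrow t u ((!) xs) = a ((!) xs)"
proof (rule coh_unique)
  show "coh t u (coh_arrow t u)" unfolding coh_arrow_def by (rule someI[of "coh t u"]) (rule assms)
qed (use assms in \<open>auto simp: tree_props power_cat_Ob\<close>)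

lemma ev_power: "\<lbrakk>t \<in> trees n; xs \<in> Ob (power_cat C n)\<rbrakk> \<Longrightarrow> ev ((!) xs) t \<in> Ob C"
  by (rule ev_ob) (auto simp: tree_props power_cat_Ob)

lemma eva_power:
  assumes "t \<in> trees n" "fs \<in> Arr (power_cat C n)"
  shows "eva ((!) fs) t \<in> Arr C" "Dom C (eva ((!) fs) t) = ev (\<lambda>v. Dom C (fs ! v)) t"
    "Cod C (eva ((!) fs) t) = ev (\<lambda>v. Cod C (fs ! v)) t"
  by (rule eva_arr; use assms in \<open>auto simp: tree_props power_cat_Arr\<close>)+

lemma tree_functor_functor:
  assumes t: "t \<in> trees n"
  shows "tree_functor n t \<in> functors (power_cat C n) C"
  unfolding functors_def is_functor_def mem_Collect_eq
proof (intro conjI ballI impI)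
  have wf: "wf_tree t" and l: "set (leaves t) = {..<n}" using tree_props[OF t] by simp_all
  show "omap (tree_functor n t) xs \<in> Ob C" if "xs \<in> Ob (power_cat C n)" for xs
    using that ev_power[OF t] by (simp add: tree_functor_def)
  show "amap (tree_functor n t) (Idn (power_cat C n) xs) = one (omap (tree_functor n t) xs)"
    if "xs \<in> Ob (power_cat C n)" for xs
  proof -
    have "eva (\<lambda>v. one (xs ! v)) t = one (ev ((!) xs) t)"
      by (rule eva_id[OF wf]) (use that l in \<open>auto simp: power_cat_Ob\<close>)
    then show ?thesis
      using that by (simp add: tree_functor_def power_cat_Ob power_cat_Arr power_cat_ops tree_fold_map[OF t])
  qed
  fix fs assume fs: "fs \<in> Arr (power_cat C n)"
  then show "amap (tree_functor n t) fs \<in> Hom C (omap (tree_functor n t) (Dom (power_cat C n) fs)) (omap (tree_functor n t) (Cod (power_cat C n) fs))"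
    using eva_power[OF t fs] by (simp add: tree_functor_def power_cat_Ob power_cat_Arr power_cat_ops tree_fold_map[OF t] Hom_def)
  fix gs assume gs: "gs \<in> Arr (power_cat C n)" and "Dom (power_cat C n) gs = Cod (power_cat C n) fs"
  then have eq: "Dom C (gs ! i) = Cod C (fs ! i)" if "i < n" for i
    using fs gs that by (auto simp: power_cat_Arr power_cat_ops list_eq_iff_nth_eq)
  have "eva ((!) (map2 (Cmp C) gs fs)) t = eva (\<lambda>i. gs ! i \<cdot> fs ! i) t"
    using fs gs l by (intro tree_fold_cong[OF wf]) (auto simp: power_cat_Arr)
  also have "\<dots> = eva ((!) gs) t \<cdot> eva ((!) fs) t"
    using fs gs eq l by (intro eva_comp[OF wf]) (auto simp: power_cat_Arr)
  finally show "amap (tree_functor n t) (Cmp (power_cat C n) gs fs) = amap (tree_functor n t) gs \<cdot> amap (tree_functor n t) fs"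
    using fs gs eq by (simp add: tree_functor_def power_cat_Arr power_cat_ops)
qed (simp_all add: tree_functor_def)

lemma coh_trans_natural:
  assumes t: "t \<in> trees n" and u: "u \<in> trees n"
  shows "coh_trans n t u \<in> Hom (functor_cat (power_cat C n) C) (tree_functor n t) (tree_functor n u)"
proof -
  note c = coh_arrow[OF t u]
  have wf: "wf_tree t" "wf_tree u" and l: "set (leaves t) = {..<n}" "set (leaves u) = {..<n}"
    using tree_props[OF t] tree_props[OF u] by simp_all
  have "is_natural (power_cat C n) C (tree_functor n t) (tree_functor n u) (\<lambda>xs\<in>Ob (power_cat C n). coh_arrow t u ((!) xs))"
    unfolding is_natural_def
  proof (intro conjI ballI)
    show "(\<lambda>xs\<in>Ob (power_cat C n). coh_arrow t u ((!) xs)) xs \<in> Hom C (omap (tree_functor n t) xs) (omap (tree_functor n u) xs)"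
      if "xs \<in> Ob (power_cat C n)" for xs
      using coh_arr[OF c, of "(!) xs"] that l by (simp add: tree_functor_def power_cat_Ob Hom_def)
    fix fs assume fs: "fs \<in> Arr (power_cat C n)"
    have "coh_arrow t u ((!) (map g fs)) = coh_arrow t u (\<lambda>v. g (fs ! v))" for g :: "'a \<Rightarrow> 'o"
      using fs l by (intro coh_cong[OF c]) (simp add: power_cat_Arr)
    then show "(\<lambda>xs\<in>Ob (power_cat C n). coh_arrow t u ((!) xs)) (Cod (power_cat C n) fs) \<cdot> amap (tree_functor n t) fs
       = amap (tree_functor n u) fs \<cdot> (\<lambda>xs\<in>Ob (power_cat C n). coh_arrow t u ((!) xs)) (Dom (power_cat C n) fs)"
      using coh_natural[OF c, of "(!) fs"] fs l
      by (simp add: tree_functor_def power_cat_Ob power_cat_Arr power_cat_ops)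
  qed simp
  then show ?thesis
    using tree_functor_functor[OF t] tree_functor_functor[OF u] by (simp add: coh_trans_def functor_cat_def Hom_def)
qed

lemma coh_arrow_graft:
  assumes t: "t \<in> trees (length ks)" "ts \<in> list_prod (map trees ks)"
    and u: "u \<in> trees (length ks)" "us \<in> list_prod (map trees ks)"
    and xs: "xs \<in> Ob (power_cat C (sum_list ks))"
  shows "coh_arrow (opcomp free_cmon ks t ts) (opcomp free_cmon ks u us) ((!) xs)
    = coh_arrow t u ((!) (map2 (\<lambda>s ys. ev ((!) ys) s) us (blocks ks xs)))
      \<cdot> eva ((!) (map2 (\<lambda>(s, s') ys. coh_arrow s s' ((!) ys)) (zip ts us) (blocks ks xs))) t"
proof -
  let ?r = "\<lambda>ts i. relabel ((+) (block_start ks i)) (ts ! i)"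
  have l: "length xs = sum_list ks" "length ts = length ks" "length us = length ks"
    using xs t u by (simp_all add: power_cat_Ob in_list_prod_iff)
  have i: "ts ! i \<in> trees (ks ! i)" "us ! i \<in> trees (ks ! i)" if "i < length ks" for i
    using t u that by (auto simp: in_list_prod_iff)
  let ?\<theta> = "\<lambda>i x. coh_arrow (ts ! i) (us ! i) (\<lambda>j. x (block_start ks i + j))"
  have \<theta>: "coh (?r ts i) (?r us i) (?\<theta> i)" if "i < length ks" for i
    using coh_graft[OF coh_arrow[OF i[OF that]], of "\<lambda>j. Leaf (block_start ks i + j)"]
    by (simp add: relabel_def)
  have "coh (graft (?r ts) t) (graft (?r us) t) (\<lambda>x. eva (\<lambda>i. ?\<theta> i x) t)"
    using \<theta> t(1) by (intro coh_subst) (auto simp: tree_props)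
  moreover have "coh (graft (?r us) t) (graft (?r us) u) (\<lambda>x. coh_arrow t u (\<lambda>i. ev x (?r us i)))"
    using tree_props(1)[OF i(2)] tree_props(3)[OF t(1)]
    by (intro coh_graft[OF coh_arrow[OF t(1) u(1)]] wf_relabel) simp
  ultimately have "coh (opcomp free_cmon ks t ts) (opcomp free_cmon ks u us)
      (\<lambda>x. coh_arrow t u (\<lambda>i. ev x (?r us i)) \<cdot> eva (\<lambda>i. ?\<theta> i x) t)"
    unfolding free_opcomp by (rule coh_comp)
  then have "coh_arrow (opcomp free_cmon ks t ts) (opcomp free_cmon ks u us) ((!) xs)
    = coh_arrow t u (\<lambda>i. ev ((!) xs) (?r us i)) \<cdot> eva (\<lambda>i. ?\<theta> i ((!) xs)) t"
    using free_cmon.comp_closed[OF t] xs by (intro coh_arrow_eq)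
  also have "coh_arrow t u (\<lambda>i. ev ((!) xs) (?r us i)) = coh_arrow t u ((!) (map2 (\<lambda>s ys. ev ((!) ys) s) us (blocks ks xs)))"
  proof (rule coh_cong[OF coh_arrow[OF t(1) u(1)]])
    fix j assume "j \<in> set (leaves t)"
    then have j: "j < length ks" using tree_props(3)[OF t(1)] by simp
    then show "ev ((!) xs) (?r us j) = map2 (\<lambda>s ys. ev ((!) ys) s) us (blocks ks xs) ! j"
      using i(2)[OF j] l by (auto simp: tree_fold_relabel tree_props nth_blocks intro!: tree_fold_cong)
  qed
  also have "eva (\<lambda>i. ?\<theta> i ((!) xs)) t = eva ((!) (map2 (\<lambda>(s, s') ys. coh_arrow s s' ((!) ys)) (zip ts us) (blocks ks xs))) t"
  proof (rule tree_fold_cong[OF tree_props(1)[OF t(1)]])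
    fix j assume "j \<in> set (leaves t)"
    then have j: "j < length ks" using tree_props(3)[OF t(1)] by simp
    then show "?\<theta> j ((!) xs) = map2 (\<lambda>(s, s') ys. coh_arrow s s' ((!) ys)) (zip ts us) (blocks ks xs) ! j"
      using i[OF j] l by (auto simp: tree_props nth_blocks intro!: coh_cong[OF coh_arrow[OF i[OF j]]])
  qed
  finally show ?thesis .
qed

lemma tree_functor_act:
  assumes s: "\<sigma> permutes {..<n}" and t: "t \<in> trees n"
  shows "tree_functor n (relabel \<sigma> t) = omap (cact (End_operad C) n \<sigma>) (tree_functor n t)"
proof -
  have "ev ((!) xs) (relabel \<sigma> t) = omap (tree_functor n t) (permute_list \<sigma> xs)" if "xs \<in> Ob (power_cat C n)" for xs
    using power_permute(1)[OF s that] tree_fold_permute[OF s t, of xs] that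
    by (simp add: tree_functor_def power_cat_Ob)
  moreover have "eva ((!) fs) (relabel \<sigma> t) = amap (tree_functor n t) (permute_list \<sigma> fs)" if "fs \<in> Arr (power_cat C n)" for fs
    using power_permute(2)[OF s that] tree_fold_permute[OF s t, of fs] that
    by (simp add: tree_functor_def power_cat_Arr)
  ultimately show ?thesis
    unfolding End_cact_omap by (subst tree_functor_def) (auto intro!: restrict_ext)
qed

lemma coh_trans_act:
  assumes s: "\<sigma> permutes {..<n}" and t: "t \<in> trees n" and u: "u \<in> trees n"
  shows "coh_trans n (relabel \<sigma> t) (relabel \<sigma> u) = amap (cact (End_operad C) n \<sigma>) (coh_trans n t u)"
proof -
  have "coh_arrow (relabel \<sigma> t) (relabel \<sigma> u) ((!) xs) = coh_arrow t u ((!) (permute_list \<sigma> xs))"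
    if xs: "xs \<in> Ob (power_cat C n)" for xs
  proof -
    have "coh (relabel \<sigma> t) (relabel \<sigma> u) (\<lambda>x. coh_arrow t u (\<lambda>v. x (\<sigma> v)))"
      using coh_graft[OF coh_arrow[OF t u], of "\<lambda>v. Leaf (\<sigma> v)"] by (simp add: relabel_def)
    moreover have "relabel \<sigma> t \<in> trees n" using free_cmon.act_closed[OF s t] by (simp add: free_opact)
    ultimately have "coh_arrow (relabel \<sigma> t) (relabel \<sigma> u) ((!) xs) = coh_arrow t u (\<lambda>v. xs ! \<sigma> v)"
      using coh_arrow_eq xs by simp
    also have "\<dots> = coh_arrow t u ((!) (permute_list \<sigma> xs))"
      using xs s tree_props(3)[OF t] by (intro coh_cong[OF coh_arrow[OF t u]]) (simp add: permute_list_nth power_cat_Ob)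
    finally show ?thesis .
  qed
  then show ?thesis
    by (auto simp: coh_trans_def End_cact_amap tree_functor_act s t u power_permute(1)[OF s] intro!: restrict_ext)
qed

lemma tree_functor_graft:
  assumes t: "t \<in> trees (length ks)" "ts \<in> list_prod (map trees ks)"
  shows "tree_functor (sum_list ks) (opcomp free_cmon ks t ts)
    = omap (ccomp (End_operad C) ks) (tree_functor (length ks) t, map2 tree_functor ks ts)"
proof -
  have ts: "ts ! i \<in> trees (ks ! i)" "length ts = length ks" if "i < length ks" for i
    using t that by (auto simp: in_list_prod_iff)
  have lt: "length ts = length ks" using t by (simp add: in_list_prod_iff)
  have o: "ev ((!) xs) (opcomp free_cmon ks t ts) = omap (tree_functor (length ks) t) (map2 omap (map2 tree_functor ks ts) (blocks ks xs))"
    if xs: "xs \<in> Ob (power_cat C (sum_list ks))" for xs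
  proof -
    have b: "map2 omap (map2 tree_functor ks ts) (blocks ks xs) = map2 (\<lambda>s ys. ev ((!) ys) s) ts (blocks ks xs)"
      using blocks_power(1)[OF _ xs] lt by (auto simp: tree_functor_def intro!: nth_equalityI)
    have "map2 (\<lambda>s ys. ev ((!) ys) s) ts (blocks ks xs) \<in> Ob (power_cat C (length ks))"
      using ev_power[OF ts(1) blocks_power(1)[OF _ xs]] lt by (subst power_cat_Ob) simp
    then show ?thesis
      using tree_fold_opcomp[OF t, of xs] power_cat_Ob[of xs C] xs unfolding b by (simp add: tree_functor_def)
  qed
  have a: "eva ((!) xs) (opcomp free_cmon ks t ts) = amap (tree_functor (length ks) t) (map2 amap (map2 tree_functor ks ts) (blocks ks xs))"
    if xs: "xs \<in> Arr (power_cat C (sum_list ks))" for xs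
  proof -
    have b: "map2 amap (map2 tree_functor ks ts) (blocks ks xs) = map2 (\<lambda>s ys. eva ((!) ys) s) ts (blocks ks xs)"
      using blocks_power(2)[OF _ xs] lt by (auto simp: tree_functor_def intro!: nth_equalityI)
    have "map2 (\<lambda>s ys. eva ((!) ys) s) ts (blocks ks xs) \<in> Arr (power_cat C (length ks))"
      using eva_power(1)[OF ts(1) blocks_power(2)[OF _ xs]] lt by (subst power_cat_Arr) simp
    then show ?thesis
      using tree_fold_opcomp[OF t, of xs] power_cat_Arr[of xs C] xs unfolding b by (simp add: tree_functor_def)
  qed
  show ?thesis
    unfolding End_ccomp_omap using o a
    by (subst tree_functor_def) (auto intro!: restrict_ext)
qed

lemma coh_trans_graft:
  assumes t: "t \<in> trees (length ks)" "ts \<in> list_prod (map trees ks)"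
    and u: "u \<in> trees (length ks)" "us \<in> list_prod (map trees ks)"
  shows "coh_trans (sum_list ks) (opcomp free_cmon ks t ts) (opcomp free_cmon ks u us)
    = amap (ccomp (End_operad C) ks) (coh_trans (length ks) t u, map2 (\<lambda>k (t, u). coh_trans k t u) ks (zip ts us))"
proof -
  let ?ss = "map2 (\<lambda>k (t, u). coh_trans k t u) ks (zip ts us)"
  have ts: "ts ! i \<in> trees (ks ! i)" "us ! i \<in> trees (ks ! i)" if "i < length ks" for i
    using t u that by (auto simp: in_list_prod_iff)
  have lt: "length ts = length ks" "length us = length ks" using t u by (simp_all add: in_list_prod_iff)
  have st: "map nsrc ?ss = map2 tree_functor ks ts" "map ntgt ?ss = map2 tree_functor ks us"
    using lt by (auto simp: coh_trans_def intro!: nth_equalityI)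
  have "coh_arrow (opcomp free_cmon ks t ts) (opcomp free_cmon ks u us) ((!) xs)
    = ncmp (coh_trans (length ks) t u) (map2 omap (map ntgt ?ss) (blocks ks xs)) \<cdot>
      amap (nsrc (coh_trans (length ks) t u)) (map2 ncmp ?ss (blocks ks xs))"
    if xs: "xs \<in> Ob (power_cat C (sum_list ks))" for xs
  proof -
    note bl = blocks_power(1)[OF _ xs]
    have o: "map2 omap (map ntgt ?ss) (blocks ks xs) = map2 (\<lambda>s ys. ev ((!) ys) s) us (blocks ks xs)"
      unfolding st using bl lt by (auto simp: tree_functor_def intro!: nth_equalityI)
    have a: "map2 ncmp ?ss (blocks ks xs) = map2 (\<lambda>(s, s') ys. coh_arrow s s' ((!) ys)) (zip ts us) (blocks ks xs)"
      using bl lt by (auto simp: coh_trans_def intro!: nth_equalityI)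
    have "map2 (\<lambda>s ys. ev ((!) ys) s) us (blocks ks xs) \<in> Ob (power_cat C (length ks))"
      using ev_power[OF ts(2) bl] lt by (subst power_cat_Ob) simp
    moreover have "map2 (\<lambda>(s, s') ys. coh_arrow s s' ((!) ys)) (zip ts us) (blocks ks xs) \<in> Arr (power_cat C (length ks))"
    proof -
      have "coh_arrow (ts ! i) (us ! i) ((!) (blocks ks xs ! i)) \<in> Arr C" if i: "i < length ks" for i
        using coh_arr[OF coh_arrow[OF ts[OF i]], of "(!) (blocks ks xs ! i)"] bl[OF i] ts[OF i]
        by (auto simp: tree_props power_cat_Ob)
      then show ?thesis using lt by (auto simp: power_cat_Arr)
    qed
    ultimately show ?thesis
      unfolding o a using coh_arrow_graft[OF t u xs] by (simp add: coh_trans_def tree_functor_def)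
  qed
  then show ?thesis
    unfolding End_ccomp_amap coh_trans_def[of "sum_list ks"] st
    by (intro ntrans.equality) (auto simp: st coh_trans_def[of "length ks"] tree_functor_graft t u intro!: restrict_ext)
qed

lemma tree_algebra: "tree_algebra C tree_functor coh_trans"
proof
  show "tree_functor n t \<in> functors (power_cat C n) C" if "t \<in> trees n" for n t
    using that by (rule tree_functor_functor)
  show "coh_trans n t u \<in> Hom (functor_cat (power_cat C n) C) (tree_functor n t) (tree_functor n u)"
    if "t \<in> trees n" "u \<in> trees n" for n t u
    using that by (rule coh_trans_natural)
  show "coh_trans n t t = Idn (functor_cat (power_cat C n) C) (tree_functor n t)" if "t \<in> trees n" for n t
    using coh_arrow_eq[OF coh_id that] that
    by (auto simp: coh_trans_def functor_cat_def tree_functor_def tree_props intro!: restrict_ext)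
  show "Cmp (functor_cat (power_cat C n) C) (coh_trans n u v) (coh_trans n t u) = coh_trans n t v"
    if t: "t \<in> trees n" and u: "u \<in> trees n" and v: "v \<in> trees n" for n t u v
    using coh_arrow_eq[OF coh_comp[OF coh_arrow[OF t u] coh_arrow[OF u v]] t]
    by (auto simp: coh_trans_def functor_cat_def intro!: restrict_ext)
  show "tree_functor 1 (Leaf 0) = cunit (End_operad C)"
    by (auto simp: tree_functor_def End_cunit power_cat_Ob power_cat_Arr intro!: restrict_ext hd_conv_nth[symmetric])
qed (fact tree_functor_act coh_trans_act tree_functor_graft coh_trans_graft)+

end

text \<open>The arities 1 and 2 occur as literals from here on; 1 must not be rewritten to \<open>Suc 0\<close>.\<close>

declare One_nat_def [simp del]

text \<open>The four pairs of trees are the ends of \<open>\<delta>\<^sub>1, \<dots>, \<delta>\<^sub>4\<close>.\<close>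

definition structure_of ::
  "('o, 'a) category \<Rightarrow> (nat \<Rightarrow> cmon_tree \<Rightarrow> ('o list, 'a list, 'o, 'a) ftor) \<Rightarrow>
   (nat \<Rightarrow> cmon_tree \<Rightarrow> cmon_tree \<Rightarrow> ('o list, 'a list, 'o, 'a) ntrans) \<Rightarrow> ('o, 'a) sym_mon" where
  "structure_of C T M = sym_mon_of C (T 2 (Leaf 0 \<odot> Leaf 1)) (T 0 \<epsilon>)
     (M 3 (Leaf 0 \<odot> Leaf 1 \<odot> Leaf 2) ((Leaf 0 \<odot> Leaf 1) \<odot> Leaf 2))
     (M 1 (\<epsilon> \<odot> Leaf 0) (Leaf 0)) (M 1 (Leaf 0 \<odot> \<epsilon>) (Leaf 0)) (M 2 (Leaf 1 \<odot> Leaf 0) (Leaf 0 \<odot> Leaf 1))"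

lemma small_trees [simp]:
  "Leaf 0 \<in> trees 1" "\<epsilon> \<in> trees 0" "Leaf 0 \<odot> Leaf 1 \<in> trees 2" "Leaf 1 \<odot> Leaf 0 \<in> trees 2"
  "\<epsilon> \<odot> Leaf 0 \<in> trees 1" "Leaf 0 \<odot> \<epsilon> \<in> trees 1"
  "Leaf 0 \<odot> Leaf 1 \<odot> Leaf 2 \<in> trees 3" "(Leaf 0 \<odot> Leaf 1) \<odot> Leaf 2 \<in> trees 3"
  by (auto simp: free_ops_iff)

lemma nat_less_cases: "(\<forall>i<Suc 0. P i) \<longleftrightarrow> P 0" "(\<forall>i<2. P i) \<longleftrightarrow> P 0 \<and> P 1" "(\<forall>i<3. P i) \<longleftrightarrow> P 0 \<and> P 1 \<and> P 2"
  for P :: "nat \<Rightarrow> bool"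
  by (auto simp: less_Suc_eq numeral_2_eq_2 numeral_3_eq_3 One_nat_def)

lemma power_cat_small:
  "[] \<in> Ob (power_cat C 0)" "[A] \<in> Ob (power_cat C 1) \<longleftrightarrow> A \<in> Ob C"
  "[A, B] \<in> Ob (power_cat C 2) \<longleftrightarrow> A \<in> Ob C \<and> B \<in> Ob C"
  "[A, B, D] \<in> Ob (power_cat C 3) \<longleftrightarrow> A \<in> Ob C \<and> B \<in> Ob C \<and> D \<in> Ob C"
  "[] \<in> Arr (power_cat C 0)" "[f] \<in> Arr (power_cat C 1) \<longleftrightarrow> f \<in> Arr C"
  "[f, g] \<in> Arr (power_cat C 2) \<longleftrightarrow> f \<in> Arr C \<and> g \<in> Arr C"
  "[f, g, h] \<in> Arr (power_cat C 3) \<longleftrightarrow> f \<in> Arr C \<and> g \<in> Arr C \<and> h \<in> Arr C"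
  by (simp_all add: power_cat_Ob power_cat_Arr nat_less_cases)

lemma (in sym_mon_cat) structure_of_tree_algebra: "structure_of C tree_functor coh_trans = S"
proof (rule sym_mon.equality)
  let ?S = "structure_of C tree_functor coh_trans"
  have ext: "omap (tensor S) \<in> extensional (Ob C \<times> Ob C)" "amap (tensor S) \<in> extensional (Arr C \<times> Arr C)"
    "assoc S \<in> extensional (Ob C \<times> Ob C \<times> Ob C)" "lunit S \<in> extensional (Ob C)" "runit S \<in> extensional (Ob C)"
    "symm S \<in> extensional (Ob C \<times> Ob C)"
    using tensor_functor structure_natural_iso by (auto simp: functors_def is_natural_iso_def is_natural_def prod_cat_def)
  show "tensor ?S = tensor S"
  proof (rule ftor.equality)
    show "omap (tensor ?S) = omap (tensor S)"
      by (rule extensionalityI[OF _ ext(1)]) (auto simp: structure_of_def sym_mon_of_def tree_functor_def power_cat_small)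
    show "amap (tensor ?S) = amap (tensor S)"
      by (rule extensionalityI[OF _ ext(2)]) (auto simp: structure_of_def sym_mon_of_def tree_functor_def power_cat_small)
  qed simp
  show "unit_ob ?S = I" by (simp add: structure_of_def sym_mon_of_def tree_functor_def power_cat_small)
  have c: "coh_arrow t u ((!) xs) = a ((!) xs)" if "coh t u a" "t \<in> trees n" "xs \<in> Ob (power_cat C n)" for t u a n xs
    using that by (rule coh_arrow_eq)
  show "assoc ?S = assoc S"
    using c[OF coh_assoc[of "Leaf 0" "Leaf 1" "Leaf 2"] small_trees(7)]
    by (intro extensionalityI[OF _ ext(3)]) (auto simp: structure_of_def sym_mon_of_def coh_trans_def power_cat_small)
  show "lunit ?S = lunit S"
    using c[OF coh_lunit[of "Leaf 0"] small_trees(5)]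
    by (intro extensionalityI[OF _ ext(4)]) (auto simp: structure_of_def sym_mon_of_def coh_trans_def power_cat_small)
  show "runit ?S = runit S"
    using c[OF coh_runit[of "Leaf 0"] small_trees(6)]
    by (intro extensionalityI[OF _ ext(5)]) (auto simp: structure_of_def sym_mon_of_def coh_trans_def power_cat_small)
  show "symm ?S = symm S"
    using c[OF coh_symm[of "Leaf 0" "Leaf 1"] small_trees(4)]
    by (intro extensionalityI[OF _ ext(6)]) (auto simp: structure_of_def sym_mon_of_def coh_trans_def power_cat_small)
qed simp

section \<open>Tree algebras are symmetric monoidal categories\<close>

lemma relabel_trees:
  assumes "wf_tree t" "distinct (leaves t)" "bij_betw \<pi> (set (leaves t)) {..<n}"
  shows "relabel \<pi> t \<in> trees n"
  using assms by (auto simp: free_ops_iff wf_relabel leaves_relabel distinct_map bij_betw_def)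

text \<open>The leaves of an instance of \<open>\<alpha>\<close>, say, are distributed over its three arguments in an arbitrary
  way, whereas operadic composition numbers them blockwise. The permutation \<open>\<sigma>\<close> mediates between the two numberings;
  \<open>\<iota> i\<close> numbers the leaves of the \<open>i\<close>-th argument by their positions.\<close>

lemma split_labels:
  assumes d: "distinct (concat ls)" and \<pi>: "bij_betw \<pi> (set (concat ls)) {..<n}"
  obtains \<sigma> \<iota> where "\<sigma> permutes {..<n}" "sum_list (map length ls) = n"
    "\<And>i. i < length ls \<Longrightarrow> bij_betw (\<iota> i) (set (ls ! i)) {..<length (ls ! i)}"
    "\<And>i v. \<lbrakk>i < length ls; v \<in> set (ls ! i)\<rbrakk> \<Longrightarrow> \<sigma> (block_start (map length ls) i + \<iota> i v) = \<pi> v"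
proof
  let ?\<sigma> = "perm_of_list (map \<pi> (concat ls))"
  let ?\<iota> = "\<lambda>i. inv_into {..<length (ls ! i)} ((!) (ls ! i))"
  let ?ks = "map length ls"
  show "?\<sigma> permutes {..<n}"
    using d \<pi> by (intro perm_of_list_permutes) (auto simp: distinct_map bij_betw_def)
  have len: "length (concat ls) = sum_list ?ks" by (rule length_concat_block) simp
  then show "sum_list ?ks = n"
    using distinct_card[OF d] bij_betw_same_card[OF \<pi>] by simp
  have b: "bij_betw ((!) (ls ! i)) {..<length (ls ! i)} (set (ls ! i))" if "i < length ls" for i
  proof (rule bij_betw_nth)
    show "distinct (ls ! i)" using d that by (auto simp: distinct_concat_iff)
  qed simp_all
  show "bij_betw (?\<iota> i) (set (ls ! i)) {..<length (ls ! i)}" if "i < length ls" for i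
    by (rule bij_betw_inv_into[OF b[OF that]])
  fix i v assume i: "i < length ls" and v: "v \<in> set (ls ! i)"
  have j: "?\<iota> i v < length (ls ! i)" "ls ! i ! ?\<iota> i v = v"
    using bij_betwE[OF bij_betw_inv_into[OF b[OF i]]] bij_betw_inv_into_right[OF b[OF i]] v by auto
  have "concat ls ! (block_start ?ks i + ?\<iota> i v) = v"
    using nth_concat_block[of ls ?ks i "?\<iota> i v"] i j by simp
  moreover have "block_start ?ks i + ?\<iota> i v < length (concat ls)"
    unfolding len using i j by (intro block_start_bound) simp_all
  ultimately show "?\<sigma> (block_start ?ks i + ?\<iota> i v) = \<pi> v"
    by (simp add: perm_of_list_def)
qed

lemma graft_opcomp_relabel:
  assumes "s \<in> trees (length ks)" "length us = length ks"
    "\<And>i v. \<lbrakk>i < length ks; v \<in> set (leaves (us ! i))\<rbrakk> \<Longrightarrow> \<sigma> (block_start ks i + \<iota> i v) = \<pi> v"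
  shows "relabel \<pi> (graft ((!) us) s)
    = relabel \<sigma> (opcomp free_cmon ks s (map2 (\<lambda>i. relabel (\<iota> i)) [0..<length us] us))"
  unfolding free_opcomp relabel_graft relabel_relabel
  using assms tree_props(3)[OF assms(1)]
  by (auto simp: relabel_relabel intro!: graft_cong relabel_cong)

context tree_algebra begin

sublocale sym_mon_ops C "structure_of C T M" ..

notation tens (infixr "\<otimes>" 70) and tensa (infixr "\<star>" 70)

abbreviation "S \<equiv> structure_of C T M"
abbreviation "dot_tree \<equiv> Leaf 0 \<odot> Leaf 1"

lemma T_is_functor: "t \<in> trees n \<Longrightarrow> is_functor (power_cat C n) C (T n t)"
  using T_functor[of t n] by (simp add: functors_def)

lemma T_ext: "t \<in> trees n \<Longrightarrow> omap (T n t) \<in> extensional (Ob (power_cat C n))"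
  "t \<in> trees n \<Longrightarrow> amap (T n t) \<in> extensional (Arr (power_cat C n))"
  using T_functor[of t n] by (simp_all add: functors_def)

lemma T_ob: "\<lbrakk>t \<in> trees n; xs \<in> Ob (power_cat C n)\<rbrakk> \<Longrightarrow> omap (T n t) xs \<in> Ob C"
  by (rule functor_ob[OF T_is_functor])

lemma T_id: "\<lbrakk>t \<in> trees n; xs \<in> Ob (power_cat C n)\<rbrakk> \<Longrightarrow> amap (T n t) (map (Idn C) xs) = one (omap (T n t) xs)"
  using functor_id[OF T_is_functor, of t n xs] by (simp add: power_cat_Ob power_cat_ops)

lemma T_arr:
  assumes "t \<in> trees n" "fs \<in> Arr (power_cat C n)"
  shows "amap (T n t) fs \<in> Arr C" "Dom C (amap (T n t) fs) = omap (T n t) (map (Dom C) fs)"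
    "Cod C (amap (T n t) fs) = omap (T n t) (map (Cod C) fs)"
  using T_is_functor[OF assms(1)] assms(2) by (auto simp: is_functor_def Hom_def power_cat_Arr power_cat_ops)

lemma M_props:
  assumes "t \<in> trees n" "u \<in> trees n"
  shows "nsrc (M n t u) = T n t" "ntgt (M n t u) = T n u" "is_natural (power_cat C n) C (T n t) (T n u) (ncmp (M n t u))"
  using M_hom[OF assms] by (auto simp: Hom_def functor_cat_def)

lemma M_arr:
  assumes "t \<in> trees n" "u \<in> trees n" "xs \<in> Ob (power_cat C n)"
  shows "ncmp (M n t u) xs \<in> Arr C" "Dom C (ncmp (M n t u) xs) = omap (T n t) xs" "Cod C (ncmp (M n t u) xs) = omap (T n u) xs"
  using M_props(3)[OF assms(1,2)] assms(3) by (auto simp: is_natural_def Hom_def)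

lemma M_natural:
  assumes "t \<in> trees n" "u \<in> trees n" "fs \<in> Arr (power_cat C n)"
  shows "ncmp (M n t u) (map (Cod C) fs) \<cdot> amap (T n t) fs = amap (T n u) fs \<cdot> ncmp (M n t u) (map (Dom C) fs)"
  using M_props(3)[OF assms(1,2)] assms(3) by (auto simp: is_natural_def power_cat_Arr power_cat_ops)

lemma ncmp_M_id: "\<lbrakk>t \<in> trees n; xs \<in> Ob (power_cat C n)\<rbrakk> \<Longrightarrow> ncmp (M n t t) xs = one (omap (T n t) xs)"
  by (simp add: M_id functor_cat_def)

lemma ncmp_M_comp:
  assumes "t \<in> trees n" "u \<in> trees n" "v \<in> trees n" "xs \<in> Ob (power_cat C n)"
  shows "ncmp (M n u v) xs \<cdot> ncmp (M n t u) xs = ncmp (M n t v) xs"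
  using arg_cong[OF M_comp[OF assms(1-3)], of "\<lambda>m. ncmp m xs"] assms(4) by (simp add: functor_cat_def)

lemma M_inverse:
  assumes "t \<in> trees n" "u \<in> trees n" "xs \<in> Ob (power_cat C n)"
  shows "is_iso C (ncmp (M n t u) xs)" "inva (ncmp (M n t u) xs) = ncmp (M n u t) xs"
  using M_arr[OF assms] M_arr[OF assms(2,1,3)] ncmp_M_comp[OF assms(1,2,1,3)] ncmp_M_comp[OF assms(2,1,2,3)]
    ncmp_M_id[OF assms(1,3)] ncmp_M_id[OF assms(2,3)]
  by (auto intro!: isoI[of _ "ncmp (M n u t) xs"] arr_inv_eq simp: Hom_def)

lemma tensor_T: "\<lbrakk>A \<in> Ob C; B \<in> Ob C\<rbrakk> \<Longrightarrow> A \<otimes> B = omap (T 2 dot_tree) [A, B]"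
    "\<lbrakk>f \<in> Arr C; g \<in> Arr C\<rbrakk> \<Longrightarrow> f \<star> g = amap (T 2 dot_tree) [f, g]"
  by (simp_all add: structure_of_def sym_mon_of_def)

lemma tensor_ob: "\<lbrakk>A \<in> Ob C; B \<in> Ob C\<rbrakk> \<Longrightarrow> A \<otimes> B \<in> Ob C"
  by (simp add: tensor_T T_ob power_cat_small)

lemma unit_ob_T: "I = omap (T 0 \<epsilon>) []" by (simp add: structure_of_def sym_mon_of_def)

lemma unit_ob_ob: "I \<in> Ob C" by (simp add: unit_ob_T T_ob power_cat_small)

lemma tensor_arr:
  assumes "f \<in> Arr C" "g \<in> Arr C"
  shows "f \<star> g \<in> Arr C" "Dom C (f \<star> g) = Dom C f \<otimes> Dom C g" "Cod C (f \<star> g) = Cod C f \<otimes> Cod C g"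
  using T_arr[OF small_trees(3), of "[f, g]"] assms by (simp_all add: tensor_T power_cat_small)

lemma ev_in_Ob: "wf_tree t \<Longrightarrow> (\<And>v. v \<in> set (leaves t) \<Longrightarrow> x v \<in> Ob C) \<Longrightarrow> ev x t \<in> Ob C"
  by (induction t rule: wf_tree_induct) (simp_all add: tensor_ob unit_ob_ob)

lemma eva_in_Arr: "wf_tree t \<Longrightarrow> (\<And>v. v \<in> set (leaves t) \<Longrightarrow> x v \<in> Arr C) \<Longrightarrow> eva x t \<in> Arr C"
  by (induction t rule: wf_tree_induct) (simp_all add: tensor_arr unit_ob_ob)

text \<open>Equivariance and the composition law of a tree algebra, combined for a shape \<open>s\<close> with arguments
  \<open>us\<close> whose labels are arbitrary but distinct.\<close>

lemma T_pieces:
  assumes s: "s \<in> trees (length us)" and us: "\<And>i. i < length us \<Longrightarrow> wf_tree (us ! i)"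
    and d: "distinct (concat (map leaves us))" and \<pi>: "bij_betw \<pi> (set (concat (map leaves us))) {..<n}"
  shows "(\<And>i k \<rho> ys. \<lbrakk>i < length us; bij_betw \<rho> (set (leaves (us ! i))) {..<k}; ys \<in> Ob (power_cat C k);
        \<And>v. v \<in> set (leaves (us ! i)) \<Longrightarrow> ys ! \<rho> v = x v\<rbrakk> \<Longrightarrow> omap (T k (relabel \<rho> (us ! i))) ys = ev x (us ! i)) \<Longrightarrow>
      xs \<in> Ob (power_cat C n) \<Longrightarrow> (\<And>v. v \<in> set (concat (map leaves us)) \<Longrightarrow> xs ! \<pi> v = x v) \<Longrightarrow>
      omap (T n (relabel \<pi> (graft ((!) us) s))) xs = omap (T (length us) s) (map (ev x) us)"
    and "(\<And>i k \<rho> ys. \<lbrakk>i < length us; bij_betw \<rho> (set (leaves (us ! i))) {..<k}; ys \<in> Arr (power_cat C k);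
        \<And>v. v \<in> set (leaves (us ! i)) \<Longrightarrow> ys ! \<rho> v = y v\<rbrakk> \<Longrightarrow> amap (T k (relabel \<rho> (us ! i))) ys = eva y (us ! i)) \<Longrightarrow>
      fs \<in> Arr (power_cat C n) \<Longrightarrow> (\<And>v. v \<in> set (concat (map leaves us)) \<Longrightarrow> fs ! \<pi> v = y v) \<Longrightarrow>
      amap (T n (relabel \<pi> (graft ((!) us) s))) fs = amap (T (length us) s) (map (eva y) us)"
proof -
  let ?ls = "map leaves us"
  let ?ks = "map length ?ls"
  obtain \<sigma> \<iota> where \<sigma>: "\<sigma> permutes {..<n}" and n: "sum_list ?ks = n"
    and \<iota>: "\<And>i. i < length ?ls \<Longrightarrow> bij_betw (\<iota> i) (set (?ls ! i)) {..<length (?ls ! i)}"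
    and \<sigma>\<iota>: "\<And>i v. \<lbrakk>i < length ?ls; v \<in> set (?ls ! i)\<rbrakk> \<Longrightarrow> \<sigma> (block_start ?ks i + \<iota> i v) = \<pi> v"
    by (rule split_labels[OF d \<pi>]) (rule that)
  let ?us = "map2 (\<lambda>i. relabel (\<iota> i)) [0..<length us] us"
  have s': "s \<in> trees (length ?ks)" using s by simp
  have g: "relabel \<pi> (graft ((!) us) s) = relabel \<sigma> (opcomp free_cmon ?ks s ?us)"
    using \<sigma>\<iota> s' by (intro graft_opcomp_relabel) auto
  have di: "distinct (leaves (us ! i))" if "i < length us" for i
    using d that by (auto simp: distinct_concat_iff)
  have usp: "?us \<in> list_prod (map trees ?ks)"
    using \<iota> us di by (auto simp: in_list_prod_iff intro!: relabel_trees)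
  have T: "T n (relabel \<pi> (graft ((!) us) s)) = omap (cact (End_operad C) n \<sigma>)
      (omap (ccomp (End_operad C) ?ks) (T (length us) s, map2 T ?ks ?us))"
    unfolding g using T_act[OF \<sigma>] T_graft[OF s' usp] free_cmon.comp_closed[OF s' usp] n by simp
  have lt: "block_start ?ks i + \<iota> i v < n" if "i < length us" "v \<in> set (leaves (us ! i))" for i v
    using block_start_bound[of i ?ks "\<iota> i v"] bij_betwE[OF \<iota>, of i] that n by simp
  have bl: "blocks ?ks (permute_list \<sigma> xs) ! i ! \<iota> i v = xs ! \<pi> v"
    if "length xs = n" "i < length us" "v \<in> set (leaves (us ! i))" for i v and xs :: "'o list"
    using that \<sigma>\<iota>[of i v] lt[of i v] bij_betwE[OF \<iota>, of i] \<sigma> n by (simp add: nth_blocks permute_list_nth)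
  have bl': "blocks ?ks (permute_list \<sigma> xs) ! i ! \<iota> i v = xs ! \<pi> v"
    if "length xs = n" "i < length us" "v \<in> set (leaves (us ! i))" for i v and xs :: "'a list"
    using that \<sigma>\<iota>[of i v] lt[of i v] bij_betwE[OF \<iota>, of i] \<sigma> n by (simp add: nth_blocks permute_list_nth)
  {
    assume IH: "\<And>i k \<rho> ys. \<lbrakk>i < length us; bij_betw \<rho> (set (leaves (us ! i))) {..<k}; ys \<in> Ob (power_cat C k);
        \<And>v. v \<in> set (leaves (us ! i)) \<Longrightarrow> ys ! \<rho> v = x v\<rbrakk> \<Longrightarrow> omap (T k (relabel \<rho> (us ! i))) ys = ev x (us ! i)"
      and xs: "xs \<in> Ob (power_cat C n)" and x: "\<And>v. v \<in> set (concat (map leaves us)) \<Longrightarrow> xs ! \<pi> v = x v"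
    have p: "permute_list \<sigma> xs \<in> Ob (power_cat C (sum_list ?ks))" using power_permute(1)[OF \<sigma> xs] n by simp
    have "map2 omap (map2 T ?ks ?us) (blocks ?ks (permute_list \<sigma> xs)) = map (ev x) us"
    proof (rule nth_equalityI)
      fix i assume "i < length (map2 omap (map2 T ?ks ?us) (blocks ?ks (permute_list \<sigma> xs)))"
      then have i: "i < length us" by simp
      have "omap (T (length (leaves (us ! i))) (relabel (\<iota> i) (us ! i))) (blocks ?ks (permute_list \<sigma> xs) ! i) = ev x (us ! i)"
      proof (rule IH[OF i])
        show "bij_betw (\<iota> i) (set (leaves (us ! i))) {..<length (leaves (us ! i))}" using \<iota>[of i] i by simp
        show "blocks ?ks (permute_list \<sigma> xs) ! i \<in> Ob (power_cat C (length (leaves (us ! i))))"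
          using blocks_power(1)[OF _ p, of i] i by simp
        fix v assume v: "v \<in> set (leaves (us ! i))"
        then have "xs ! \<pi> v = x v" using i by (intro x) auto
        then show "blocks ?ks (permute_list \<sigma> xs) ! i ! \<iota> i v = x v"
          using bl[OF _ i v] xs unfolding power_cat_Ob by simp
      qed
      then show "map2 omap (map2 T ?ks ?us) (blocks ?ks (permute_list \<sigma> xs)) ! i = map (ev x) us ! i"
        using i by simp
    qed simp
    then show "omap (T n (relabel \<pi> (graft ((!) us) s))) xs = omap (T (length us) s) (map (ev x) us)"
      unfolding T End_cact_omap End_ccomp_omap using xs p by simp
  next
    assume IH: "\<And>i k \<rho> ys. \<lbrakk>i < length us; bij_betw \<rho> (set (leaves (us ! i))) {..<k}; ys \<in> Arr (power_cat C k);
        \<And>v. v \<in> set (leaves (us ! i)) \<Longrightarrow> ys ! \<rho> v = y v\<rbrakk> \<Longrightarrow> amap (T k (relabel \<rho> (us ! i))) ys = eva y (us ! i)"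
      and xs: "fs \<in> Arr (power_cat C n)" and x: "\<And>v. v \<in> set (concat (map leaves us)) \<Longrightarrow> fs ! \<pi> v = y v"
    have p: "permute_list \<sigma> fs \<in> Arr (power_cat C (sum_list ?ks))" using power_permute(2)[OF \<sigma> xs] n by simp
    have "map2 amap (map2 T ?ks ?us) (blocks ?ks (permute_list \<sigma> fs)) = map (eva y) us"
    proof (rule nth_equalityI)
      fix i assume "i < length (map2 amap (map2 T ?ks ?us) (blocks ?ks (permute_list \<sigma> fs)))"
      then have i: "i < length us" by simp
      have "amap (T (length (leaves (us ! i))) (relabel (\<iota> i) (us ! i))) (blocks ?ks (permute_list \<sigma> fs) ! i) = eva y (us ! i)"
      proof (rule IH[OF i])
        show "bij_betw (\<iota> i) (set (leaves (us ! i))) {..<length (leaves (us ! i))}" using \<iota>[of i] i by simp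
        show "blocks ?ks (permute_list \<sigma> fs) ! i \<in> Arr (power_cat C (length (leaves (us ! i))))"
          using blocks_power(2)[OF _ p, of i] i by simp
        fix v assume v: "v \<in> set (leaves (us ! i))"
        then have "fs ! \<pi> v = y v" using i by (intro x) auto
        then show "blocks ?ks (permute_list \<sigma> fs) ! i ! \<iota> i v = y v"
          using bl'[OF _ i v] xs unfolding power_cat_Arr by simp
      qed
      then show "map2 amap (map2 T ?ks ?us) (blocks ?ks (permute_list \<sigma> fs)) ! i = map (eva y) us ! i"
        using i by simp
    qed simp
    then show "amap (T n (relabel \<pi> (graft ((!) us) s))) fs = amap (T (length us) s) (map (eva y) us)"
      unfolding T End_cact_omap End_ccomp_omap using xs p by simp
  }
qed

end

lemma bij_betw_singleton_lessThan: "bij_betw \<pi> {a} {..<n} \<Longrightarrow> n = 1 \<and> \<pi> a = (0::nat)"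
  using bij_betw_same_card[of \<pi> "{a}" "{..<n}"] bij_betwE[of \<pi> "{a}" "{..<n}"] by simp

lemma bij_betw_empty_lessThan: "bij_betw \<pi> {} {..<n} \<Longrightarrow> n = (0::nat)"
  using bij_betw_same_card[of \<pi> "{}" "{..<n}"] by simp

context tree_algebra begin

lemma omap_T:
  "wf_tree t \<Longrightarrow> distinct (leaves t) \<Longrightarrow> bij_betw \<pi> (set (leaves t)) {..<n} \<Longrightarrow> xs \<in> Ob (power_cat C n) \<Longrightarrow>
   (\<And>v. v \<in> set (leaves t) \<Longrightarrow> xs ! \<pi> v = x v) \<Longrightarrow> omap (T n (relabel \<pi> t)) xs = ev x t"
proof (induction t arbitrary: \<pi> n xs rule: wf_tree_induct)
  case (Leaf a \<pi> n xs)
  have n: "n = 1" "\<pi> a = 0" using bij_betw_singleton_lessThan[of \<pi> a n] Leaf by auto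
  have "hd xs = xs ! 0" using Leaf(3) n by (intro hd_conv_nth) (auto simp: power_cat_Ob)
  then show ?case using Leaf(3,4) n T_unit by (simp add: relabel_def End_cunit)
next
  case (unit \<pi> n xs)
  then have "n = 0" using bij_betw_empty_lessThan by simp
  then show ?case using unit by (simp add: relabel_def unit_ob_T power_cat_Ob)
next
  case (tens t u \<pi> n xs)
  have wf: "wf_tree ([t, u] ! i)" if "i < length [t, u]" for i using that tens.hyps by (cases i) auto
  have "omap (T n (relabel \<pi> (graft ((!) [t, u]) dot_tree))) xs = omap (T (length [t, u]) dot_tree) (map (ev x) [t, u])"
  proof (rule T_pieces(1)[OF _ wf])
    show "omap (T k (relabel \<rho> ([t, u] ! i))) ys = ev x ([t, u] ! i)"
      if "i < length [t, u]" "bij_betw \<rho> (set (leaves ([t, u] ! i))) {..<k}" "ys \<in> Ob (power_cat C k)"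
        "\<And>v. v \<in> set (leaves ([t, u] ! i)) \<Longrightarrow> ys ! \<rho> v = x v" for i k \<rho> ys
      using that tens.IH(1)[of \<rho> k ys] tens.IH(2)[of \<rho> k ys] tens.prems(1)
      by (cases "i = 0") (auto simp: less_Suc_eq One_nat_def)
  qed (use tens.prems in \<open>auto simp flip: numeral_2_eq_2\<close>)
  moreover have "ev x t \<in> Ob C" "ev x u \<in> Ob C"
  proof -
    have "x v \<in> Ob C" if "v \<in> set (leaves (t \<odot> u))" for v
      using tens.prems(4)[OF that] tens.prems(3) bij_betwE[OF tens.prems(2)] that by (auto simp: power_cat_Ob)
    then show "ev x t \<in> Ob C" "ev x u \<in> Ob C" using tens.hyps by (auto intro!: ev_in_Ob)
  qed
  ultimately show ?case by (simp add: tensor_T One_nat_def numeral_2_eq_2)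
qed

lemma amap_T:
  "wf_tree t \<Longrightarrow> distinct (leaves t) \<Longrightarrow> bij_betw \<pi> (set (leaves t)) {..<n} \<Longrightarrow> fs \<in> Arr (power_cat C n) \<Longrightarrow>
   (\<And>v. v \<in> set (leaves t) \<Longrightarrow> fs ! \<pi> v = f v) \<Longrightarrow> amap (T n (relabel \<pi> t)) fs = eva f t"
proof (induction t arbitrary: \<pi> n fs rule: wf_tree_induct)
  case (Leaf a \<pi> n fs)
  have n: "n = 1" "\<pi> a = 0" using bij_betw_singleton_lessThan[of \<pi> a n] Leaf by auto
  have "hd fs = fs ! 0" using Leaf(3) n by (intro hd_conv_nth) (auto simp: power_cat_Arr)
  then show ?case using Leaf(3,4) n T_unit by (simp add: relabel_def End_cunit)
next
  case (unit \<pi> n fs)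
  then have "n = 0" using bij_betw_empty_lessThan by simp
  then show ?case using unit T_id[of \<epsilon> 0 "[]"] by (simp add: relabel_def unit_ob_T power_cat_Arr power_cat_small)
next
  case (tens t u \<pi> n fs)
  have wf: "wf_tree ([t, u] ! i)" if "i < length [t, u]" for i using that tens.hyps by (cases i) auto
  have "amap (T n (relabel \<pi> (graft ((!) [t, u]) dot_tree))) fs = amap (T (length [t, u]) dot_tree) (map (eva f) [t, u])"
  proof (rule T_pieces(2)[OF _ wf])
    show "amap (T k (relabel \<rho> ([t, u] ! i))) ys = eva f ([t, u] ! i)"
      if "i < length [t, u]" "bij_betw \<rho> (set (leaves ([t, u] ! i))) {..<k}" "ys \<in> Arr (power_cat C k)"
        "\<And>v. v \<in> set (leaves ([t, u] ! i)) \<Longrightarrow> ys ! \<rho> v = f v" for i k \<rho> ys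
      using that tens.IH(1)[of \<rho> k ys] tens.IH(2)[of \<rho> k ys] tens.prems(1)
      by (cases "i = 0") (auto simp: less_Suc_eq One_nat_def)
  qed (use tens.prems in \<open>auto simp flip: numeral_2_eq_2\<close>)
  moreover have "eva f t \<in> Arr C" "eva f u \<in> Arr C"
  proof -
    have "f v \<in> Arr C" if "v \<in> set (leaves (t \<odot> u))" for v
      using tens.prems(4)[OF that] tens.prems(3) bij_betwE[OF tens.prems(2)] that by (auto simp: power_cat_Arr)
    then show "eva f t \<in> Arr C" "eva f u \<in> Arr C" using tens.hyps by (auto intro!: eva_in_Arr)
  qed
  ultimately show ?case by (simp add: tensor_T One_nat_def numeral_2_eq_2)
qed

text \<open>The quantification over the numberings \<open>\<pi>\<close> makes the notion applicable to subtrees, whose leaves are not numbered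
  consecutively.\<close>

definition represents :: "cmon_tree \<Rightarrow> cmon_tree \<Rightarrow> ((nat \<Rightarrow> 'o) \<Rightarrow> 'a) \<Rightarrow> bool" where
  "represents t u a \<longleftrightarrow> (\<forall>n \<pi> xs x. bij_betw \<pi> (set (leaves t)) {..<n} \<longrightarrow> xs \<in> Ob (power_cat C n) \<longrightarrow>
     (\<forall>v\<in>set (leaves t). xs ! \<pi> v = x v) \<longrightarrow> ncmp (M n (relabel \<pi> t) (relabel \<pi> u)) xs = a x)"

lemma represents_pieces:
  assumes s: "s \<in> trees (length ts)" "s' \<in> trees (length ts)" and len: "length us = length ts"
    and wf: "\<And>i. i < length ts \<Longrightarrow> wf_tree (ts ! i)" "\<And>i. i < length ts \<Longrightarrow> wf_tree (us ! i)"
    and lv: "\<And>i. i < length ts \<Longrightarrow> set (leaves (us ! i)) = set (leaves (ts ! i))"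
      "\<And>i. i < length ts \<Longrightarrow> distinct (leaves (us ! i))"
    and d: "distinct (concat (map leaves ts))"
    and a: "\<And>i. i < length ts \<Longrightarrow> represents (ts ! i) (us ! i) (a i)"
  shows "represents (graft ((!) ts) s) (graft ((!) us) s')
    (\<lambda>x. ncmp (M (length ts) s s') (map (ev x) us) \<cdot> amap (T (length ts) s) (map (\<lambda>i. a i x) [0..<length ts]))"
  unfolding represents_def
proof (intro allI impI)
  fix n \<pi> xs x
  assume "bij_betw \<pi> (set (leaves (graft ((!) ts) s))) {..<n}" and xs: "xs \<in> Ob (power_cat C n)"
    and x0: "\<forall>v\<in>set (leaves (graft ((!) ts) s)). xs ! \<pi> v = x v"
  moreover have sl: "set (leaves (graft ((!) ts) s)) = set (concat (map leaves ts))"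
  proof -
    have "set ts = (!) ts ` {..<length ts}" by (auto simp: set_conv_nth)
    then show ?thesis by (auto simp: leaves_graft tree_props(3)[OF s(1)])
  qed
  ultimately have \<pi>: "bij_betw \<pi> (set (concat (map leaves ts))) {..<n}" by simp
  have x: "xs ! \<pi> v = x v" if "i < length ts" "v \<in> set (leaves (ts ! i))" for v i
    using x0 that unfolding sl by auto
  let ?ls = "map leaves ts"
  let ?ks = "map length ?ls"
  obtain \<sigma> \<iota> where \<sigma>: "\<sigma> permutes {..<n}" and n: "sum_list ?ks = n"
    and \<iota>: "\<And>i. i < length ?ls \<Longrightarrow> bij_betw (\<iota> i) (set (?ls ! i)) {..<length (?ls ! i)}"
    and \<sigma>\<iota>: "\<And>i v. \<lbrakk>i < length ?ls; v \<in> set (?ls ! i)\<rbrakk> \<Longrightarrow> \<sigma> (block_start ?ks i + \<iota> i v) = \<pi> v"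
    by (rule split_labels[OF d \<pi>]) (rule that)
  let ?ts = "map2 (\<lambda>i. relabel (\<iota> i)) [0..<length ts] ts"
  let ?us = "map2 (\<lambda>i. relabel (\<iota> i)) [0..<length us] us"
  have s': "s \<in> trees (length ?ks)" "s' \<in> trees (length ?ks)" using s by simp_all
  have g: "relabel \<pi> (graft ((!) ts) s) = relabel \<sigma> (opcomp free_cmon ?ks s ?ts)"
    using \<sigma>\<iota> s'(1) by (intro graft_opcomp_relabel) auto
  have g': "relabel \<pi> (graft ((!) us) s') = relabel \<sigma> (opcomp free_cmon ?ks s' ?us)"
    using \<sigma>\<iota> s'(2) len lv by (intro graft_opcomp_relabel) auto
  have di: "distinct (leaves (ts ! i))" if "i < length ts" for i
    using d that by (auto simp: distinct_concat_iff)
  have tp: "relabel (\<iota> i) (ts ! i) \<in> trees (length (leaves (ts ! i)))"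
    "relabel (\<iota> i) (us ! i) \<in> trees (length (leaves (ts ! i)))" if "i < length ts" for i
    using that \<iota>[of i] wf di lv by (auto intro!: relabel_trees)
  have tsp: "?ts \<in> list_prod (map trees ?ks)" "?us \<in> list_prod (map trees ?ks)"
    using tp len by (auto simp: in_list_prod_iff)
  let ?ss = "map2 (\<lambda>k (t, u). M k t u) ?ks (zip ?ts ?us)"
  have M: "M n (relabel \<pi> (graft ((!) ts) s)) (relabel \<pi> (graft ((!) us) s')) = amap (cact (End_operad C) n \<sigma>)
      (amap (ccomp (End_operad C) ?ks) (M (length ts) s s', ?ss))"
    unfolding g g' using M_act[OF \<sigma>] M_graft[OF s'(1) tsp(1) s'(2) tsp(2)] free_cmon.comp_closed[OF s'(1) tsp(1)]
      free_cmon.comp_closed[OF s'(2) tsp(2)] n by simp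
  have lt: "block_start ?ks i + \<iota> i v < n" if "i < length ts" "v \<in> set (leaves (ts ! i))" for i v
    using block_start_bound[of i ?ks "\<iota> i v"] bij_betwE[OF \<iota>, of i] that n by simp
  have p: "permute_list \<sigma> xs \<in> Ob (power_cat C (sum_list ?ks))" using power_permute(1)[OF \<sigma> xs] n by simp
  let ?bs = "blocks ?ks (permute_list \<sigma> xs)"
  have bl: "?bs ! i ! \<iota> i v = x v" if "i < length ts" "v \<in> set (leaves (ts ! i))" for i v
    using that \<sigma>\<iota>[of i v] lt[of i v] bij_betwE[OF \<iota>, of i] \<sigma> n xs x[OF that] unfolding power_cat_Ob
    by (simp add: nth_blocks permute_list_nth)
  have bp: "?bs ! i \<in> Ob (power_cat C (length (leaves (ts ! i))))" if "i < length ts" for i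
    using blocks_power(1)[OF _ p, of i] that by simp
  have \<iota>': "bij_betw (\<iota> i) (set (leaves (ts ! i))) {..<length (leaves (ts ! i))}" if "i < length ts" for i
    using \<iota>[of i] that by simp
  have "map2 omap (map ntgt ?ss) ?bs = map (ev x) us"
  proof (rule nth_equalityI)
    fix i assume "i < length (map2 omap (map ntgt ?ss) ?bs)"
    then have i: "i < length ts" using len by simp
    have "omap (T (length (leaves (ts ! i))) (relabel (\<iota> i) (us ! i))) (?bs ! i) = ev x (us ! i)"
      using i wf lv \<iota>' bp bl by (intro omap_T) simp_all
    then show "map2 omap (map ntgt ?ss) ?bs ! i = map (ev x) us ! i"
      using i len M_props(2)[OF tp[OF i]] by simp
  qed (use len in simp)
  moreover have "map2 ncmp ?ss ?bs = map (\<lambda>i. a i x) [0..<length ts]"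
  proof (rule nth_equalityI)
    fix i assume "i < length (map2 ncmp ?ss ?bs)"
    then have i: "i < length ts" using len by simp
    have "ncmp (M (length (leaves (ts ! i))) (relabel (\<iota> i) (ts ! i)) (relabel (\<iota> i) (us ! i))) (?bs ! i) = a i x"
      using a[OF i, unfolded represents_def] \<iota>'[OF i] bp[OF i] bl[OF i] by blast
    then show "map2 ncmp ?ss ?bs ! i = map (\<lambda>i. a i x) [0..<length ts] ! i"
      using i len by simp
  qed (use len in simp)
  ultimately show "ncmp (M n (relabel \<pi> (graft ((!) ts) s)) (relabel \<pi> (graft ((!) us) s'))) xs
    = ncmp (M (length ts) s s') (map (ev x) us) \<cdot> amap (T (length ts) s) (map (\<lambda>i. a i x) [0..<length ts])"
    unfolding M End_cact_amap End_ccomp_amap using xs p M_props(1)[OF s] by simp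
qed

lemma represents_id:
  assumes "wf_tree t" "distinct (leaves t)"
  shows "represents t t (\<lambda>x. one (ev x t))"
  unfolding represents_def
proof (intro allI impI)
  fix n \<pi> xs x
  assume h: "bij_betw \<pi> (set (leaves t)) {..<n}" "xs \<in> Ob (power_cat C n)" "\<forall>v\<in>set (leaves t). xs ! \<pi> v = x v"
  have "relabel \<pi> t \<in> trees n" using assms h(1) by (rule relabel_trees)
  then show "ncmp (M n (relabel \<pi> t) (relabel \<pi> t)) xs = one (ev x t)"
    using omap_T[OF assms h(1,2), of x] h(2,3) by (simp add: ncmp_M_id)
qed

lemma represents_cong:
  assumes "represents t u a" "\<And>x. (\<And>v. v \<in> set (leaves t) \<Longrightarrow> x v \<in> Ob C) \<Longrightarrow> a x = b x"
  shows "represents t u b"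
  unfolding represents_def
proof (intro allI impI)
  fix n \<pi> xs x
  assume h: "bij_betw \<pi> (set (leaves t)) {..<n}" "xs \<in> Ob (power_cat C n)" "\<forall>v\<in>set (leaves t). xs ! \<pi> v = x v"
  have "x v \<in> Ob C" if "v \<in> set (leaves t)" for v
    using bij_betwE[OF h(1)] h(2,3) that by (auto simp: power_cat_Ob dest!: bspec)
  then show "ncmp (M n (relabel \<pi> t) (relabel \<pi> u)) xs = b x"
    using assms h unfolding represents_def by metis
qed

lemma represents_instance:
  assumes s: "s \<in> trees (length ts)" "s' \<in> trees (length ts)"
    and wf: "\<And>t. t \<in> set ts \<Longrightarrow> wf_tree t" and d: "distinct (concat (map leaves ts))"
  shows "represents (graft ((!) ts) s) (graft ((!) ts) s') (\<lambda>x. ncmp (M (length ts) s s') (map (ev x) ts))"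
proof (rule represents_cong)
  show "represents (graft ((!) ts) s) (graft ((!) ts) s')
    (\<lambda>x. ncmp (M (length ts) s s') (map (ev x) ts) \<cdot> amap (T (length ts) s) (map (\<lambda>i. one (ev x (ts ! i))) [0..<length ts]))"
    using s wf d by (intro represents_pieces represents_id) (auto simp: distinct_concat_iff)
  fix x assume x: "\<And>v. v \<in> set (leaves (graft ((!) ts) s)) \<Longrightarrow> x v \<in> Ob C"
  have "ev x t \<in> Ob C" if t: "t \<in> set ts" for t
  proof (rule ev_in_Ob[OF wf[OF t]])
    fix v assume "v \<in> set (leaves t)"
    then show "x v \<in> Ob C"
      using t tree_props(3)[OF s(1)] by (intro x) (auto simp: leaves_graft in_set_conv_nth)
  qed
  then have ob: "map (ev x) ts \<in> Ob (power_cat C (length ts))" by (simp add: power_cat_Ob)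
  have "map (\<lambda>i. one (ev x (ts ! i))) [0..<length ts] = map (Idn C) (map (ev x) ts)"
    by (rule nth_equalityI) simp_all
  then have "amap (T (length ts) s) (map (\<lambda>i. one (ev x (ts ! i))) [0..<length ts]) = one (omap (T (length ts) s) (map (ev x) ts))"
    using T_id[OF s(1) ob] by simp
  then show "ncmp (M (length ts) s s') (map (ev x) ts) \<cdot> amap (T (length ts) s) (map (\<lambda>i. one (ev x (ts ! i))) [0..<length ts])
     = ncmp (M (length ts) s s') (map (ev x) ts)"
    using M_arr[OF s ob] by simp
qed

end

context tree_algebra begin

lemma structure_ncmp:
  "\<lbrakk>A \<in> Ob C; B \<in> Ob C; D \<in> Ob C\<rbrakk> \<Longrightarrow>
     \<alpha> A B D = ncmp (M 3 (Leaf 0 \<odot> Leaf 1 \<odot> Leaf 2) ((Leaf 0 \<odot> Leaf 1) \<odot> Leaf 2)) [A, B, D]"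
  "A \<in> Ob C \<Longrightarrow> lunit S A = ncmp (M 1 (\<epsilon> \<odot> Leaf 0) (Leaf 0)) [A]"
  "A \<in> Ob C \<Longrightarrow> runit S A = ncmp (M 1 (Leaf 0 \<odot> \<epsilon>) (Leaf 0)) [A]"
  "\<lbrakk>A \<in> Ob C; B \<in> Ob C\<rbrakk> \<Longrightarrow> \<tau> A B = ncmp (M 2 (Leaf 1 \<odot> Leaf 0) (Leaf 0 \<odot> Leaf 1)) [A, B]"
  by (simp_all add: structure_of_def sym_mon_of_def)

lemma omap_T_ev:
  assumes "t \<in> trees n" "xs \<in> Ob (power_cat C n)"
  shows "omap (T n t) xs = ev ((!) xs) t"
  using omap_T[of t "\<lambda>v. v" n xs "(!) xs"] assms by (simp add: tree_props relabel_ident bij_betw_def inj_on_def)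

lemma amap_T_eva:
  assumes "t \<in> trees n" "fs \<in> Arr (power_cat C n)"
  shows "amap (T n t) fs = eva ((!) fs) t"
  using amap_T[of t "\<lambda>v. v" n fs "(!) fs"] assms by (simp add: tree_props relabel_ident bij_betw_def inj_on_def)

lemma represents_arr:
  assumes "represents t u a" "wf_tree t" "wf_tree u" "distinct (leaves t)" "distinct (leaves u)"
    "set (leaves u) = set (leaves t)" "\<And>v. v \<in> set (leaves t) \<Longrightarrow> x v \<in> Ob C"
  shows "a x \<in> Arr C" "Dom C (a x) = ev x t" "Cod C (a x) = ev x u"
proof -
  let ?n = "length (leaves t)"
  let ?\<pi> = "inv_into {..<?n} ((!) (leaves t))"
  let ?xs = "map x (leaves t)"
  have b: "bij_betw ((!) (leaves t)) {..<?n} (set (leaves t))" using assms(4) by (rule bij_betw_nth) simp_all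
  have \<pi>: "bij_betw ?\<pi> (set (leaves t)) {..<?n}" using b by (rule bij_betw_inv_into)
  have xs: "?xs \<in> Ob (power_cat C ?n)" using assms(7) by (simp add: power_cat_Ob)
  have x: "?xs ! ?\<pi> v = x v" if "v \<in> set (leaves t)" for v
    using bij_betwE[OF \<pi>] bij_betw_inv_into_right[OF b that] that by auto
  have tr: "relabel ?\<pi> t \<in> trees ?n" "relabel ?\<pi> u \<in> trees ?n"
    using assms \<pi> by (auto intro: relabel_trees)
  have "ncmp (M ?n (relabel ?\<pi> t) (relabel ?\<pi> u)) ?xs = a x"
    using assms(1) \<pi> xs x unfolding represents_def by blast
  moreover have "omap (T ?n (relabel ?\<pi> t)) ?xs = ev x t" "omap (T ?n (relabel ?\<pi> u)) ?xs = ev x u"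
    using assms \<pi> xs x by (auto intro!: omap_T)
  ultimately show "a x \<in> Arr C" "Dom C (a x) = ev x t" "Cod C (a x) = ev x u"
    using M_arr[OF tr xs] by simp_all
qed

text \<open>Each structure isomorphism is the value of the algebra at some pair of shapes with subtrees inserted
  (\<open>represents_instance\<close>), and tensor products are covered by \<open>represents_pieces\<close>.\<close>

lemma coh_represents: "coh t u a \<Longrightarrow> distinct (leaves t) \<Longrightarrow> represents t u a"
proof (induction rule: coh.induct)
  case (coh_id t)
  then show ?case by (rule represents_id)
next
  case (coh_comp t u a v b)
  have wf: "wf_tree t" "wf_tree u" "wf_tree v" using coh_wf coh_comp.hyps by blast+
  note l = coh_leaves[OF coh_comp.hyps(1)] coh_leaves[OF coh_comp.hyps(2)]
  have d: "distinct (leaves u)" "distinct (leaves v)" using l coh_comp.prems by simp_all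
  note r = coh_comp.IH(1)[OF coh_comp.prems] coh_comp.IH(2)[OF d(1)]
  show ?case
    unfolding represents_def
  proof (intro allI impI)
    fix n \<pi> xs x
    assume h: "bij_betw \<pi> (set (leaves t)) {..<n}" "xs \<in> Ob (power_cat C n)" "\<forall>v\<in>set (leaves t). xs ! \<pi> v = x v"
    have "relabel \<pi> t \<in> trees n" "relabel \<pi> u \<in> trees n" "relabel \<pi> v \<in> trees n"
      using wf d l coh_comp.prems h(1) by (auto intro!: relabel_trees)
    moreover have "ncmp (M n (relabel \<pi> t) (relabel \<pi> u)) xs = a x" "ncmp (M n (relabel \<pi> u) (relabel \<pi> v)) xs = b x"
      using r h l unfolding represents_def by simp_all
    ultimately show "ncmp (M n (relabel \<pi> t) (relabel \<pi> v)) xs = b x \<cdot> a x"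
      using ncmp_M_comp h(2) by metis
  qed
next
  case (coh_inv t u a)
  have wf: "wf_tree t" "wf_tree u" using coh_wf coh_inv.hyps by blast+
  note l = coh_leaves[OF coh_inv.hyps(1)]
  have d: "distinct (leaves t)" using l coh_inv.prems by simp
  show ?case
    unfolding represents_def
  proof (intro allI impI)
    fix n \<pi> xs x
    assume h: "bij_betw \<pi> (set (leaves u)) {..<n}" "xs \<in> Ob (power_cat C n)" "\<forall>v\<in>set (leaves u). xs ! \<pi> v = x v"
    have "relabel \<pi> t \<in> trees n" "relabel \<pi> u \<in> trees n"
      using wf d l coh_inv.prems h(1) by (auto intro!: relabel_trees)
    moreover have "ncmp (M n (relabel \<pi> t) (relabel \<pi> u)) xs = a x"
      using coh_inv.IH[OF d] h l unfolding represents_def by simp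
    ultimately show "ncmp (M n (relabel \<pi> u) (relabel \<pi> t)) xs = inva (a x)"
      using M_inverse(2)[of "relabel \<pi> t" n "relabel \<pi> u" xs] h(2) by simp
  qed
next
  case (coh_tens t u a t' u' a')
  have wf: "wf_tree t" "wf_tree u" "wf_tree t'" "wf_tree u'" using coh_wf coh_tens.hyps by blast+
  note l = coh_leaves[OF coh_tens.hyps(1)] coh_leaves[OF coh_tens.hyps(2)]
  have d: "distinct (leaves t)" "distinct (leaves t')" "distinct (leaves u)" "distinct (leaves u')"
    using l coh_tens.prems by simp_all
  note r = coh_tens.IH(1)[OF d(1)] coh_tens.IH(2)[OF d(2)]
  have two: "i = 0 \<or> i = 1" if "i < 2" for i :: nat using that by auto
  have dot: "dot_tree \<in> trees (length [t, t'])" "dot_tree \<in> trees (length [t, t'])" by (simp_all flip: numeral_2_eq_2)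
  have "represents (graft ((!) [t, t']) dot_tree) (graft ((!) [u, u']) dot_tree)
    (\<lambda>x. ncmp (M (length [t, t']) dot_tree dot_tree) (map (ev x) [u, u']) \<cdot>
       amap (T (length [t, t']) dot_tree) (map (\<lambda>i. (if i = 0 then a else a') x) [0..<length [t, t']]))"
    by (rule represents_pieces[OF dot])
       (use wf l d r coh_tens.prems in \<open>auto simp flip: numeral_2_eq_2 dest!: two\<close>)
  then have "represents (t \<odot> t') (u \<odot> u') (\<lambda>x. ncmp (M 2 dot_tree dot_tree) [ev x u, ev x u'] \<cdot> amap (T 2 dot_tree) [a x, a' x])"
    by (simp add: One_nat_def numeral_2_eq_2)
  then show ?case
  proof (rule represents_cong)
    fix x assume "\<And>v. v \<in> set (leaves (t \<odot> t')) \<Longrightarrow> x v \<in> Ob C"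
    then have x: "x v \<in> Ob C" if "v \<in> set (leaves s)" "s \<in> {t, t', u, u'}" for v s using that l by auto
    have ob: "ev x u \<in> Ob C" "ev x u' \<in> Ob C" using x wf by (auto intro!: ev_in_Ob)
    have a: "a x \<in> Arr C" "Cod C (a x) = ev x u" "a' x \<in> Arr C" "Cod C (a' x) = ev x u'"
      using represents_arr[OF r(1), of x] represents_arr[OF r(2), of x] wf d l x by auto
    show "ncmp (M 2 dot_tree dot_tree) [ev x u, ev x u'] \<cdot> amap (T 2 dot_tree) [a x, a' x] = a x \<star> a' x"
      using ob a tensor_arr[of "a x" "a' x"] by (simp add: ncmp_M_id power_cat_small flip: tensor_T)
  qed
next
  case (coh_assoc t u v)
  have "represents (graft ((!) [t, u, v]) (Leaf 0 \<odot> Leaf 1 \<odot> Leaf 2)) (graft ((!) [t, u, v]) ((Leaf 0 \<odot> Leaf 1) \<odot> Leaf 2))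
     (\<lambda>x. ncmp (M (length [t, u, v]) (Leaf 0 \<odot> Leaf 1 \<odot> Leaf 2) ((Leaf 0 \<odot> Leaf 1) \<odot> Leaf 2)) (map (ev x) [t, u, v]))"
    using coh_assoc small_trees(7,8) by (intro represents_instance) (auto simp flip: numeral_3_eq_3)
  then have "represents (t \<odot> u \<odot> v) ((t \<odot> u) \<odot> v)
     (\<lambda>x. ncmp (M 3 (Leaf 0 \<odot> Leaf 1 \<odot> Leaf 2) ((Leaf 0 \<odot> Leaf 1) \<odot> Leaf 2)) [ev x t, ev x u, ev x v])"
    by (simp flip: numeral_3_eq_3)
  then show ?case by (rule represents_cong) (use coh_assoc in \<open>simp add: structure_ncmp ev_in_Ob\<close>)
next
  case (coh_lunit t)
  have "represents (graft ((!) [t]) (\<epsilon> \<odot> Leaf 0)) (graft ((!) [t]) (Leaf 0))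
     (\<lambda>x. ncmp (M (length [t]) (\<epsilon> \<odot> Leaf 0) (Leaf 0)) (map (ev x) [t]))"
    using coh_lunit small_trees by (intro represents_instance) (auto simp flip: One_nat_def)
  then have "represents (\<epsilon> \<odot> t) t (\<lambda>x. ncmp (M 1 (\<epsilon> \<odot> Leaf 0) (Leaf 0)) [ev x t])"
    by (simp flip: One_nat_def)
  then show ?case by (rule represents_cong) (use coh_lunit in \<open>simp add: structure_ncmp ev_in_Ob\<close>)
next
  case (coh_runit t)
  have "represents (graft ((!) [t]) (Leaf 0 \<odot> \<epsilon>)) (graft ((!) [t]) (Leaf 0))
     (\<lambda>x. ncmp (M (length [t]) (Leaf 0 \<odot> \<epsilon>) (Leaf 0)) (map (ev x) [t]))"
    using coh_runit small_trees by (intro represents_instance) (auto simp flip: One_nat_def)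
  then have "represents (t \<odot> \<epsilon>) t (\<lambda>x. ncmp (M 1 (Leaf 0 \<odot> \<epsilon>) (Leaf 0)) [ev x t])"
    by (simp flip: One_nat_def)
  then show ?case by (rule represents_cong) (use coh_runit in \<open>simp add: structure_ncmp ev_in_Ob\<close>)
next
  case (coh_symm t u)
  have "represents (graft ((!) [t, u]) (Leaf 1 \<odot> Leaf 0)) (graft ((!) [t, u]) (Leaf 0 \<odot> Leaf 1))
     (\<lambda>x. ncmp (M (length [t, u]) (Leaf 1 \<odot> Leaf 0) (Leaf 0 \<odot> Leaf 1)) (map (ev x) [t, u]))"
    using coh_symm small_trees by (intro represents_instance) (auto simp flip: numeral_2_eq_2)
  then have "represents (u \<odot> t) (t \<odot> u) (\<lambda>x. ncmp (M 2 (Leaf 1 \<odot> Leaf 0) (Leaf 0 \<odot> Leaf 1)) [ev x t, ev x u])"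
    by (simp flip: numeral_2_eq_2)
  then show ?case by (rule represents_cong) (use coh_symm in \<open>simp add: structure_ncmp ev_in_Ob\<close>)
qed

lemma coh_eq_M:
  assumes "coh t u a" "t \<in> trees n" "xs \<in> Ob (power_cat C n)"
  shows "ncmp (M n t u) xs = a ((!) xs)"
proof -
  have u: "wf_tree u" "set (leaves u) = set (leaves t)" using coh_wf coh_leaves(1) assms(1) by blast+
  have "ncmp (M n (relabel (\<lambda>v. v) t) (relabel (\<lambda>v. v) u)) xs = a ((!) xs)"
    using coh_represents[OF assms(1)] assms(2,3) unfolding represents_def
    by (auto simp: tree_props bij_betw_def inj_on_def)
  then show ?thesis by (simp add: relabel_ident)
qed

text \<open>Both paths compute the same component of \<open>M\<close>. The axioms of a symmetric monoidal category are instances.\<close>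

lemma coh_diagram:
  assumes "coh t u a" "coh t u b" "t \<in> trees n" "xs \<in> Ob (power_cat C n)"
  shows "a ((!) xs) = b ((!) xs)"
  using coh_eq_M[OF assms(1,3,4)] coh_eq_M[OF assms(2,3,4)] by simp

end

context tree_algebra begin

lemma natural_from_M:
  assumes t: "t \<in> trees n" "u \<in> trees n" and fs: "fs \<in> Arr (power_cat C n)"
  shows "ncmp (M n t u) (map (Cod C) fs) \<cdot> eva ((!) fs) t = eva ((!) fs) u \<cdot> ncmp (M n t u) (map (Dom C) fs)"
  using M_natural[OF t fs] amap_T_eva[OF t(1) fs] amap_T_eva[OF t(2) fs] by simp

lemma arr_from_M:
  assumes "t \<in> trees n" "u \<in> trees n" "xs \<in> Ob (power_cat C n)"
  shows "ncmp (M n t u) xs \<in> Hom C (ev ((!) xs) t) (ev ((!) xs) u)"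
  using M_arr[OF assms] omap_T_ev assms by (simp add: Hom_def)

lemma structure_functor: "tensor S \<in> functors (prod_cat C C) C"
  unfolding functors_def is_functor_def mem_Collect_eq
proof (intro conjI ballI impI)
  show "omap (tensor S) p \<in> Ob C" if "p \<in> Ob (prod_cat C C)" for p
    using that by (auto simp: prod_cat_def tensor_ob)
  show "amap (tensor S) p \<in> Hom C (omap (tensor S) (Dom (prod_cat C C) p)) (omap (tensor S) (Cod (prod_cat C C) p))"
    if "p \<in> Arr (prod_cat C C)" for p
    using that by (auto simp: prod_cat_def tensor_arr Hom_def)
  show "amap (tensor S) (Idn (prod_cat C C) p) = one (omap (tensor S) p)" if "p \<in> Ob (prod_cat C C)" for p
    using that T_id[OF small_trees(3), of "[fst p, snd p]"] by (auto simp: prod_cat_def tensor_T power_cat_small)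
  show "amap (tensor S) (Cmp (prod_cat C C) q p) = amap (tensor S) q \<cdot> amap (tensor S) p"
    if pq: "p \<in> Arr (prod_cat C C)" "q \<in> Arr (prod_cat C C)" "Dom (prod_cat C C) q = Cod (prod_cat C C) p" for p q
  proof -
    obtain f f' g g' where *: "p = (f, f')" "q = (g, g')" by (cases p, cases q)
    have a: "f \<in> Arr C" "f' \<in> Arr C" "g \<in> Arr C" "g' \<in> Arr C" "Dom C g = Cod C f" "Dom C g' = Cod C f'"
      using pq by (auto simp: * prod_cat_def)
    have "amap (T 2 dot_tree) (Cmp (power_cat C 2) [g, g'] [f, f']) = amap (T 2 dot_tree) [g, g'] \<cdot> amap (T 2 dot_tree) [f, f']"
      using a by (intro functor_comp[OF T_is_functor[OF small_trees(3)]]) (simp_all add: Hom_def power_cat_small power_cat_ops)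
    then show ?thesis using a by (simp add: * prod_cat_def tensor_T power_cat_ops)
  qed
qed (auto simp: structure_of_def sym_mon_of_def prod_cat_def)

lemma structure_natural:
  "is_natural_iso (prod_cat C (prod_cat C C)) C
     \<lparr>omap = (\<lambda>(A, B, D). A \<otimes> B \<otimes> D), amap = (\<lambda>(f, g, h). f \<star> g \<star> h)\<rparr>
     \<lparr>omap = (\<lambda>(A, B, D). (A \<otimes> B) \<otimes> D), amap = (\<lambda>(f, g, h). (f \<star> g) \<star> h)\<rparr> (assoc S)" (is ?assoc)
  "is_natural_iso C C \<lparr>omap = (\<lambda>A. I \<otimes> A), amap = (\<lambda>f. one I \<star> f)\<rparr> \<lparr>omap = (\<lambda>A. A), amap = (\<lambda>f. f)\<rparr> (lunit S)" (is ?lunit)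
  "is_natural_iso C C \<lparr>omap = (\<lambda>A. A \<otimes> I), amap = (\<lambda>f. f \<star> one I)\<rparr> \<lparr>omap = (\<lambda>A. A), amap = (\<lambda>f. f)\<rparr> (runit S)" (is ?runit)
  "is_natural_iso (prod_cat C C) C \<lparr>omap = (\<lambda>(A, B). B \<otimes> A), amap = (\<lambda>(f, g). g \<star> f)\<rparr> (tensor S) (symm S)" (is ?symm)
proof -
  have ext: "assoc S \<in> extensional (Ob (prod_cat C (prod_cat C C)))" "lunit S \<in> extensional (Ob C)"
    "runit S \<in> extensional (Ob C)" "symm S \<in> extensional (Ob (prod_cat C C))"
    by (auto simp: structure_of_def sym_mon_of_def prod_cat_def)
  show ?assoc
    unfolding is_natural_iso_def is_natural_def
    using ext(1) arr_from_M[OF small_trees(7,8), of "[_, _, _]"] M_inverse(1)[OF small_trees(7,8), of "[_, _, _]"] natural_from_M[OF small_trees(7,8), of "[_, _, _]"]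
    by (auto simp: prod_cat_def structure_ncmp power_cat_small)
  show ?lunit
    unfolding is_natural_iso_def is_natural_def
    using ext(2) arr_from_M[OF small_trees(5,1), of "[_]"] M_inverse(1)[OF small_trees(5,1), of "[_]"] natural_from_M[OF small_trees(5,1), of "[_]"]
    by (auto simp: prod_cat_def structure_ncmp power_cat_small)
  show ?runit
    unfolding is_natural_iso_def is_natural_def
    using ext(3) arr_from_M[OF small_trees(6,1), of "[_]"] M_inverse(1)[OF small_trees(6,1), of "[_]"] natural_from_M[OF small_trees(6,1), of "[_]"]
    by (auto simp: prod_cat_def structure_ncmp power_cat_small)
  show ?symm
    unfolding is_natural_iso_def is_natural_def
    using ext(4) arr_from_M[OF small_trees(4,3), of "[_, _]"] M_inverse(1)[OF small_trees(4,3), of "[_, _]"] natural_from_M[OF small_trees(4,3), of "[_, _]"]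
    by (auto simp: prod_cat_def structure_ncmp power_cat_small)
qed

lemma structure_coherent:
  "\<lbrakk>A \<in> Ob C; B \<in> Ob C; D \<in> Ob C; E \<in> Ob C\<rbrakk> \<Longrightarrow>
     \<alpha> (A \<otimes> B) D E \<cdot> \<alpha> A B (D \<otimes> E) = (\<alpha> A B D \<star> one E) \<cdot> \<alpha> A (B \<otimes> D) E \<cdot> (one A \<star> \<alpha> B D E)"
  "\<lbrakk>A \<in> Ob C; B \<in> Ob C\<rbrakk> \<Longrightarrow> (runit S A \<star> one B) \<cdot> \<alpha> A I B = one A \<star> lunit S B"
  "lunit S I = runit S I"
  "\<lbrakk>A \<in> Ob C; B \<in> Ob C\<rbrakk> \<Longrightarrow> \<tau> A B \<cdot> \<tau> B A = one (A \<otimes> B)"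
  "A \<in> Ob C \<Longrightarrow> lunit S A \<cdot> \<tau> I A = runit S A"
  "\<lbrakk>A \<in> Ob C; B \<in> Ob C; D \<in> Ob C\<rbrakk> \<Longrightarrow>
     (\<tau> A D \<star> one B) \<cdot> \<alpha> D A B \<cdot> \<tau> D (A \<otimes> B) \<cdot> \<alpha> A B D = \<alpha> A D B \<cdot> (one A \<star> \<tau> D B)"
proof -
  let ?a = "Leaf 0 :: cmon_tree" and ?b = "Leaf 1 :: cmon_tree" and ?d = "Leaf 2 :: cmon_tree" and ?e = "Leaf 3 :: cmon_tree"
  have tree4: "?a \<odot> ?b \<odot> ?d \<odot> ?e \<in> trees 4" by (auto simp: free_ops_iff)
  show "\<alpha> (A \<otimes> B) D E \<cdot> \<alpha> A B (D \<otimes> E) = (\<alpha> A B D \<star> one E) \<cdot> \<alpha> A (B \<otimes> D) E \<cdot> (one A \<star> \<alpha> B D E)"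
    if "A \<in> Ob C" "B \<in> Ob C" "D \<in> Ob C" "E \<in> Ob C" for A B D E
    using coh_diagram[OF coh_comp[OF coh_assoc[of ?a ?b "?d \<odot> ?e"] coh_assoc[of "?a \<odot> ?b" ?d ?e]]
        coh_comp[OF coh_comp[OF coh_tens[OF coh_id[of ?a] coh_assoc[of ?b ?d ?e]] coh_assoc[of ?a "?b \<odot> ?d" ?e]]
          coh_tens[OF coh_assoc[of ?a ?b ?d] coh_id[of ?e]]] tree4, of "[A, B, D, E]"] that
    by (simp add: power_cat_Ob All_less_Suc eval_nat_numeral One_nat_def)
  show "(runit S A \<star> one B) \<cdot> \<alpha> A I B = one A \<star> lunit S B" if "A \<in> Ob C" "B \<in> Ob C" for A B
  proof -
    have "?a \<odot> \<epsilon> \<odot> ?b \<in> trees 2" by (auto simp: free_ops_iff)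
    then show ?thesis
      using coh_diagram[OF coh_comp[OF coh_assoc[of ?a \<epsilon> ?b] coh_tens[OF coh_runit[of ?a] coh_id[of ?b]]]
          coh_tens[OF coh_id[of ?a] coh_lunit[of ?b]], of 2 "[A, B]"] that
      by (simp add: power_cat_small)
  qed
  show "lunit S I = runit S I"
  proof -
    have "\<epsilon> \<odot> \<epsilon> \<in> trees 0" by (auto simp: free_ops_iff)
    then show ?thesis
      using coh_diagram[OF coh_lunit[of \<epsilon>] coh_runit[of \<epsilon>], of 0 "[]"] by (simp add: power_cat_small)
  qed
  show "\<tau> A B \<cdot> \<tau> B A = one (A \<otimes> B)" if "A \<in> Ob C" "B \<in> Ob C" for A B
    using coh_diagram[OF coh_comp[OF coh_symm[of ?b ?a] coh_symm[of ?a ?b]] coh_id[of "?a \<odot> ?b"] small_trees(3), of "[A, B]"] that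
    by (simp add: power_cat_small)
  show "lunit S A \<cdot> \<tau> I A = runit S A" if "A \<in> Ob C" for A
    using coh_diagram[OF coh_comp[OF coh_symm[of \<epsilon> ?a] coh_lunit[of ?a]] coh_runit[of ?a] small_trees(6), of "[A]"] that
    by (simp add: power_cat_small)
  show "(\<tau> A D \<star> one B) \<cdot> \<alpha> D A B \<cdot> \<tau> D (A \<otimes> B) \<cdot> \<alpha> A B D = \<alpha> A D B \<cdot> (one A \<star> \<tau> D B)"
    if "A \<in> Ob C" "B \<in> Ob C" "D \<in> Ob C" for A B D
    using coh_diagram[OF coh_comp[OF coh_comp[OF coh_comp[OF coh_assoc[of ?a ?b ?d] coh_symm[of ?d "?a \<odot> ?b"]] coh_assoc[of ?d ?a ?b]]
          coh_tens[OF coh_symm[of ?a ?d] coh_id[of ?b]]]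
        coh_comp[OF coh_tens[OF coh_id[of ?a] coh_symm[of ?d ?b]] coh_assoc[of ?a ?d ?b]] small_trees(7), of "[A, B, D]"] that
    by (simp add: power_cat_small)
qed

lemma structure_sym_mon: "is_sym_mon C S"
  unfolding is_sym_mon_def Let_def
  by (intro conjI ballI structure_functor unit_ob_ob structure_natural structure_coherent; assumption)

sublocale sym_mon_cat C S
  by unfold_locales (rule structure_sym_mon)

lemma T_eq_tree_functor: "t \<in> trees n \<Longrightarrow> T n t = tree_functor n t"
  by (rule ftor.equality; simp add: tree_functor_def)
     (rule extensionalityI[OF T_ext(1)] extensionalityI[OF T_ext(2)]; simp add: omap_T_ev amap_T_eva)+

lemma M_eq_coh_trans:
  assumes t: "t \<in> trees n" "u \<in> trees n"
  shows "M n t u = coh_trans n t u"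
proof (rule ntrans.equality)
  have "ncmp (M n t u) \<in> extensional (Ob (power_cat C n))" using M_props(3)[OF t] by (simp add: is_natural_def)
  then show "ncmp (M n t u) = ncmp (coh_trans n t u)"
    by (rule extensionalityI) (simp_all add: coh_trans_def coh_eq_M[OF coh_arrow[OF t] t(1)])
qed (use M_props[OF t] in \<open>simp_all add: coh_trans_def T_eq_tree_functor t\<close>)

end

section \<open>The correspondence\<close>

lemma is_sym_mon_locale: "is_category C \<Longrightarrow> is_sym_mon C S \<Longrightarrow> sym_mon_cat C S"
  by (simp add: sym_mon_cat_def sym_mon_ops_def cat_def sym_mon_cat_axioms_def)

context cmon_categorification begin

text \<open>The inverse sends a symmetric monoidal structure to its tree algebra of coherence arrows.\<close>

lemma algebras_bij:
  assumes C: "is_category C"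
  shows "bij_betw (\<lambda>h. structure_of C (tree_T h) (tree_M h)) (algebra_structures Q C) (sym_mon_structures C)"
proof (rule bij_betw_byWitness[where f' = "\<lambda>S. algebra_of (sym_mon_ops.tree_functor C S) (sym_mon_ops.coh_trans C S)"])
  show "\<forall>h\<in>algebra_structures Q C.
      algebra_of (sym_mon_ops.tree_functor C (structure_of C (tree_T h) (tree_M h)))
        (sym_mon_ops.coh_trans C (structure_of C (tree_T h) (tree_M h))) = h"
  proof
    fix h :: "nat \<Rightarrow> ('q, 'r, ('a list, 'b list, 'a, 'b) ftor, ('a list, 'b list, 'a, 'b) ntrans) ftor"
    assume h: "h \<in> algebra_structures Q C"
    interpret H: tree_algebra C "tree_T h" "tree_M h" by (rule tree_algebra_of_algebra[OF C h])
    have "algebra_of H.tree_functor H.coh_trans = algebra_of (tree_T h) (tree_M h)"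
      by (rule algebra_of_cong) (simp_all add: H.T_eq_tree_functor H.M_eq_coh_trans)
    then show "algebra_of H.tree_functor H.coh_trans = h"
      by (simp flip: algebra_determined[OF h])
  qed
  show "(\<lambda>h. structure_of C (tree_T h) (tree_M h)) ` algebra_structures Q C \<subseteq> sym_mon_structures C"
    using tree_algebra.structure_sym_mon[OF tree_algebra_of_algebra[OF C]] by (auto simp: sym_mon_structures_def)
  have S: "sym_mon_cat C S" if "S \<in> sym_mon_structures C" for S
    using that C by (intro is_sym_mon_locale) (simp_all add: sym_mon_structures_def)
  show "\<forall>S\<in>sym_mon_structures C.
      structure_of C (tree_T (algebra_of (sym_mon_ops.tree_functor C S) (sym_mon_ops.coh_trans C S)))
        (tree_M (algebra_of (sym_mon_ops.tree_functor C S) (sym_mon_ops.coh_trans C S))) = S"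
  proof
    fix S assume "S \<in> sym_mon_structures C"
    then interpret S: sym_mon_cat C S by (rule S)
    show "structure_of C (tree_T (algebra_of S.tree_functor S.coh_trans)) (tree_M (algebra_of S.tree_functor S.coh_trans)) = S"
      using S.structure_of_tree_algebra by (simp add: structure_of_def tree_T_def tree_M_def algebra_of_b)
  qed
  show "(\<lambda>S. algebra_of (sym_mon_ops.tree_functor C S) (sym_mon_ops.coh_trans C S)) ` sym_mon_structures C \<subseteq> algebra_structures Q C"
    using sym_mon_cat.tree_algebra[OF S] algebra_of_tree_algebra by blast
qed

end

theorem mainTheorem2:
  fixes C :: "('o, 'a) category"
    and Q :: "('q, 'r) cat_operad"
    and \<phi> :: "nat \<Rightarrow> (cmon_gen, nat) optree \<Rightarrow> unit"
    and b :: "nat \<Rightarrow> ((cmon_gen, nat) optree, (cmon_gen, nat) optree, 'q, 'r) ftor"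
    and f :: "nat \<Rightarrow> ('q, 'r, unit, unit) ftor"
  defines "e \<equiv> omap (b 0) (generator 0 Gen_e)"
    and "dot \<equiv> omap (b 2) (generator 2 Gen_dot)"
    and "one \<equiv> cunit Q"
  assumes "operad_morphism (free_operad cmon_signature) terminal_operad \<phi>"
    and "is_categorification terminal_operad cmon_signature \<phi> Q b f"
    and "is_category C"
  shows "\<exists>\<delta>\<^sub>1 \<delta>\<^sub>2 \<delta>\<^sub>3 \<delta>\<^sub>4.
      Hom (cat_at Q 3) (omap (ccomp Q [1, 2]) (dot, [one, dot]))
                       (omap (ccomp Q [2, 1]) (dot, [dot, one])) = {\<delta>\<^sub>1} \<and>
      Hom (cat_at Q 1) (omap (ccomp Q [0, 1]) (dot, [e, one])) one = {\<delta>\<^sub>2} \<and>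
      Hom (cat_at Q 1) (omap (ccomp Q [1, 0]) (dot, [one, e])) one = {\<delta>\<^sub>3} \<and>
      Hom (cat_at Q 2) (omap (cact Q 2 (transpose 0 1)) dot) dot = {\<delta>\<^sub>4} \<and>
      bij_betw
        (\<lambda>h. sym_mon_of C (omap (h 2) dot) (omap (h 0) e)
               (amap (h 3) \<delta>\<^sub>1) (amap (h 1) \<delta>\<^sub>2) (amap (h 1) \<delta>\<^sub>3) (amap (h 2) \<delta>\<^sub>4))
        (algebra_structures Q C)
        (sym_mon_structures C)"
proof -
  interpret cmon_categorification Q \<phi> b f by unfold_locales fact
  let ?a = "Leaf 0 :: cmon_tree" and ?b = "Leaf 1 :: cmon_tree" and ?d = "Leaf 2 :: cmon_tree"
  have e: "e = b_ob 0 \<epsilon>" and dot: "dot = b_ob 2 (?a \<odot> ?b)" and one: "one = b_ob 1 ?a"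
    by (simp_all only: e_def dot_def one_def b_unit) (simp_all add: generator_def eval_nat_numeral One_nat_def)
  have graft: "omap (ccomp Q [k, l]) (dot, [b_ob k t, b_ob l u]) = b_ob (k + l) (t \<odot> relabel ((+) k) u)"
    if "t \<in> trees k" "u \<in> trees l" for k l t u
  proof -
    have "b_ob (sum_list [k, l]) (opcomp free_cmon [k, l] (?a \<odot> ?b) [t, u]) = omap (ccomp Q [k, l]) (b_ob (length [k, l]) (?a \<odot> ?b), map2 b_ob [k, l] [t, u])"
      using that by (intro b_graft) (auto simp: list_prod_def simp flip: numeral_2_eq_2)
    moreover have "opcomp free_cmon [k, l] (?a \<odot> ?b) [t, u] = t \<odot> relabel ((+) k) u"
      by (simp add: free_opcomp relabel_ident One_nat_def)
    ultimately show ?thesis by (simp add: dot flip: numeral_2_eq_2)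
  qed
  have act: "omap (cact Q 2 (transpose 0 1)) dot = b_ob 2 (?b \<odot> ?a)"
    unfolding dot by (subst b_act[symmetric]) (auto simp: relabel_def intro: permutes_swap_id)
  have "Hom (cat_at Q 3) (omap (ccomp Q [1, 2]) (dot, [one, dot])) (omap (ccomp Q [2, 1]) (dot, [dot, one]))
      = {arrow 3 (?a \<odot> ?b \<odot> ?d) ((?a \<odot> ?b) \<odot> ?d)}"
    using graft[of ?a 1 "?a \<odot> ?b" 2] graft[of "?a \<odot> ?b" 2 ?a 1] Hom_eq_arrow[OF small_trees(7,8)]
    unfolding one dot by (simp add: relabel_def flip: numeral_2_eq_2)
  moreover have "Hom (cat_at Q 1) (omap (ccomp Q [0, 1]) (dot, [e, one])) one = {arrow 1 (\<epsilon> \<odot> ?a) ?a}"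
    using graft[of \<epsilon> 0 ?a 1] Hom_eq_arrow[OF small_trees(5,1)]
    unfolding one e dot by (simp add: relabel_def)
  moreover have "Hom (cat_at Q 1) (omap (ccomp Q [1, 0]) (dot, [one, e])) one = {arrow 1 (?a \<odot> \<epsilon>) ?a}"
    using graft[of ?a 1 \<epsilon> 0] Hom_eq_arrow[OF small_trees(6,1)]
    unfolding one e dot by (simp add: relabel_def)
  moreover have "Hom (cat_at Q 2) (omap (cact Q 2 (transpose 0 1)) dot) dot = {arrow 2 (?b \<odot> ?a) (?a \<odot> ?b)}"
    unfolding act unfolding dot by (rule Hom_eq_arrow) simp_all
  moreover have "bij_betw (\<lambda>h. sym_mon_of C (omap (h 2) dot) (omap (h 0) e) (amap (h 3) (arrow 3 (?a \<odot> ?b \<odot> ?d) ((?a \<odot> ?b) \<odot> ?d)))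
      (amap (h 1) (arrow 1 (\<epsilon> \<odot> ?a) ?a)) (amap (h 1) (arrow 1 (?a \<odot> \<epsilon>) ?a)) (amap (h 2) (arrow 2 (?b \<odot> ?a) (?a \<odot> ?b))))
      (algebra_structures Q C) (sym_mon_structures C)"
    using algebras_bij[OF assms(6)] by (simp add: structure_of_def tree_T_def tree_M_def e dot)
  ultimately show ?thesis by blast
qed

end
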